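(* Let $n,m\in\mathbb N$, let $\Phi$ be as in the context, and let $p,q\in[1,\infty]$. (i) If $\lim_{s\to\infty}\frac{s}{\Phi(s)}=0$, then $V^mL^p(\mathbb R^n,\mu_{\Phi,n})\hookrightarrow\hookrightarrow L^q(\mathbb R^n,\mu_{\Phi,n})$ holds if and only if $q\le p$ and $q<\infty$. In particular, if $p<\infty$, then $L^p(\mathbb R^n,\mu_{\Phi,n})$ is the smallest Lebesgue space into which $V^mL^p(\mathbb R^n,\mu_{\Phi,n})$ is compactly embedded. (ii) If $\lim_{s\to\infty}\frac{s}{\Phi(s)}\in(0,\infty)$, then $V^mL^p(\mathbb R^n,\mu_{\Phi,n})\hookrightarrow\hookrightarrow L^q(\mathbb R^n,\mu_{\Phi,n})$ holds if and only if $q<p$.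
   Context: $\Phi:[0,\infty)\to[0,\infty)$ is strictly increasing, convex, twice continuously differentiable on $(0,\infty)$, $\sqrt\Phi$ is concave on $[0,\infty)$, and $\Phi(0)=0$. $d\mu_\Phi(x)=c_\Phi e^{-\Phi(|x|)}dx$ on $\mathbb R$ with $c_\Phi>0$ chosen so that $\mu_\Phi(\mathbb R)=1$, and $\mu_{\Phi,n}=\mu_\Phi\times\dots\times\mu_\Phi$ ($n$ factors) on $\mathbb R^n$. $V^mL^p(\mathbb R^n,\mu_{\Phi,n})$ is the space of $m$-times weakly differentiable $u$ on $\mathbb R^n$ with $|\nabla^mu|\in L^p(\mathbb R^n,\mu_{\Phi,n})$, normed by $\sum_{k=0}^{m-1}\||\nabla^ku|\|_{L^1(\mu_{\Phi,n})}+\||\nabla^mu|\|_{L^p(\mu_{\Phi,n})}$; $\hookrightarrow\hookrightarrow$ denotes compact embedding. *)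

theory Defs
  imports "HOL-Analysis.Analysis" "HOL-Probability.Essential_Supremum"
begin

definition admissible_Phi :: "(real \<Rightarrow> real) \<Rightarrow> bool" where
  "admissible_Phi \<Phi> \<longleftrightarrow>
     (\<forall>x\<ge>0. \<Phi> x \<ge> 0) \<and>
     strict_mono_on {0..} \<Phi> \<and>
     convex_on {0..} \<Phi> \<and>
     (\<exists>\<Phi>' \<Phi>''. (\<forall>x>0. (\<Phi> has_real_derivative \<Phi>' x) (at x) \<and>
                           (\<Phi>' has_real_derivative \<Phi>'' x) (at x))
                 \<and> continuous_on {0<..} \<Phi>'') \<and>
     concave_on {0..} (\<lambda>x. sqrt (\<Phi> x)) \<and>
     \<Phi> 0 = 0"

definition c_Phi :: "(real \<Rightarrow> real) \<Rightarrow> real" where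
  "c_Phi \<Phi> = 1 / (\<integral>x. exp (- \<Phi> \<bar>x\<bar>) \<partial>lborel)"

definition mu_Phi :: "(real \<Rightarrow> real) \<Rightarrow> real measure" where
  "mu_Phi \<Phi> = density lborel (\<lambda>x. ennreal (c_Phi \<Phi> * exp (- \<Phi> \<bar>x\<bar>)))"

text \<open>The n-fold product measure on R^n, realised as the measure with the
  product density with respect to Lebesgue measure on R^n.\<close>
definition mu_Phi_n :: "(real \<Rightarrow> real) \<Rightarrow> (real ^ 'n) measure" where
  "mu_Phi_n \<Phi> = density lborel
     (\<lambda>x. ennreal (\<Prod>i\<in>UNIV. c_Phi \<Phi> * exp (- \<Phi> \<bar>x $ i\<bar>)))"

definition memLp :: "'a measure \<Rightarrow> ereal \<Rightarrow> ('a \<Rightarrow> real) \<Rightarrow> bool" where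
  "memLp M p f \<longleftrightarrow> f \<in> borel_measurable M \<and>
     (if p = \<infinity> then esssup M (\<lambda>x. ereal \<bar>f x\<bar>) < \<infinity>
      else integrable M (\<lambda>x. \<bar>f x\<bar> powr real_of_ereal p))"

definition Lnorm :: "'a measure \<Rightarrow> ereal \<Rightarrow> ('a \<Rightarrow> real) \<Rightarrow> real" where
  "Lnorm M p f =
     (if p = \<infinity> then real_of_ereal (esssup M (\<lambda>x. ereal \<bar>f x\<bar>))
      else (\<integral>x. \<bar>f x\<bar> powr real_of_ereal p \<partial>M) powr (1 / real_of_ereal p))"

definition pdiff :: "'n::finite \<Rightarrow> (real ^ 'n \<Rightarrow> real) \<Rightarrow> real ^ 'n \<Rightarrow> real" where
  "pdiff i f x = deriv (\<lambda>t. f (x + t *\<^sub>R axis i 1)) 0"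

fun ipdiff :: "'n::finite list \<Rightarrow> (real ^ 'n \<Rightarrow> real) \<Rightarrow> real ^ 'n \<Rightarrow> real" where
  "ipdiff [] f = f"
| "ipdiff (i # is) f = pdiff i (ipdiff is f)"

definition smooth_fun :: "(real ^ 'n::finite \<Rightarrow> real) \<Rightarrow> bool" where
  "smooth_fun f \<longleftrightarrow> (\<forall>is. continuous_on UNIV (ipdiff is f) \<and>
      (\<forall>i x. (\<lambda>t. ipdiff is f (x + t *\<^sub>R axis i 1)) differentiable (at 0)))"

definition test_fun :: "(real ^ 'n::finite \<Rightarrow> real) \<Rightarrow> bool" where
  "test_fun \<phi> \<longleftrightarrow> smooth_fun \<phi> \<and> compact (closure {x. \<phi> x \<noteq> 0})"

definition loc_integrable :: "(real ^ 'n::finite \<Rightarrow> real) \<Rightarrow> bool" where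
  "loc_integrable u \<longleftrightarrow> u \<in> borel_measurable lborel \<and>
     (\<forall>K. compact K \<longrightarrow> set_integrable lborel K u)"

definition weak_derivs :: "nat \<Rightarrow> (real ^ 'n::finite \<Rightarrow> real) \<Rightarrow> ('n list \<Rightarrow> real ^ 'n \<Rightarrow> real) \<Rightarrow> bool" where
  "weak_derivs m u D \<longleftrightarrow> D [] = u \<and>
     (\<forall>is. length is \<le> m \<longrightarrow> loc_integrable (D is) \<and>
        (\<forall>\<phi>. test_fun \<phi> \<longrightarrow>
           (\<integral>x. u x * ipdiff is \<phi> x \<partial>lborel) = (-1) ^ length is * (\<integral>x. D is x * \<phi> x \<partial>lborel)))"

definition grad_norm :: "('n::finite list \<Rightarrow> real ^ 'n \<Rightarrow> real) \<Rightarrow> nat \<Rightarrow> real ^ 'n \<Rightarrow> real" where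
  "grad_norm D k x = sqrt (\<Sum>is\<in>{is. length is = k}. (D is x)\<^sup>2)"

definition in_VmLp :: "(real \<Rightarrow> real) \<Rightarrow> nat \<Rightarrow> ereal \<Rightarrow> (real ^ 'n::finite \<Rightarrow> real) \<Rightarrow> ('n list \<Rightarrow> real ^ 'n \<Rightarrow> real) \<Rightarrow> bool" where
  "in_VmLp \<Phi> m p u D \<longleftrightarrow> weak_derivs m u D \<and>
     (\<forall>k<m. memLp (mu_Phi_n \<Phi>) 1 (grad_norm D k)) \<and> memLp (mu_Phi_n \<Phi>) p (grad_norm D m)"

definition VmLp_norm :: "(real \<Rightarrow> real) \<Rightarrow> nat \<Rightarrow> ereal \<Rightarrow> ('n::finite list \<Rightarrow> real ^ 'n \<Rightarrow> real) \<Rightarrow> real" where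
  "VmLp_norm \<Phi> m p D =
     (\<Sum>k<m. Lnorm (mu_Phi_n \<Phi>) 1 (grad_norm D k)) + Lnorm (mu_Phi_n \<Phi>) p (grad_norm D m)"

definition compact_emb :: "(real \<Rightarrow> real) \<Rightarrow> 'n::finite itself \<Rightarrow> nat \<Rightarrow> ereal \<Rightarrow> ereal \<Rightarrow> bool" where
  "compact_emb \<Phi> _ m p q \<longleftrightarrow>
     (\<forall>(u :: real ^ 'n \<Rightarrow> real) D. in_VmLp \<Phi> m p u D \<longrightarrow> memLp (mu_Phi_n \<Phi>) q u) \<and>
     (\<forall>(u :: nat \<Rightarrow> real ^ 'n \<Rightarrow> real) D C.
        (\<forall>j. in_VmLp \<Phi> m p (u j) (D j) \<and> VmLp_norm \<Phi> m p (D j) \<le> C) \<longrightarrow>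
        (\<exists>r g. strict_mono r \<and> memLp (mu_Phi_n \<Phi>) q g \<and>
           (\<lambda>j. Lnorm (mu_Phi_n \<Phi>) q (\<lambda>x. u (r j) x - g x)) \<longlonglongrightarrow> 0))"

end

theory Submission
  imports Defs "HOL-Computational_Algebra.Polynomial" "HOL-Probability.Distributions"
    "HOL-Library.Diagonal_Subsequence"
begin

text \<open>
  A weakly differentiable function satisfies, for every vector \<open>z\<close> and almost every \<open>x\<close>, the increment bound
  \<open>\<bar>v (x + z) - v x\<bar> \<le> norm z * (\<integral> t in {0..1}. G (x + t z))\<close> with \<open>G\<close> the \<open>l\<^sup>1\<close> norm of the weak gradient.
  Integrating it against the log-concave weight for outward coordinate translations bounds the tails of \<open>v\<close>,
  integrating it over small cubes gives a local Poincare inequality. Together they lift \<open>L\<^sup>1\<close> bounds on lower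
  derivatives to \<open>L\<^sup>p\<close> bounds, and reduce compactness to uniform smallness of the tails: a diagonal
  subsequence along which all averages over dyadic cubes converge is Cauchy. For superlinear \<open>\<Phi>\<close> the tails are
  uniformly small in \<open>L\<^sup>p\<close> itself; in general they are so in \<open>L\<^sup>q\<close> with \<open>q < p\<close>, by interpolation with
  the finite total mass.

  Conversely, a power of one coordinate is unbounded, which excludes \<open>q = \<infinity>\<close>, and normalised bumps escaping
  to infinity in one coordinate direction exclude \<open>q > p\<close> (by concavity of \<open>sqrt \<circ> \<Phi>\<close>, which makes
  \<open>\<Phi> (s + 1) / \<Phi> (s - 1)\<close> tend to 1) and, for linear growth, also \<open>q = p\<close>.
\<close>

section \<open>Power means and translations\<close>

text \<open>The norm controls only first moments of the derivatives of order below \<open>m\<close>,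
  and the tail bound for one derivative involves higher moments of the derivatives one order up; so
  integrability is lifted order by order, from \<open>m\<close> down to 0. The p-th moment of
  \<open>v\<close> stands on both sides of the tail bound. Convexity and \<Phi>(0) = 0 make
  \<Phi>(R)/R nondecreasing, hence bounded away from 0 for R \<ge> 1, so a long outward translation
  has a factor below 1 and the moment can be absorbed, for every admissible \<Phi>. Small tails ask
  for more: a short translation, to keep the increments cheap, and still a small factor, which is
  available once \<Phi>(R)/R tends to infinity. This is where the two cases part. The positive
  statements are proved for real exponents \<open>q\<close>; p = \<infinity> enters through the
  bound of finite moments by the essential supremum. The bumps are scaled to have bounded L^p norms;
  their L^q norms are then governed by the difference of (q/p) \<Phi>(s-1) and \<Phi>(s+1).\<close>

lemma powr_add_le:
  fixes a b p :: real
  assumes "0 \<le> a" "0 \<le> b" "0 \<le> p"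
  shows "(a + b) powr p \<le> 2 powr p * (a powr p + b powr p)"
proof -
  have "(a + b) powr p \<le> (2 * max a b) powr p"
    using assms by (intro powr_mono2) auto
  also have "\<dots> = 2 powr p * max a b powr p"
    using assms by (simp add: powr_mult)
  also have "max a b powr p \<le> a powr p + b powr p"
    by (auto simp: max_def)
  finally show ?thesis by simp
qed

text \<open>The graph of \<open>t powr p\<close> lies above its tangent at \<open>b\<close>; this is
  the rearranged inequality. It follows from Young's inequality with weights 1/p and (p-1)/p, which
  asks for positive arguments, hence the separate degenerate cases.\<close>

lemma powr_tangent_le:
  fixes b f p :: real
  assumes "0 \<le> b" "0 \<le> f" "1 \<le> p"
  shows "p * (b powr (p - 1) * f) \<le> f powr p + (p - 1) * b powr p"
proof (cases "p = 1 \<or> b = 0 \<or> f = 0")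
  case True
  then show ?thesis using assms by (auto simp: powr_def)
next
  case False
  then have p: "p > 1" and pos: "b > 0" "f > 0" using assms by auto
  have "(f powr p) powr (1/p) * (b powr p) powr ((p-1)/p) \<le> 1/p * f powr p + ((p-1)/p) * b powr p"
    using p pos by (intro Youngs_inequality_0) (auto simp: field_simps)
  also have "(f powr p) powr (1/p) * (b powr p) powr ((p-1)/p) = f * b powr (p-1)"
    using p pos by (simp add: powr_powr)
  finally show ?thesis using p by (simp add: field_simps)
qed

lemma nn_integral_powr_Jensen:
  fixes f :: "'a \<Rightarrow> real" and a c p :: real
  assumes M: "emeasure M (space M) = ennreal c" and c: "c > 0"
    and f[measurable]: "f \<in> borel_measurable M" and f0: "\<And>x. f x \<ge> 0" and p: "1 \<le> p"
    and a: "0 \<le> a" "ennreal a \<le> (\<integral>\<^sup>+x. ennreal (f x) \<partial>M)"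
  shows "ennreal (a powr p) \<le> ennreal (c powr (p - 1)) * (\<integral>\<^sup>+x. ennreal (f x powr p) \<partial>M)"
proof (cases "(\<integral>\<^sup>+x. ennreal (f x powr p) \<partial>M) = \<infinity>")
  case True
  then show ?thesis using c by (simp add: ennreal_mult_top)
next
  case False
  define b where "b = a / c"
  have b: "b \<ge> 0" using a c by (simp add: b_def)
  obtain I where I: "(\<integral>\<^sup>+x. ennreal (f x powr p) \<partial>M) = ennreal I" "I \<ge> 0"
    using False by (cases "(\<integral>\<^sup>+x. ennreal (f x powr p) \<partial>M)") auto
  have "ennreal (p * b powr (p-1)) * ennreal a \<le> ennreal (p * b powr (p-1)) * (\<integral>\<^sup>+x. ennreal (f x) \<partial>M)"
    using a by (intro mult_left_mono) auto
  also have "\<dots> = (\<integral>\<^sup>+x. ennreal (p * (b powr (p-1) * f x)) \<partial>M)"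
    using p b f0 by (subst nn_integral_cmult[symmetric]) (auto simp: ennreal_mult'[symmetric] mult.assoc intro!: nn_integral_cong)
  also have "\<dots> \<le> (\<integral>\<^sup>+x. ennreal (f x powr p) + ennreal ((p-1) * b powr p) \<partial>M)"
    using p b f0 by (intro nn_integral_mono) (auto simp: ennreal_plus[symmetric] simp del: ennreal_plus intro!: ennreal_leI powr_tangent_le)
  also have "\<dots> = ennreal I + ennreal ((p-1) * b powr p) * ennreal c"
    by (subst nn_integral_add) (auto simp: I M)
  also have "\<dots> = ennreal (I + (p-1) * b powr p * c)"
    using I c p by (simp add: ennreal_mult'[symmetric] ennreal_plus[symmetric] del: ennreal_plus)
  finally have "p * b powr (p-1) * a \<le> I + (p-1) * b powr p * c"
    using p a c I b by (subst (asm) ennreal_mult'[symmetric]) (auto simp: ennreal_le_iff mult.assoc simp del: ennreal_plus)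
  moreover have "b powr (p-1) * a = b powr p * c"
  proof (cases "b = 0")
    case False
    then have "b powr p = b powr (p-1) * b" using b powr_add[of b "p-1" 1] by simp
    then show ?thesis using c by (simp add: b_def)
  qed (use c a in \<open>simp add: b_def\<close>)
  ultimately have "p * (b powr p * c) \<le> I + (p - 1) * (b powr p * c)" by (simp add: mult.assoc)
  then have "b powr p * c \<le> I" by (simp add: left_diff_distrib)
  moreover have "a powr p = c powr (p - 1) * (b powr p * c)"
  proof -
    have "a powr p = (b * c) powr p" using c by (simp add: b_def)
    also have "\<dots> = b powr p * (c powr (p - 1) * c)"
      using b c powr_add[of c "p-1" 1] by (simp add: powr_mult)
    finally show ?thesis by simp
  qed
  ultimately have "a powr p \<le> c powr (p-1) * I"
    by (simp add: mult_left_mono)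
  then have "ennreal (a powr p) \<le> ennreal (c powr (p-1) * I)" by (rule ennreal_leI)
  then show ?thesis using I by (simp add: ennreal_mult' )
qed

section \<open>Translation invariance of Lebesgue integrals\<close>

lemma nn_integral_lborel_shift:
  fixes f :: "'a::euclidean_space \<Rightarrow> ennreal"
  assumes [measurable]: "f \<in> borel_measurable borel"
  shows "(\<integral>\<^sup>+x. f (x + z) \<partial>lborel) = (\<integral>\<^sup>+x. f x \<partial>lborel)"
proof -
  have "(\<integral>\<^sup>+x. f x \<partial>lborel) = (\<integral>\<^sup>+x. f x \<partial>distr lborel borel ((+) z))"
    by (simp add: lborel_distr_plus)
  also have "\<dots> = (\<integral>\<^sup>+x. f (z + x) \<partial>lborel)" by (subst nn_integral_distr) auto
  finally show ?thesis by (simp add: add.commute)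
qed

lemma integral_lborel_shift:
  fixes f :: "'a::euclidean_space \<Rightarrow> real"
  assumes [measurable]: "f \<in> borel_measurable borel"
  shows "(\<integral>x. f (x + z) \<partial>lborel) = (\<integral>x. f x \<partial>lborel)"
proof -
  have "(\<integral>x. f x \<partial>lborel) = (\<integral>x. f x \<partial>distr lborel borel ((+) z))"
    by (simp add: lborel_distr_plus)
  also have "\<dots> = (\<integral>x. f (z + x) \<partial>lborel)" by (subst integral_distr) auto
  finally show ?thesis by (simp add: add.commute)
qed

lemma integrable_lborel_shift:
  fixes f :: "'a::euclidean_space \<Rightarrow> real"
  assumes "integrable lborel f"
  shows "integrable lborel (\<lambda>x. f (x + z))"
proof -
  have "integrable (distr lborel borel ((+) z)) f" using assms by (simp add: lborel_distr_plus)
  moreover have "f \<in> borel_measurable borel" using assms by auto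
  ultimately have "integrable lborel (\<lambda>x. f (z + x))" by (subst (asm) integrable_distr_eq) auto
  then show ?thesis by (simp add: add.commute)
qed

section \<open>Smooth bump functions\<close>

text \<open>The derivative relation is demanded at every order because \<open>deriv\<close> returns
  an unspecified value where no derivative exists.\<close>

definition smooth1 :: "(real \<Rightarrow> real) \<Rightarrow> bool" where
  "smooth1 f \<longleftrightarrow> (\<forall>k x. ((deriv ^^ k) f has_real_derivative (deriv ^^ Suc k) f x) (at x))"

text \<open>Lets iterated \<open>deriv\<close> be computed from a guessed chain of derivatives, each
  link of which is checked by one differentiation.\<close>

lemma smooth1_eq:
  assumes "F 0 = f" and "\<And>k x. (F k has_real_derivative F (Suc k) x) (at x)"
  shows "(deriv ^^ k) f = F k"
proof (induction k)
  case (Suc k)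
  then show ?case using DERIV_imp_deriv[OF assms(2)[of k]] by auto
qed (simp add: assms)

lemma smooth1I:
  assumes "F 0 = f" and "\<And>k x. (F k has_real_derivative F (Suc k) x) (at x)"
  shows "smooth1 f"
  unfolding smooth1_def smooth1_eq[of F, OF assms] by (simp add: assms(2))

lemma smooth1_deriv: "smooth1 f \<Longrightarrow> ((deriv ^^ k) f has_real_derivative (deriv ^^ Suc k) f x) (at x)"
  by (simp add: smooth1_def)

lemma smooth1_continuous: "smooth1 f \<Longrightarrow> continuous_on UNIV ((deriv ^^ k) f)"
  by (rule DERIV_continuous_on) (rule has_field_derivative_at_within, erule smooth1_deriv)

text \<open>An auxiliary notion with an existentially quantified derivative: closure under products
  is then a plain induction on the order, while iterated \<open>deriv\<close> would call for the
  general Leibniz formula.\<close>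

fun ndiff :: "nat \<Rightarrow> (real \<Rightarrow> real) \<Rightarrow> bool" where
  "ndiff 0 f = True"
| "ndiff (Suc n) f = (\<exists>f'. (\<forall>x. (f has_real_derivative f' x) (at x)) \<and> ndiff n f')"

lemma ndiff_Suc_D: "ndiff (Suc n) f \<Longrightarrow> ndiff n f"
proof (induction n arbitrary: f)
  case (Suc n)
  obtain f' where f': "\<And>x. (f has_real_derivative f' x) (at x)" "ndiff (Suc n) f'"
    using Suc.prems unfolding ndiff.simps(2)[of "Suc n"] by blast
  with Suc.IH have "ndiff n f'" by blast
  with f' show ?case unfolding ndiff.simps by blast
qed simp

lemma ndiff_add: "ndiff n f \<Longrightarrow> ndiff n g \<Longrightarrow> ndiff n (\<lambda>x. f x + g x)"
proof (induction n arbitrary: f g)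
  case (Suc n)
  obtain f' g' where "\<forall>x. (f has_real_derivative f' x) (at x)" "ndiff n f'"
    "\<forall>x. (g has_real_derivative g' x) (at x)" "ndiff n g'" using Suc.prems by auto
  then have "\<forall>x. ((\<lambda>x. f x + g x) has_real_derivative (f' x + g' x)) (at x)" "ndiff n (\<lambda>x. f' x + g' x)"
    using Suc.IH by (auto intro!: derivative_intros)
  then show ?case unfolding ndiff.simps by (intro exI conjI)
qed simp

lemma ndiff_mult: "ndiff n f \<Longrightarrow> ndiff n g \<Longrightarrow> ndiff n (\<lambda>x. f x * g x)"
proof (induction n arbitrary: f g)
  case (Suc n)
  obtain f' g' where d: "\<forall>x. (f has_real_derivative f' x) (at x)" "ndiff n f'"
    "\<forall>x. (g has_real_derivative g' x) (at x)" "ndiff n g'" using Suc.prems by auto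
  then have "\<forall>x. ((\<lambda>x. f x * g x) has_real_derivative (f' x * g x + f x * g' x)) (at x)"
    by (auto intro!: derivative_eq_intros)
  moreover have "ndiff n (\<lambda>x. f' x * g x + f x * g' x)"
    using d Suc.IH ndiff_Suc_D[OF Suc.prems(1)] ndiff_Suc_D[OF Suc.prems(2)] by (intro ndiff_add) auto
  ultimately show ?case unfolding ndiff.simps by (intro exI conjI)
qed simp

lemma ndiff_smooth1: "(\<And>n. ndiff n f) \<Longrightarrow> smooth1 f"
proof -
  assume n: "\<And>n. ndiff n f"
  have "\<forall>f. (\<forall>n. ndiff n f) \<longrightarrow> (\<forall>n. ndiff n ((deriv ^^ k) f))" for k
  proof (induction k)
    case (Suc k)
    show ?case
    proof (intro allI impI)
      fix f n assume "\<forall>n. ndiff n f"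
      then have "ndiff (Suc n) ((deriv ^^ k) f)" using Suc by blast
      then obtain f' where "\<forall>x. ((deriv ^^ k) f has_real_derivative f' x) (at x)" "ndiff n f'" by auto
      then have "deriv ((deriv ^^ k) f) = f'" by (auto intro!: ext DERIV_imp_deriv)
      then show "ndiff n ((deriv ^^ Suc k) f)" using \<open>ndiff n f'\<close> by simp
    qed
  qed simp
  then have "ndiff (Suc 0) ((deriv ^^ k) f)" for k using n by blast
  then have "\<exists>f'. \<forall>x. ((deriv ^^ k) f has_real_derivative f' x) (at x)" for k by auto
  then have "((deriv ^^ k) f has_real_derivative deriv ((deriv ^^ k) f) x) (at x)" for k x
    using DERIV_imp_deriv by (metis (no_types, lifting))
  then show ?thesis unfolding smooth1_def by simp
qed

lemma smooth1_ndiff: "smooth1 f \<Longrightarrow> ndiff n f"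
proof -
  assume "smooth1 f"
  then have "ndiff n ((deriv ^^ k) f)" for k
  proof (induction n arbitrary: k)
    case (Suc n)
    show ?case unfolding ndiff.simps
      by (rule exI[of _ "(deriv ^^ Suc k) f"]) (use smooth1_deriv[OF Suc.prems] Suc in blast)
  qed simp
  from this[of 0] show ?thesis by simp
qed

lemma smooth1_mult: "smooth1 f \<Longrightarrow> smooth1 g \<Longrightarrow> smooth1 (\<lambda>x. f x * g x)"
  by (rule ndiff_smooth1, rule ndiff_mult) (simp_all add: smooth1_ndiff)

lemma smooth1_affine:
  assumes "smooth1 f"
  shows "smooth1 (\<lambda>x. f (a * x + b))"
proof (rule smooth1I[where F="\<lambda>k x. a ^ k * (deriv ^^ k) f (a * x + b)"])
  fix k x
  have "((\<lambda>x. (deriv ^^ k) f (a * x + b)) has_real_derivative (deriv ^^ Suc k) f (a * x + b) * a) (at x)"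
    by (rule DERIV_chain2[OF smooth1_deriv[OF assms]]) (auto intro!: derivative_eq_intros)
  from DERIV_cmult[OF this, of "a ^ k"]
  show "((\<lambda>x. a ^ k * (deriv ^^ k) f (a * x + b)) has_real_derivative a ^ Suc k * (deriv ^^ Suc k) f (a * x + b)) (at x)"
    by (simp add: mult_ac)
qed simp

text \<open>Cauchy's flat function: every derivative tends to 0 at the origin, so the two branches
  fit together smoothly.\<close>

definition bump0 :: "real \<Rightarrow> real" where
  "bump0 x = (if x > 0 then exp (- (1 / x)) else 0)"

text \<open>For x > 0 the k-th derivative of exp(-1/x) is P_k(y) exp(-y) with y = 1/x. Since d/dx
  equals -y^2 d/dy, the polynomials satisfy P_(k+1) = y^2 (P_k - P_k').\<close>

primrec bump_poly :: "nat \<Rightarrow> real poly" where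
  "bump_poly 0 = 1"
| "bump_poly (Suc k) = [:0, 0, 1:] * (bump_poly k - pderiv (bump_poly k))"

lemma poly_times_exp_tendsto_0: "((\<lambda>y. poly P y * exp (- y)) \<longlongrightarrow> 0) at_top" for P :: "real poly"
proof -
  have "((\<lambda>y. \<Sum>i\<le>degree P. coeff P i * (y ^ i / exp y)) \<longlongrightarrow> (\<Sum>i\<le>degree P. coeff P i * 0)) at_top"
    by (intro tendsto_sum tendsto_mult tendsto_const tendsto_power_div_exp_0)
  then show ?thesis by (simp add: poly_altdef sum_distrib_right exp_minus divide_inverse mult.assoc)
qed

lemma bump0_smooth: "smooth1 bump0"
proof (rule smooth1I)
  define F where "F k x = (if x > 0 then poly (bump_poly k) (1 / x) * exp (- (1 / x)) else 0)" for k and x :: real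
  show "F 0 = bump0" by (auto simp: F_def bump0_def fun_eq_iff)
  fix k and x :: real
  consider "x > 0" | "x < 0" | "x = 0" by linarith
  then show "(F k has_real_derivative F (Suc k) x) (at x)"
  proof cases
    case 1
    have "((\<lambda>x. poly (bump_poly k) (1 / x)) has_real_derivative poly (pderiv (bump_poly k)) (1 / x) * (- 1 / x\<^sup>2)) (at x)"
      using 1 by (intro DERIV_chain2[OF poly_DERIV]) (auto intro!: derivative_eq_intros simp: power2_eq_square)
    moreover have "((\<lambda>x. exp (- (1 / x))) has_real_derivative exp (- (1 / x)) * (1 / x\<^sup>2)) (at x)"
      using 1 by (auto intro!: derivative_eq_intros simp: power2_eq_square)
    ultimately have "((\<lambda>x. poly (bump_poly k) (1 / x) * exp (- (1 / x))) has_real_derivative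
        poly (pderiv (bump_poly k)) (1 / x) * (- 1 / x\<^sup>2) * exp (- (1 / x)) + exp (- (1 / x)) * (1 / x\<^sup>2) * poly (bump_poly k) (1 / x)) (at x)"
      by (rule DERIV_mult)
    also have "poly (pderiv (bump_poly k)) (1 / x) * (- 1 / x\<^sup>2) * exp (- (1 / x)) + exp (- (1 / x)) * (1 / x\<^sup>2) * poly (bump_poly k) (1 / x) = F (Suc k) x"
      using 1 by (simp add: F_def power2_eq_square algebra_simps)
    finally show ?thesis
      by (rule has_field_derivative_transform_within_open[where S="{0<..}"]) (use 1 in \<open>auto simp: F_def\<close>)
  next
    case 2
    have "((\<lambda>x. 0) has_real_derivative F (Suc k) x) (at x)" using 2 by (simp add: F_def)
    then show ?thesis
      by (rule has_field_derivative_transform_within_open[where S="{..<0}"]) (use 2 in \<open>auto simp: F_def\<close>)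
  next
    case 3
    \<comment> \<open>At the origin the right difference quotient is y P_k(y) exp(-y) with y = 1/h,
      so the exponential wins as y tends to infinity; the left quotient is identically 0.\<close>
    have "((\<lambda>h. poly ([:0,1:] * bump_poly k) (inverse h) * exp (- (inverse h))) \<longlongrightarrow> 0) (at_right 0)"
      by (rule filterlim_compose[OF poly_times_exp_tendsto_0 filterlim_inverse_at_top_right])
    then have "((\<lambda>h. (F k (0 + h) - F k 0) / h) \<longlongrightarrow> 0) (at_right 0)"
      by (rule Lim_transform_eventually) (rule eventually_at_rightI[of 0 1], simp_all add: F_def divide_inverse)
    moreover have "((\<lambda>h. (F k (0 + h) - F k 0) / h) \<longlongrightarrow> 0) (at_left 0)"
      by (rule Lim_transform_eventually[OF tendsto_const]) (rule eventually_at_leftI[of "-1" 0], simp_all add: F_def)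
    ultimately have "((\<lambda>h. (F k (0 + h) - F k 0) / h) \<longlongrightarrow> 0) (at 0)"
      by (simp add: filterlim_at_split)
    moreover have "F (Suc k) x = 0" using 3 by (simp add: F_def)
    ultimately show ?thesis unfolding DERIV_def 3 by simp
  qed
qed

lemma bump0_bounds: "0 \<le> bump0 x" "bump0 x \<le> 1"
  by (auto simp: bump0_def)

text \<open>The parameter \<open>k\<close> is a steepness: exp(-1/(k y)) tends to 1 for every y > 0,
  so the bumps converge pointwise to the indicator of the open interval from \<open>a\<close> to
  \<open>b\<close>.\<close>

definition bump :: "real \<Rightarrow> real \<Rightarrow> real \<Rightarrow> real \<Rightarrow> real" where
  "bump k a b x = bump0 (k * (x - a)) * bump0 (k * (b - x))"

lemma bump_smooth: "smooth1 (bump k a b)"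
proof -
  have "bump k a b = (\<lambda>x. bump0 (k * x + (- k * a)) * bump0 ((- k) * x + k * b))"
    by (auto simp: bump_def algebra_simps)
  then show ?thesis
    by (simp only: smooth1_mult smooth1_affine bump0_smooth)
qed

lemma bump_bounds: "0 \<le> bump k a b x" "bump k a b x \<le> 1"
  by (auto simp: bump_def bump0_bounds mult_le_one)

lemma bump_outside: "k > 0 \<Longrightarrow> \<not> (a < x \<and> x < b) \<Longrightarrow> bump k a b x = 0"
  by (cases "x \<le> a") (auto simp: bump_def bump0_def zero_less_mult_iff)

lemma bump_tendsto: "(\<lambda>n. bump (real (Suc n)) a b x) \<longlonglongrightarrow> indicator {a<..<b} x"
proof -
  have *: "(\<lambda>n. bump0 (real (Suc n) * y)) \<longlonglongrightarrow> (if y > 0 then 1 else 0)" for y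
  proof (cases "y > 0")
    case True
    have "(\<lambda>n. exp (- (inverse (real (Suc n)) * (1 / y)))) \<longlonglongrightarrow> exp (- (0 * (1 / y)))"
      by (intro tendsto_intros LIMSEQ_inverse_real_of_nat)
    moreover have "bump0 (real (Suc n) * y) = exp (- (inverse (real (Suc n)) * (1 / y)))" for n
      using True by (simp add: bump0_def divide_inverse)
    ultimately show ?thesis using True by simp
  qed (simp add: bump0_def zero_less_mult_iff)
  have "(\<lambda>n. bump (real (Suc n)) a b x) \<longlonglongrightarrow> (if x - a > 0 then 1 else 0) * (if b - x > 0 then 1 else 0)"
    unfolding bump_def by (intro tendsto_mult *)
  moreover have "(if x - a > 0 then 1 else 0) * (if b - x > 0 then 1 else 0) = (indicator {a<..<b} x :: real)"
    by (simp add: indicator_def)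
  ultimately show ?thesis by simp
qed

section \<open>Weak gradients and translations\<close>

text \<open>Tensor products of smooth factors are mapped to such products by each partial
  derivative, so smoothness in the sense of \<open>smooth_fun\<close> reduces to one
  variable.\<close>

definition tprod :: "('n::finite \<Rightarrow> real \<Rightarrow> real) \<Rightarrow> real ^ 'n \<Rightarrow> real" where
  "tprod f x = (\<Prod>i\<in>UNIV. f i (x $ i))"

lemma tprod_line_deriv:
  fixes f :: "'n::finite \<Rightarrow> real \<Rightarrow> real"
  assumes "\<And>i. smooth1 (f i)"
  shows "((\<lambda>t. tprod f (x + t *\<^sub>R z)) has_real_derivative
     (\<Sum>i\<in>UNIV. z $ i * tprod (f(i := deriv (f i))) (x + t *\<^sub>R z))) (at t)"
proof -
  have d: "((\<lambda>t. f i ((x + t *\<^sub>R z) $ i)) has_real_derivative deriv (f i) ((x + t *\<^sub>R z) $ i) * z $ i) (at t)" for i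
  proof -
    have "(f i has_real_derivative deriv (f i) ((x + t *\<^sub>R z) $ i)) (at ((x + t *\<^sub>R z) $ i))"
      using smooth1_deriv[OF assms, where k=0] by simp
    then show ?thesis
      by (rule DERIV_chain2) (auto intro!: derivative_eq_intros)
  qed
  have "((\<lambda>t. tprod f (x + t *\<^sub>R z)) has_real_derivative
     (\<Sum>i\<in>UNIV. (deriv (f i) ((x + t *\<^sub>R z) $ i) * z $ i) * (\<Prod>j\<in>UNIV - {i}. f j ((x + t *\<^sub>R z) $ j)))) (at t)"
    unfolding tprod_def has_field_derivative_def
    by (rule has_derivative_eq_rhs[OF has_derivative_prod[OF d[unfolded has_field_derivative_def]]])
       (auto simp: sum_distrib_left sum_distrib_right fun_eq_iff mult_ac intro!: sum.cong)
  also have "(\<Sum>i\<in>UNIV. (deriv (f i) ((x + t *\<^sub>R z) $ i) * z $ i) * (\<Prod>j\<in>UNIV - {i}. f j ((x + t *\<^sub>R z) $ j)))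
     = (\<Sum>i\<in>UNIV. z $ i * tprod (f(i := deriv (f i))) (x + t *\<^sub>R z))"
  proof (rule sum.cong[OF refl])
    fix i
    have "tprod (f(i := deriv (f i))) (x + t *\<^sub>R z) = deriv (f i) ((x + t *\<^sub>R z) $ i) * (\<Prod>j\<in>UNIV - {i}. f j ((x + t *\<^sub>R z) $ j))"
      unfolding tprod_def by (subst prod.remove[of _ i]) (auto intro!: prod.cong)
    then show "(deriv (f i) ((x + t *\<^sub>R z) $ i) * z $ i) * (\<Prod>j\<in>UNIV - {i}. f j ((x + t *\<^sub>R z) $ j))
      = z $ i * tprod (f(i := deriv (f i))) (x + t *\<^sub>R z)" by simp
  qed
  finally show ?thesis .
qed

lemma smooth1_derivI: "smooth1 f \<Longrightarrow> smooth1 (deriv f)"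
proof -
  assume f: "smooth1 f"
  have "(deriv ^^ k) (deriv f) = (deriv ^^ Suc k) f" for k
    by (induction k) auto
  then show ?thesis using smooth1_deriv[OF f] unfolding smooth1_def by (metis funpow.simps(2) comp_apply)
qed

lemma tprod_line_deriv_axis:
  fixes f :: "'n::finite \<Rightarrow> real \<Rightarrow> real"
  assumes "\<And>i. smooth1 (f i)"
  shows "((\<lambda>t. tprod f (x + t *\<^sub>R axis i 1)) has_real_derivative tprod (f(i := deriv (f i))) x) (at 0)"
proof -
  have "(\<Sum>j\<in>UNIV. axis i 1 $ j * tprod (f(j := deriv (f j))) (x + 0 *\<^sub>R axis i 1)) = tprod (f(i := deriv (f i))) x"
    by (subst sum.remove[of _ i]) (auto simp: axis_def)
  then show ?thesis
    using tprod_line_deriv[of f x "axis i 1" 0, OF assms] by simp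
qed

lemma pdiff_tprod:
  assumes "\<And>i. smooth1 (f i)"
  shows "pdiff i (tprod f) = tprod (f(i := deriv (f i)))"
  unfolding pdiff_def fun_eq_iff by (intro allI DERIV_imp_deriv tprod_line_deriv_axis assms)

lemma ipdiff_tprod:
  assumes "\<And>i. smooth1 (f i)"
  shows "\<exists>h. (\<forall>i. smooth1 (h i)) \<and> ipdiff is (tprod f) = tprod h"
proof (induction "is")
  case Nil
  then show ?case using assms by (intro exI[of _ f]) simp
next
  case (Cons i "is")
  then obtain h where h: "\<And>i. smooth1 (h i)" "ipdiff is (tprod f) = tprod h" by blast
  have "ipdiff (i # is) (tprod f) = tprod (h(i := deriv (h i)))"
    by (simp add: h(2) pdiff_tprod[of h, OF h(1)])
  moreover have "smooth1 ((h(i := deriv (h i))) j)" for j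
    using h(1) smooth1_derivI by simp
  ultimately show ?case by blast
qed

lemma tprod_continuous:
  assumes "\<And>i. smooth1 (f i)"
  shows "continuous_on UNIV (tprod f)"
proof -
  have "continuous_on UNIV (\<lambda>x. f i (x $ i))" for i
    by (rule continuous_on_compose2[of UNIV "f i"])
       (use smooth1_continuous[OF assms, where k=0] in \<open>auto intro!: continuous_intros\<close>)
  then show ?thesis unfolding tprod_def by (intro continuous_on_prod) auto
qed

lemma smooth_fun_tprod:
  assumes "\<And>i. smooth1 (f i)"
  shows "smooth_fun (tprod f)"
  unfolding smooth_fun_def
proof (intro allI conjI)
  fix "is" i x
  obtain h where h: "\<And>i. smooth1 (h i)" "ipdiff is (tprod f) = tprod h" using ipdiff_tprod[of f "is"] assms by blast
  show "continuous_on UNIV (ipdiff is (tprod f))" unfolding h(2) by (rule tprod_continuous, rule h(1))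
  show "(\<lambda>t. ipdiff is (tprod f) (x + t *\<^sub>R axis i 1)) differentiable (at 0)"
    unfolding h(2) real_differentiable_def by (rule exI, rule tprod_line_deriv_axis, rule h(1))
qed

lemma tprod_support:
  assumes "\<And>i t. \<not> (a $ i \<le> t \<and> t \<le> b $ i) \<Longrightarrow> f i t = 0"
  shows "tprod f x \<noteq> 0 \<Longrightarrow> x \<in> cbox a b"
  using assms unfolding tprod_def mem_box_cart by auto

lemma test_fun_tprod:
  assumes "\<And>i. smooth1 (f i)" and "\<And>i t. \<not> (a $ i \<le> t \<and> t \<le> b $ i) \<Longrightarrow> f i t = 0"
  shows "test_fun (tprod f)"
proof -
  have "closure {x. tprod f x \<noteq> 0} \<subseteq> cbox a b"
    using tprod_support[of a b f, OF assms(2)] by (intro closure_minimal) auto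
  then have "compact (closure {x. tprod f x \<noteq> 0})"
    using compact_eq_bounded_closed bounded_subset[OF bounded_cbox] closed_closure by blast
  then show ?thesis unfolding test_fun_def using smooth_fun_tprod[of f, OF assms(1)] by blast
qed

lemma ipdiff_append: "ipdiff (is @ js) f = ipdiff is (ipdiff js f)"
  by (induction "is") auto

text \<open>Off the closed support the function vanishes along a short segment through the point,
  and so does its directional derivative. Hence differentiation preserves compact support.\<close>

lemma pdiff_support: "{x. pdiff i \<phi> x \<noteq> 0} \<subseteq> closure {x. \<phi> x \<noteq> 0}"
proof (intro subsetI, rule ccontr)
  fix x assume x: "x \<in> {x. pdiff i \<phi> x \<noteq> 0}" "x \<notin> closure {x. \<phi> x \<noteq> 0}"
  let ?S = "{t. x + t *\<^sub>R axis i 1 \<in> - closure {x. \<phi> x \<noteq> 0}}"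
  have op: "open ?S"
  proof -
    have "open ((\<lambda>t. x + t *\<^sub>R axis i 1) -` (- closure {x. \<phi> x \<noteq> 0}))"
      by (intro open_vimage continuous_intros open_Compl closed_closure)
    then show ?thesis by (simp add: vimage_def)
  qed
  have "((\<lambda>t. 0::real) has_real_derivative 0) (at 0)" by simp
  then have "((\<lambda>t. \<phi> (x + t *\<^sub>R axis i 1)) has_real_derivative 0) (at 0)"
  proof (rule has_field_derivative_transform_within_open[OF _ op])
    show "0 \<in> ?S" using x by simp
    show "0 = \<phi> (x + t *\<^sub>R axis i 1)" if "t \<in> ?S" for t
      using that closure_subset[of "{x. \<phi> x \<noteq> 0}"] by auto
  qed
  then have "pdiff i \<phi> x = 0" unfolding pdiff_def by (rule DERIV_imp_deriv)
  then show False using x by simp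
qed

lemma test_fun_pdiff:
  assumes "test_fun \<phi>" shows "test_fun (pdiff i \<phi>)"
proof -
  have "ipdiff is (pdiff i \<phi>) = ipdiff (is @ [i]) \<phi>" for "is" by (simp add: ipdiff_append)
  then have "smooth_fun (pdiff i \<phi>)" using assms unfolding test_fun_def smooth_fun_def by simp
  moreover have "closure {x. pdiff i \<phi> x \<noteq> 0} \<subseteq> closure {x. \<phi> x \<noteq> 0}"
    using pdiff_support by (intro closure_minimal) auto
  then have "compact (closure {x. pdiff i \<phi> x \<noteq> 0})"
    using assms unfolding test_fun_def compact_eq_bounded_closed
    using bounded_subset closed_closure by blast
  ultimately show ?thesis by (simp add: test_fun_def)
qed

lemma test_fun_ipdiff: "test_fun \<phi> \<Longrightarrow> test_fun (ipdiff is \<phi>)"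
  by (induction "is") (auto intro: test_fun_pdiff)

section \<open>Weak gradients and the separation of functions by boxes\<close>

definition weak_grad :: "(real ^ 'n::finite \<Rightarrow> real) \<Rightarrow> ('n \<Rightarrow> real ^ 'n \<Rightarrow> real) \<Rightarrow> bool" where
  "weak_grad u g \<longleftrightarrow> loc_integrable u \<and> (\<forall>i. loc_integrable (g i)) \<and>
     (\<forall>i \<phi>. test_fun \<phi> \<longrightarrow> (\<integral>x. u x * pdiff i \<phi> x \<partial>lborel) = - (\<integral>x. g i x * \<phi> x \<partial>lborel))"

lemma weak_derivs_loc: "weak_derivs m u D \<Longrightarrow> length is \<le> m \<Longrightarrow> loc_integrable (D is)"
  unfolding weak_derivs_def by simp

lemma weak_derivs_test:
  "weak_derivs m u D \<Longrightarrow> length is \<le> m \<Longrightarrow> test_fun \<phi> \<Longrightarrow>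
    (\<integral>x. u x * ipdiff is \<phi> x \<partial>lborel) = (-1) ^ length is * (\<integral>x. D is x * \<phi> x \<partial>lborel)"
  unfolding weak_derivs_def by simp

text \<open>In \<open>weak_derivs\<close> every derivative is defined by testing \<open>u\<close>
  itself. Testing \<open>u\<close> once with \<open>is\<close> against \<open>pdiff i \<phi>\<close>
  and once with \<open>is @ [i]\<close> against \<phi> gives two expressions for the same integral.
  The new index goes to the end of the list because \<open>ipdiff\<close> applies the last entry
  first.\<close>

lemma weak_derivs_grad:
  assumes u: "weak_derivs m u D" and l: "length is < m"
  shows "weak_grad (D is) (\<lambda>i. D (is @ [i]))"
  unfolding weak_grad_def
proof (intro conjI allI impI)
  show "loc_integrable (D is)" "loc_integrable (D (is @ [i]))" for i
    using weak_derivs_loc[OF u] l by auto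
  fix i and \<phi> :: "real ^ 'a \<Rightarrow> real" assume \<phi>: "test_fun \<phi>"
  have "(\<integral>x. u x * ipdiff is (pdiff i \<phi>) x \<partial>lborel) = (-1) ^ length is * (\<integral>x. D is x * pdiff i \<phi> x \<partial>lborel)"
    using l by (intro weak_derivs_test[OF u] test_fun_pdiff \<phi>) simp
  moreover have "(\<integral>x. u x * ipdiff (is @ [i]) \<phi> x \<partial>lborel) = (-1) ^ length (is @ [i]) * (\<integral>x. D (is @ [i]) x * \<phi> x \<partial>lborel)"
    using l by (intro weak_derivs_test[OF u] \<phi>) simp
  ultimately show "(\<integral>x. D is x * pdiff i \<phi> x \<partial>lborel) = - (\<integral>x. D (is @ [i]) x * \<phi> x \<partial>lborel)"
    by (cases "even (length is)") (simp_all add: ipdiff_append)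
qed

lemma loc_integrable_bounded:
  assumes "loc_integrable u" and [measurable]: "h \<in> borel_measurable borel" and "\<And>x. \<bar>h x\<bar> \<le> B" "\<And>x. h x \<noteq> 0 \<Longrightarrow> norm x \<le> r"
  shows "integrable lborel (\<lambda>x. u x * h x)"
proof -
  have [measurable]: "u \<in> borel_measurable borel" using assms by (simp add: loc_integrable_def)
  have "set_integrable lborel (cball 0 r) u" using assms by (auto simp: loc_integrable_def)
  then have "integrable lborel (\<lambda>x. B * (indicator (cball 0 r) x * u x))" unfolding set_integrable_def by simp
  then show ?thesis
  proof (rule Bochner_Integration.integrable_bound)
    show "AE x in lborel. norm (u x * h x) \<le> norm (B * (indicator (cball 0 r) x * u x))"
    proof (intro AE_I2)
      fix x
      have "\<bar>u x * h x\<bar> \<le> \<bar>B\<bar> * \<bar>u x\<bar>"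
        unfolding abs_mult using assms(3)[of x] by (subst mult.commute, intro mult_mono) auto
      then show "norm (u x * h x) \<le> norm (B * (indicator (cball 0 r) x * u x))"
        using assms(4)[of x] by (cases "h x = 0") (auto simp: abs_mult)
    qed
  qed measurable
qed

lemma enn2real_inject: "enn2real X = enn2real Y \<Longrightarrow> X \<noteq> \<infinity> \<Longrightarrow> Y \<noteq> \<infinity> \<Longrightarrow> X = Y"
  by (cases X; cases Y) auto

text \<open>The positive and the negative part are densities of two finite measures that agree on
  boxes. Boxes are stable under intersection and generate the Borel sets, so the measures coincide,
  and so do their densities almost everywhere.\<close>

lemma AE_zero_if_box_integrals_zero:
  fixes F :: "'a::euclidean_space \<Rightarrow> real"
  assumes F: "integrable lborel F" and z: "\<And>a b. (\<integral>x. indicator (box a b) x * F x \<partial>lborel) = 0"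
  shows "AE x in lborel. F x = 0"
proof -
  have [measurable]: "F \<in> borel_measurable borel" using F by auto
  have fin: "(\<integral>\<^sup>+x. ennreal (F x) \<partial>lborel) \<noteq> \<infinity>" "(\<integral>\<^sup>+x. ennreal (- F x) \<partial>lborel) \<noteq> \<infinity>"
    using F by (auto simp: real_integrable_def)
  let ?M = "density lborel (\<lambda>x. ennreal (F x))" and ?N = "density lborel (\<lambda>x. ennreal (- F x))"
  have eqbox: "emeasure ?M (box a b) = emeasure ?N (box a b)" for a b
  proof -
    have i: "integrable lborel (\<lambda>x. indicator (box a b) x * F x)"
      using integrable_real_mult_indicator[OF _ F, of "box a b"] by (simp add: mult.commute)
    have "enn2real (\<integral>\<^sup>+x. ennreal (indicator (box a b) x * F x) \<partial>lborel) = enn2real (\<integral>\<^sup>+x. ennreal (- (indicator (box a b) x * F x)) \<partial>lborel)"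
      using real_lebesgue_integral_def[OF i] z[of a b] by simp
    moreover have "(\<integral>\<^sup>+x. ennreal (indicator (box a b) x * F x) \<partial>lborel) \<noteq> \<infinity>" "(\<integral>\<^sup>+x. ennreal (- (indicator (box a b) x * F x)) \<partial>lborel) \<noteq> \<infinity>"
      using i by (auto simp: real_integrable_def)
    ultimately have "(\<integral>\<^sup>+x. ennreal (indicator (box a b) x * F x) \<partial>lborel) = (\<integral>\<^sup>+x. ennreal (- (indicator (box a b) x * F x)) \<partial>lborel)"
      by (rule enn2real_inject)
    moreover have "ennreal (F x) * indicator (box a b) x = ennreal (indicator (box a b) x * F x)" 
      "ennreal (- F x) * indicator (box a b) x = ennreal (- (indicator (box a b) x * F x))" for x
      by (auto simp: indicator_def)
    ultimately show ?thesis by (simp add: emeasure_density)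
  qed
  have "?M = ?N"
  proof (rule measure_eqI_generator_eq)
    let ?E = "range (\<lambda>(a, b). box a b::'a set)"
    show "Int_stable ?E" by (auto simp: Int_stable_def box_Int_box)
    show "?E \<subseteq> Pow UNIV" "sets ?M = sigma_sets UNIV ?E" "sets ?N = sigma_sets UNIV ?E"
      by (simp_all add: borel_eq_box)
    let ?A = "\<lambda>n::nat. box (- (real n *\<^sub>R One)) (real n *\<^sub>R One) :: 'a set"
    show "range ?A \<subseteq> ?E" "(\<Union>i. ?A i) = UNIV" unfolding UN_box_eq_UNIV by auto
    show "emeasure ?M (?A i) \<noteq> \<infinity>" for i
    proof -
      have "emeasure ?M (?A i) \<le> emeasure ?M UNIV" by (intro emeasure_mono) auto
      also have "\<dots> < \<infinity>" using fin by (simp add: emeasure_density top.not_eq_extremum)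
      finally show ?thesis by simp
    qed
    show "emeasure ?M X = emeasure ?N X" if "X \<in> ?E" for X using that eqbox by auto
  qed
  \<comment> \<open>As \<open>ennreal\<close> cuts off negative numbers, at least one of the two
    sides is 0 at each point; their equality therefore forces \<open>F x = 0\<close>.\<close>
  then have "AE x in lborel. ennreal (F x) = ennreal (- F x)"
    using fin by (subst (asm) finite_density_unique) auto
  then show ?thesis
  proof eventually_elim
    case (elim x)
    show ?case
    proof (cases "F x \<ge> 0")
      case True
      then have "ennreal (- F x) = 0" by (simp add: ennreal_neg)
      with elim True show ?thesis by simp
    next
      case False
      then have "ennreal (F x) = 0" by (simp add: ennreal_neg)
      with elim False show ?thesis by simp
    qed
  qed
qed

lemma test_fun_borel [measurable_dest]: "test_fun \<phi> \<Longrightarrow> \<phi> \<in> borel_measurable borel"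
  unfolding test_fun_def smooth_fun_def
  by (metis borel_measurable_continuous_onI ipdiff.simps(1))

lemma test_fun_continuous: "test_fun \<phi> \<Longrightarrow> continuous_on UNIV \<phi>"
  unfolding test_fun_def smooth_fun_def by (metis ipdiff.simps(1))

lemma test_fun_bounded:
  assumes "test_fun \<phi>"
  obtains B r where "\<And>x. \<bar>\<phi> x\<bar> \<le> B" "\<And>x. \<phi> x \<noteq> 0 \<Longrightarrow> norm x \<le> r" "B \<ge> 0" "r \<ge> 0"
proof -
  let ?K = "closure {x. \<phi> x \<noteq> 0}"
  have K: "compact ?K" using assms by (simp add: test_fun_def)
  have "compact (\<phi> ` ?K)"
    using continuous_on_subset[OF test_fun_continuous[OF assms], of ?K] K by (intro compact_continuous_image) auto
  then obtain B where B: "\<And>y. y \<in> \<phi> ` ?K \<Longrightarrow> norm y \<le> B" using compact_imp_bounded bounded_iff by metis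
  obtain r where r: "\<And>x. x \<in> ?K \<Longrightarrow> norm x \<le> r" using K compact_imp_bounded bounded_iff by metis
  show thesis
  proof (rule that[of "max B 0" "max r 0"])
    fix x
    have in_K: "\<phi> x \<noteq> 0 \<Longrightarrow> x \<in> ?K" using closure_subset[of "{x. \<phi> x \<noteq> 0}"] by blast
    show "\<bar>\<phi> x\<bar> \<le> max B 0"
      using B[of "\<phi> x"] in_K by (cases "\<phi> x = 0") auto
    show "norm x \<le> max r 0" if "\<phi> x \<noteq> 0"
      using r[of x] in_K that by auto
  qed auto
qed

lemma pdiff_shift: "pdiff i (\<lambda>x. \<phi> (x - s)) = (\<lambda>x. pdiff i \<phi> (x - s))"
  by (auto simp: pdiff_def fun_eq_iff algebra_simps)

lemma ipdiff_shift: "ipdiff is (\<lambda>x. \<phi> (x - s)) = (\<lambda>x. ipdiff is \<phi> (x - s))"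
  by (induction "is") (auto simp: pdiff_shift)

lemma test_fun_shift:
  assumes "test_fun \<phi>"
  shows "test_fun (\<lambda>x. \<phi> (x - s))"
proof -
  have "{x. \<phi> (x - s) \<noteq> 0} = (+) s ` {x. \<phi> x \<noteq> 0}"
    by (auto intro!: image_eqI[where x="x - s" for x])
  then have "compact (closure {x. \<phi> (x - s) \<noteq> 0})"
    using assms unfolding test_fun_def by (simp only: closure_translation compact_translation)
  moreover have "smooth_fun (\<lambda>x. \<phi> (x - s))"
    unfolding smooth_fun_def ipdiff_shift
  proof (intro allI conjI)
    fix "is" i x
    have "continuous_on UNIV (ipdiff is \<phi>)" using assms by (simp add: test_fun_def smooth_fun_def)
    then show "continuous_on UNIV (\<lambda>x. ipdiff is \<phi> (x - s))"
      by (rule continuous_on_compose2) (auto intro!: continuous_intros)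
    have "(\<lambda>t. ipdiff is \<phi> ((x - s) + t *\<^sub>R axis i 1)) differentiable (at 0)"
      using assms by (simp add: test_fun_def smooth_fun_def)
    then show "(\<lambda>t. ipdiff is \<phi> (x + t *\<^sub>R axis i 1 - s)) differentiable (at 0)"
      by (simp add: algebra_simps)
  qed
  ultimately show ?thesis by (simp add: test_fun_def)
qed

section \<open>Joint integrability in the space variable and the parameter of a segment\<close>

lemma integrable_unit_interval_pair:
  fixes h :: "'a::euclidean_space \<times> real \<Rightarrow> real"
  assumes [measurable]: "h \<in> borel_measurable (borel \<Otimes>\<^sub>M borel)"
    and C: "\<And>t. 0 \<le> t \<Longrightarrow> t \<le> 1 \<Longrightarrow> (\<integral>\<^sup>+x. ennreal \<bar>h (x, t)\<bar> \<partial>lborel) \<le> ennreal C"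
  shows "integrable (lborel \<Otimes>\<^sub>M lborel) (\<lambda>(x, t). indicator {0..1} t * h (x, t))"
proof (rule integrableI_bounded)
  let ?h = "\<lambda>(x, t). indicator {0..1::real} t * h (x, t)"
  show "?h \<in> borel_measurable (lborel \<Otimes>\<^sub>M lborel)" by measurable
  have "(\<integral>\<^sup>+z. ennreal (norm (?h z)) \<partial>(lborel \<Otimes>\<^sub>M lborel)) = (\<integral>\<^sup>+t. (\<integral>\<^sup>+x. ennreal (norm (?h (x, t))) \<partial>lborel) \<partial>lborel)"
    by (subst lborel_pair.nn_integral_snd[symmetric]) auto
  also have "\<dots> \<le> (\<integral>\<^sup>+t. ennreal C * indicator {0..1::real} t \<partial>lborel)"
    by (intro nn_integral_mono) (auto simp: indicator_def C)
  also have "\<dots> = ennreal C" by (subst nn_integral_cmult) auto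
  finally show "(\<integral>\<^sup>+z. ennreal (norm (?h z)) \<partial>(lborel \<Otimes>\<^sub>M lborel)) < \<infinity>"
    by (simp add: le_less_trans)
qed

lemma loc_integrable_borel [measurable_dest]: "loc_integrable u \<Longrightarrow> u \<in> borel_measurable borel"
  by (simp add: loc_integrable_def)

text \<open>The constant depends on \<open>u\<close> and the radius but not on \<psi>: the bound is
  applied to all translates of one function by \<open>t *\<^sub>R z\<close>, and has to be uniform
  in \<open>t\<close>.\<close>

lemma loc_integrable_ball_bound:
  assumes u: "loc_integrable u"
  obtains C where "\<And>\<psi> B. \<psi> \<in> borel_measurable borel \<Longrightarrow> (\<And>x. \<bar>\<psi> x\<bar> \<le> B) \<Longrightarrow> (\<And>x. \<psi> x \<noteq> 0 \<Longrightarrow> norm x \<le> r) \<Longrightarrow>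
     (\<integral>\<^sup>+x. ennreal \<bar>u x * \<psi> x\<bar> \<partial>lborel) \<le> ennreal (B * C)"
proof -
  note [measurable] = loc_integrable_borel[OF u]
  define C where "C = (\<integral>x. \<bar>indicator (cball 0 r) x * u x\<bar> \<partial>lborel)"
  have i: "integrable lborel (\<lambda>x. \<bar>indicator (cball 0 r) x * u x\<bar>)"
    using u unfolding loc_integrable_def set_integrable_def by (auto simp: )
  show thesis
  proof (rule that[of C])
    fix \<psi> :: "real ^ 'a \<Rightarrow> real" and B assume [measurable]: "\<psi> \<in> borel_measurable borel" and B: "\<And>x. \<bar>\<psi> x\<bar> \<le> B" and r: "\<And>x. \<psi> x \<noteq> 0 \<Longrightarrow> norm x \<le> r"
    have B0: "0 \<le> B" using B[of 0] by linarith
    have "(\<integral>\<^sup>+x. ennreal \<bar>u x * \<psi> x\<bar> \<partial>lborel) \<le> (\<integral>\<^sup>+x. ennreal (B * \<bar>indicator (cball 0 r) x * u x\<bar>) \<partial>lborel)"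
    proof (intro nn_integral_mono ennreal_leI)
      fix x
      have "\<bar>u x * \<psi> x\<bar> \<le> B * \<bar>u x\<bar>" unfolding abs_mult by (subst mult.commute) (intro mult_right_mono B abs_ge_zero)
      then show "\<bar>u x * \<psi> x\<bar> \<le> B * \<bar>indicator (cball 0 r) x * u x\<bar>"
        using r[of x] B0 by (cases "\<psi> x = 0") auto
    qed
    also have "\<dots> = ennreal (\<integral>x. B * \<bar>indicator (cball 0 r) x * u x\<bar> \<partial>lborel)"
      using i B0 by (intro nn_integral_eq_integral) auto
    also have "\<dots> = ennreal (B * C)" unfolding C_def by simp
    finally show "(\<integral>\<^sup>+x. ennreal \<bar>u x * \<psi> x\<bar> \<partial>lborel) \<le> ennreal (B * C)" .
  qed
qed

lemma norm_shift_le: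
  fixes x z :: "'a::real_normed_vector"
  assumes "0 \<le> t" "t \<le> 1" "norm x \<le> r"
  shows "norm (x + t *\<^sub>R z) \<le> r + norm z" "norm (x - t *\<^sub>R z) \<le> r + norm z"
proof -
  have "norm (t *\<^sub>R z) \<le> norm z" using assms by (simp add: mult_left_le_one_le)
  then show "norm (x + t *\<^sub>R z) \<le> r + norm z" "norm (x - t *\<^sub>R z) \<le> r + norm z"
    using norm_triangle_ineq[of x "t *\<^sub>R z"] norm_triangle_ineq4[of x "t *\<^sub>R z"] assms by linarith+
qed

lemma integrable_pair_shift1:
  fixes u :: "real ^ 'n::finite \<Rightarrow> real"
  assumes u: "loc_integrable u" and [measurable]: "\<psi> \<in> borel_measurable borel"
    and B: "\<And>x. \<bar>\<psi> x\<bar> \<le> B" and r: "\<And>x. \<psi> x \<noteq> 0 \<Longrightarrow> norm x \<le> r"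
  shows "integrable (lborel \<Otimes>\<^sub>M lborel) (\<lambda>(x, t). indicator {0..1} t * (u x * \<psi> (x - t *\<^sub>R z)))"
proof -
  note [measurable] = loc_integrable_borel[OF u]
  obtain C where C: "\<And>\<psi> B. \<psi> \<in> borel_measurable borel \<Longrightarrow> (\<And>x. \<bar>\<psi> x\<bar> \<le> B) \<Longrightarrow> (\<And>x. \<psi> x \<noteq> 0 \<Longrightarrow> norm x \<le> r + norm z) \<Longrightarrow>
     (\<integral>\<^sup>+x. ennreal \<bar>u x * \<psi> x\<bar> \<partial>lborel) \<le> ennreal (B * C)"
    using loc_integrable_ball_bound[OF u, of "r + norm z"] by blast
  have "integrable (lborel \<Otimes>\<^sub>M lborel) (\<lambda>(x, t). indicator {0..1} t * (\<lambda>(x, t). u x * \<psi> (x - t *\<^sub>R z)) (x, t))"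
  proof (rule integrable_unit_interval_pair[where C="B * C"])
    fix t :: real assume t: "0 \<le> t" "t \<le> 1"
    have "norm x \<le> r + norm z" if "\<psi> (x - t *\<^sub>R z) \<noteq> 0" for x
      using norm_shift_le(1)[OF t r[OF that], of z] by simp
    then have "(\<integral>\<^sup>+x. ennreal \<bar>u x * \<psi> (x - t *\<^sub>R z)\<bar> \<partial>lborel) \<le> ennreal (B * C)"
      by (intro C B) auto
    then show "(\<integral>\<^sup>+x. ennreal \<bar>case (x, t) of (x, t) \<Rightarrow> u x * \<psi> (x - t *\<^sub>R z)\<bar> \<partial>lborel) \<le> ennreal (B * C)" by simp
  qed measurable
  then show ?thesis by simp
qed

lemma integrable_pair_shift2:
  fixes u :: "real ^ 'n::finite \<Rightarrow> real"
  assumes u: "loc_integrable u" and [measurable]: "\<psi> \<in> borel_measurable borel"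
    and B: "\<And>x. \<bar>\<psi> x\<bar> \<le> B" and r: "\<And>x. \<psi> x \<noteq> 0 \<Longrightarrow> norm x \<le> r"
  shows "integrable (lborel \<Otimes>\<^sub>M lborel) (\<lambda>(x, t). indicator {0..1} t * (u (x + t *\<^sub>R z) * \<psi> x))"
proof -
  note [measurable] = loc_integrable_borel[OF u]
  obtain C where C: "\<And>\<psi> B. \<psi> \<in> borel_measurable borel \<Longrightarrow> (\<And>x. \<bar>\<psi> x\<bar> \<le> B) \<Longrightarrow> (\<And>x. \<psi> x \<noteq> 0 \<Longrightarrow> norm x \<le> r + norm z) \<Longrightarrow>
     (\<integral>\<^sup>+x. ennreal \<bar>u x * \<psi> x\<bar> \<partial>lborel) \<le> ennreal (B * C)"
    using loc_integrable_ball_bound[OF u, of "r + norm z"] by blast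
  have "integrable (lborel \<Otimes>\<^sub>M lborel) (\<lambda>(x, t). indicator {0..1} t * (\<lambda>(x, t). u (x + t *\<^sub>R z) * \<psi> x) (x, t))"
  proof (rule integrable_unit_interval_pair[where C="B * C"])
    fix t :: real assume t: "0 \<le> t" "t \<le> 1"
    have "norm x \<le> r + norm z" if "\<psi> (x - t *\<^sub>R z) \<noteq> 0" for x
      using norm_shift_le(1)[OF t r[OF that], of z] by simp
    then have "(\<integral>\<^sup>+x. ennreal \<bar>u x * \<psi> (x - t *\<^sub>R z)\<bar> \<partial>lborel) \<le> ennreal (B * C)"
      by (intro C B) auto
    moreover have "(\<integral>\<^sup>+x. ennreal \<bar>u x * \<psi> (x - t *\<^sub>R z)\<bar> \<partial>lborel) = (\<integral>\<^sup>+x. ennreal \<bar>u (x + t *\<^sub>R z) * \<psi> x\<bar> \<partial>lborel)"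
      by (subst nn_integral_lborel_shift[where z="t *\<^sub>R z", symmetric]) auto
    ultimately show "(\<integral>\<^sup>+x. ennreal \<bar>case (x, t) of (x, t) \<Rightarrow> u (x + t *\<^sub>R z) * \<psi> x\<bar> \<partial>lborel) \<le> ennreal (B * C)" by simp
  qed measurable
  then show ?thesis by simp
qed

lemma loc_integrable_shift_bounded:
  fixes u :: "real ^ 'n::finite \<Rightarrow> real"
  assumes u: "loc_integrable u" and [measurable]: "\<psi> \<in> borel_measurable borel"
    and B: "\<And>x. \<bar>\<psi> x\<bar> \<le> B" and r: "\<And>x. \<psi> x \<noteq> 0 \<Longrightarrow> norm x \<le> r"
  shows "integrable lborel (\<lambda>x. u (x + z) * \<psi> x)"
proof -
  have "integrable lborel (\<lambda>x. u x * \<psi> (x - z))"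
  proof (rule loc_integrable_bounded[OF u])
    show "norm x \<le> r + norm z" if "\<psi> (x - z) \<noteq> 0" for x
      using r[OF that] norm_triangle_ineq2[of x z] by linarith
  qed (use B in auto)
  from integrable_lborel_shift[OF this, of z] show ?thesis by simp
qed

text \<open>The translation is moved to the test function, whose increment is the integral of its
  derivatives along the segment; each derivative is passed to \<open>u\<close> by testing against a
  translate of \<phi>, and the translation is moved back. The derivative of \<phi> along
  \<open>z\<close> is an assumption because \<open>smooth_fun\<close> speaks about the coordinate
  directions only.\<close>

lemma weak_grad_translate:
  fixes u :: "real ^ 'n::finite \<Rightarrow> real"
  assumes u: "weak_grad u g" and \<phi>: "test_fun \<phi>"
    and line: "\<And>x t. ((\<lambda>t. \<phi> (x + t *\<^sub>R (- z))) has_real_derivative (\<Sum>i\<in>UNIV. - z $ i * pdiff i \<phi> (x + t *\<^sub>R (- z)))) (at t)"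
  shows "(\<integral>x. (u (x + z) - u x) * \<phi> x \<partial>lborel) =
    (\<integral>x. (\<integral>t. indicator {0..1} t * (\<Sum>i\<in>UNIV. z $ i * g i (x + t *\<^sub>R z)) \<partial>lborel) * \<phi> x \<partial>lborel)"
proof -
  have lu: "loc_integrable u" and lg: "\<And>i. loc_integrable (g i)" using u by (auto simp: weak_grad_def)
  note [measurable] = loc_integrable_borel[OF lu] loc_integrable_borel[OF lg] test_fun_borel[OF \<phi>] test_fun_borel[OF test_fun_pdiff[OF \<phi>]]
  obtain B r where Br: "\<And>x. \<bar>\<phi> x\<bar> \<le> B" "\<And>x. \<phi> x \<noteq> 0 \<Longrightarrow> norm x \<le> r" using test_fun_bounded[OF \<phi>] by metis
  have pBr: "\<exists>B r. (\<forall>x. \<bar>pdiff i \<phi> x\<bar> \<le> B) \<and> (\<forall>x. pdiff i \<phi> x \<noteq> 0 \<longrightarrow> norm x \<le> r)" for i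
    using test_fun_bounded[OF test_fun_pdiff[OF \<phi>, of i]] by metis
  define H where "H i x t = indicator {0..1::real} t * (u x * pdiff i \<phi> (x - t *\<^sub>R z))" for i x t
  define J where "J i x t = indicator {0..1::real} t * (g i (x + t *\<^sub>R z) * \<phi> x)" for i x t
  have H: "integrable (lborel \<Otimes>\<^sub>M lborel) (case_prod (H i))" for i
    unfolding H_def using pBr[of i] by (auto intro!: integrable_pair_shift1[OF lu])
  have J: "integrable (lborel \<Otimes>\<^sub>M lborel) (case_prod (J i))" for i
    unfolding J_def using Br by (auto intro!: integrable_pair_shift2[OF lg])
  have ftc: "\<phi> (x - z) - \<phi> x = (\<integral>t. indicator {0..1} t * (\<Sum>i\<in>UNIV. - z $ i * pdiff i \<phi> (x - t *\<^sub>R z)) \<partial>lborel)" for x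
  proof -
    have c: "continuous_on UNIV (\<lambda>t. \<Sum>i\<in>UNIV. - z $ i * pdiff i \<phi> (x + t *\<^sub>R (- z)))"
    proof (intro continuous_intros)
      fix i
      show "continuous_on UNIV (\<lambda>t. pdiff i \<phi> (x + t *\<^sub>R (- z)))"
        by (rule continuous_on_compose2[OF test_fun_continuous[OF test_fun_pdiff[OF \<phi>]]]) (auto intro!: continuous_intros)
    qed
    have "(\<integral>t. (\<Sum>i\<in>UNIV. - z $ i * pdiff i \<phi> (x + t *\<^sub>R (- z))) * indicator {0..1} t \<partial>lborel) = \<phi> (x + 1 *\<^sub>R (- z)) - \<phi> (x + 0 *\<^sub>R (- z))"
      using c by (intro integral_FTC_Icc_real line) (auto simp: continuous_on_eq_continuous_at)
    then show ?thesis by (simp add: mult.commute)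
  qed
  \<comment> \<open>Integrability in \<open>t\<close> is known for almost every \<open>x\<close>
    only; it is needed to exchange the Bochner integral with the finite sum over the
    coordinates.\<close>
  have iH: "AE x in lborel. \<forall>i. integrable lborel (H i x)"
    using lborel_pair.AE_integrable_fst'[OF H] by (subst AE_all_countable) auto
  have iJ: "AE x in lborel. \<forall>i. integrable lborel (J i x)"
    using lborel_pair.AE_integrable_fst'[OF J] by (subst AE_all_countable) auto
  have swapH: "(\<integral>x. (\<integral>t. H i x t \<partial>lborel) \<partial>lborel) = (\<integral>t. (\<integral>x. H i x t \<partial>lborel) \<partial>lborel)" for i
    by (rule lborel_pair.Fubini_integral[OF H, symmetric])
  have swapJ: "(\<integral>x. (\<integral>t. J i x t \<partial>lborel) \<partial>lborel) = (\<integral>t. (\<integral>x. J i x t \<partial>lborel) \<partial>lborel)" for i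
    by (rule lborel_pair.Fubini_integral[OF J, symmetric])
  \<comment> \<open>For fixed \<open>t\<close> this is the definition of the weak gradient, tested
    against \<phi> translated by \<open>t *\<^sub>R z\<close>.\<close>
  have HJ: "(\<integral>x. H i x t \<partial>lborel) = - (\<integral>x. J i x t \<partial>lborel)" for i t
  proof -
    have "(\<integral>x. u x * pdiff i (\<lambda>x. \<phi> (x - t *\<^sub>R z)) x \<partial>lborel) = - (\<integral>x. g i x * \<phi> (x - t *\<^sub>R z) \<partial>lborel)"
      using u test_fun_shift[OF \<phi>] by (auto simp: weak_grad_def)
    also have "(\<integral>x. g i x * \<phi> (x - t *\<^sub>R z) \<partial>lborel) = (\<integral>x. g i (x + t *\<^sub>R z) * \<phi> x \<partial>lborel)"
      by (subst integral_lborel_shift[where z="t *\<^sub>R z", symmetric]) auto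
    finally show ?thesis by (simp add: H_def J_def pdiff_shift)
  qed
  have iu: "integrable lborel (\<lambda>x. u (x + z) * \<phi> x)" "integrable lborel (\<lambda>x. u x * \<phi> x)"
    using loc_integrable_shift_bounded[OF lu _ Br, where z=z] loc_integrable_shift_bounded[OF lu _ Br, where z=0] by auto
  have iu': "integrable lborel (\<lambda>x. u x * \<phi> (x - z))"
    using integrable_lborel_shift[OF iu(1), of "- z"] by simp
  have "(\<integral>x. (u (x + z) - u x) * \<phi> x \<partial>lborel) = (\<integral>x. u (x + z) * \<phi> x \<partial>lborel) - (\<integral>x. u x * \<phi> x \<partial>lborel)"
    using iu by (simp add: left_diff_distrib)
  also have "(\<integral>x. u (x + z) * \<phi> x \<partial>lborel) = (\<integral>x. u x * \<phi> (x - z) \<partial>lborel)"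
    by (subst integral_lborel_shift[where z="- z", symmetric]) auto
  also have "(\<integral>x. u x * \<phi> (x - z) \<partial>lborel) - (\<integral>x. u x * \<phi> x \<partial>lborel) = (\<integral>x. u x * (\<phi> (x - z) - \<phi> x) \<partial>lborel)"
    using iu iu' by (simp add: right_diff_distrib)
  also have "\<dots> = (\<integral>x. (\<Sum>i\<in>UNIV. - z $ i * (\<integral>t. H i x t \<partial>lborel)) \<partial>lborel)"
  proof (intro integral_cong_AE)
    show "AE x in lborel. u x * (\<phi> (x - z) - \<phi> x) = (\<Sum>i\<in>UNIV. - z $ i * (\<integral>t. H i x t \<partial>lborel))"
      using iH
    proof eventually_elim
      case (elim x)
      have "u x * (\<phi> (x - z) - \<phi> x) = (\<integral>t. u x * (indicator {0..1} t * (\<Sum>i\<in>UNIV. - z $ i * pdiff i \<phi> (x - t *\<^sub>R z))) \<partial>lborel)"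
        unfolding ftc by simp
      also have "\<dots> = (\<integral>t. (\<Sum>i\<in>UNIV. - z $ i * H i x t) \<partial>lborel)"
        by (intro Bochner_Integration.integral_cong refl) (auto simp: H_def sum_distrib_left mult_ac intro!: sum.cong)
      also have "\<dots> = (\<Sum>i\<in>UNIV. - z $ i * (\<integral>t. H i x t \<partial>lborel))"
        using elim by (subst Bochner_Integration.integral_sum) auto
      finally show ?case .
    qed
  qed (unfold H_def, measurable)
  also have "\<dots> = (\<Sum>i\<in>UNIV. - z $ i * (\<integral>x. (\<integral>t. H i x t \<partial>lborel) \<partial>lborel))"
    using lborel_pair.integrable_fst'[OF H] by (subst Bochner_Integration.integral_sum) auto
  also have "\<dots> = (\<Sum>i\<in>UNIV. z $ i * (\<integral>x. (\<integral>t. J i x t \<partial>lborel) \<partial>lborel))"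
    unfolding swapH swapJ HJ by simp
  also have "\<dots> = (\<integral>x. (\<Sum>i\<in>UNIV. z $ i * (\<integral>t. J i x t \<partial>lborel)) \<partial>lborel)"
    using lborel_pair.integrable_fst'[OF J] by (subst Bochner_Integration.integral_sum) auto
  also have "\<dots> = (\<integral>x. (\<integral>t. indicator {0..1} t * (\<Sum>i\<in>UNIV. z $ i * g i (x + t *\<^sub>R z)) \<partial>lborel) * \<phi> x \<partial>lborel)"
  proof (intro integral_cong_AE)
    show "AE x in lborel. (\<Sum>i\<in>UNIV. z $ i * (\<integral>t. J i x t \<partial>lborel)) = (\<integral>t. indicator {0..1} t * (\<Sum>i\<in>UNIV. z $ i * g i (x + t *\<^sub>R z)) \<partial>lborel) * \<phi> x"
      using iJ
    proof eventually_elim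
      case (elim x)
      have "(\<Sum>i\<in>UNIV. z $ i * (\<integral>t. J i x t \<partial>lborel)) = (\<integral>t. (\<Sum>i\<in>UNIV. z $ i * J i x t) \<partial>lborel)"
        using elim by (subst Bochner_Integration.integral_sum) auto
      also have "\<dots> = (\<integral>t. (indicator {0..1} t * (\<Sum>i\<in>UNIV. z $ i * g i (x + t *\<^sub>R z))) * \<phi> x \<partial>lborel)"
        by (intro Bochner_Integration.integral_cong refl) (auto simp: J_def sum_distrib_left sum_distrib_right mult_ac intro!: sum.cong)
      finally show ?case by simp
    qed
  qed (unfold J_def, measurable)
  finally show ?thesis .
qed

lemma tprod_bump_tendsto:
  fixes a b x :: "real ^ 'n::finite"
  shows "(\<lambda>n. tprod (\<lambda>i. bump (real (Suc n)) (a $ i) (b $ i)) x) \<longlonglongrightarrow> indicator (box a b) x"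
proof -
  have "(\<lambda>n. tprod (\<lambda>i. bump (real (Suc n)) (a $ i) (b $ i)) x) \<longlonglongrightarrow> (\<Prod>i\<in>UNIV. indicator {a $ i<..<b $ i} (x $ i))"
    unfolding tprod_def by (intro tendsto_prod bump_tendsto)
  also have "(\<Prod>i\<in>UNIV. indicator {a $ i<..<b $ i} (x $ i)) = (indicator (box a b) x :: real)"
  proof (cases "x \<in> box a b")
    case True
    then show ?thesis by (auto simp: mem_box_cart)
  next
    case False
    then obtain i where "\<not> (a $ i < x $ i \<and> x $ i < b $ i)" by (auto simp: mem_box_cart)
    then show ?thesis using False by (intro trans[OF prod_zero]) (auto intro!: bexI[of _ i] simp: indicator_def)
  qed
  finally show ?thesis .
qed

lemma tprod_bump_bounds:
  fixes a b x :: "real ^ 'n::finite"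
  assumes "k > 0"
  shows "0 \<le> tprod (\<lambda>i. bump k (a $ i) (b $ i)) x" "tprod (\<lambda>i. bump k (a $ i) (b $ i)) x \<le> indicator (box a b) x"
proof -
  show "0 \<le> tprod (\<lambda>i. bump k (a $ i) (b $ i)) x"
    unfolding tprod_def by (intro prod_nonneg) (auto simp: bump_bounds)
  show "tprod (\<lambda>i. bump k (a $ i) (b $ i)) x \<le> indicator (box a b) x"
  proof (cases "x \<in> box a b")
    case True
    then show ?thesis unfolding tprod_def by (auto intro!: prod_le_1 simp: bump_bounds)
  next
    case False
    then obtain i where "\<not> (a $ i < x $ i \<and> x $ i < b $ i)" by (auto simp: mem_box_cart)
    then have "bump k (a $ i) (b $ i) (x $ i) = 0" using bump_outside[OF assms] by blast
    then have "tprod (\<lambda>i. bump k (a $ i) (b $ i)) x = 0"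
      unfolding tprod_def by (intro prod_zero) auto
    then show ?thesis by simp
  qed
qed

lemma test_fun_tprod_bump:
  fixes a b :: "real ^ 'n::finite"
  assumes "k > 0"
  shows "test_fun (tprod (\<lambda>i. bump k (a $ i) (b $ i)))"
proof (rule test_fun_tprod)
  show "bump k (a $ i) (b $ i) t = 0" if "\<not> (a $ i \<le> t \<and> t \<le> b $ i)" for i t
    using that by (intro bump_outside[OF assms]) auto
qed (rule bump_smooth)

text \<open>Tested against tensor products of bumps, the two sides agree; dominated convergence from
  bumps to indicators shows that their difference has integral 0 over every box. Tensor products are
  also the test functions for which the derivative in an oblique direction is at hand.\<close>

lemma weak_grad_translate_AE:
  fixes u :: "real ^ 'n::finite \<Rightarrow> real"
  assumes u: "weak_grad u g"
  shows "AE x in lborel. u (x + z) - u x = (\<integral>t. indicator {0..1} t * (\<Sum>i\<in>UNIV. z $ i * g i (x + t *\<^sub>R z)) \<partial>lborel)"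
proof -
  have lu: "loc_integrable u" and lg: "\<And>i. loc_integrable (g i)" using u by (auto simp: weak_grad_def)
  note [measurable] = loc_integrable_borel[OF lu] loc_integrable_borel[OF lg]
  define I where "I x = (\<integral>t. indicator {0..1} t * (\<Sum>i\<in>UNIV. z $ i * g i (x + t *\<^sub>R z)) \<partial>lborel)" for x
  define F where "F x = u (x + z) - u x - I x" for x
  have [measurable]: "I \<in> borel_measurable borel" unfolding I_def by measurable
  have [measurable]: "F \<in> borel_measurable borel" unfolding F_def by measurable
  have iI: "integrable lborel (\<lambda>x. I x * \<psi> x)" and iF: "integrable lborel (\<lambda>x. F x * \<psi> x)"
    and iU: "integrable lborel (\<lambda>x. (u (x + z) - u x) * \<psi> x)"
    if \<psi>: "\<psi> \<in> borel_measurable borel" "\<And>x. \<bar>\<psi> x\<bar> \<le> B" "\<And>x. \<psi> x \<noteq> 0 \<Longrightarrow> norm x \<le> r" for \<psi> B r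
  proof -
    have "integrable (lborel \<Otimes>\<^sub>M lborel) (\<lambda>(x, t). \<Sum>i\<in>UNIV. z $ i * (case (x, t) of (x, t) \<Rightarrow> indicator {0..1} t * (g i (x + t *\<^sub>R z) * \<psi> x)))"
      unfolding split_beta' fst_conv snd_conv
      using integrable_pair_shift2[OF lg \<psi>, where z=z] by (intro Bochner_Integration.integrable_sum integrable_mult_right) (simp add: split_beta')
    from lborel_pair.integrable_fst'[OF this]
    have "integrable lborel (\<lambda>x. \<integral>t. (\<Sum>i\<in>UNIV. z $ i * (indicator {0..1} t * (g i (x + t *\<^sub>R z) * \<psi> x))) \<partial>lborel)" by simp
    moreover have "(\<integral>t. (\<Sum>i\<in>UNIV. z $ i * (indicator {0..1} t * (g i (x + t *\<^sub>R z) * \<psi> x))) \<partial>lborel) = I x * \<psi> x" for x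
    proof -
      have "(\<integral>t. (\<Sum>i\<in>UNIV. z $ i * (indicator {0..1} t * (g i (x + t *\<^sub>R z) * \<psi> x))) \<partial>lborel)
         = (\<integral>t. (indicator {0..1} t * (\<Sum>i\<in>UNIV. z $ i * g i (x + t *\<^sub>R z))) * \<psi> x \<partial>lborel)"
        by (intro Bochner_Integration.integral_cong refl) (auto simp: sum_distrib_left sum_distrib_right mult_ac intro!: sum.cong)
      then show ?thesis by (simp add: I_def)
    qed
    ultimately show iI: "integrable lborel (\<lambda>x. I x * \<psi> x)" by simp
    show iU: "integrable lborel (\<lambda>x. (u (x + z) - u x) * \<psi> x)"
      using loc_integrable_shift_bounded[OF lu \<psi>, where z=z] loc_integrable_shift_bounded[OF lu \<psi>, where z=0]
      by (simp add: left_diff_distrib)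
    have "(\<lambda>x. F x * \<psi> x) = (\<lambda>x. (u (x + z) - u x) * \<psi> x - I x * \<psi> x)" by (simp add: F_def left_diff_distrib)
    then show "integrable lborel (\<lambda>x. F x * \<psi> x)" using iI iU by simp
  qed
  have box_int: "integrable lborel (\<lambda>x. F x * indicator (box a b) x)" for a b
  proof -
    obtain r where "\<And>x. x \<in> box a b \<Longrightarrow> norm x \<le> r" using bounded_box bounded_iff by metis
    then show ?thesis by (intro iF[where B=1 and r=r]) (auto simp: indicator_def split: if_splits)
  qed
  have box0: "(\<integral>x. F x * indicator (box a b) x \<partial>lborel) = 0" for a b
  proof -
    define \<phi> where "\<phi> n = tprod (\<lambda>i. bump (real (Suc n)) (a $ i) (b $ i))" for n
    have t: "test_fun (\<phi> n)" for n unfolding \<phi>_def by (rule test_fun_tprod_bump) simp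
    have 0: "(\<integral>x. F x * \<phi> n x \<partial>lborel) = 0" for n
    proof -
      obtain B r where Br: "\<And>x. \<bar>\<phi> n x\<bar> \<le> B" "\<And>x. \<phi> n x \<noteq> 0 \<Longrightarrow> norm x \<le> r" using test_fun_bounded[OF t[of n]] by metis
      note m = test_fun_borel[OF t[of n]]
      have "(\<integral>x. (u (x + z) - u x) * \<phi> n x \<partial>lborel) = (\<integral>x. I x * \<phi> n x \<partial>lborel)"
        unfolding I_def
      proof (rule weak_grad_translate[OF u t])
        fix x t
        have s: "smooth1 (bump (real (Suc n)) (a $ i) (b $ i))" for i by (rule bump_smooth)
        show "((\<lambda>t. \<phi> n (x + t *\<^sub>R (- z))) has_real_derivative (\<Sum>i\<in>UNIV. - z $ i * pdiff i (\<phi> n) (x + t *\<^sub>R (- z)))) (at t)"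
          using tprod_line_deriv[of "\<lambda>i. bump (real (Suc n)) (a $ i) (b $ i)" x "- z" t, OF s]
          unfolding \<phi>_def pdiff_tprod[of "\<lambda>i. bump (real (Suc n)) (a $ i) (b $ i)", OF s] vector_uminus_component .
      qed
      moreover have "(\<integral>x. F x * \<phi> n x \<partial>lborel) = (\<integral>x. (u (x + z) - u x) * \<phi> n x \<partial>lborel) - (\<integral>x. I x * \<phi> n x \<partial>lborel)"
        using iU[OF m Br] iI[OF m Br] by (subst Bochner_Integration.integral_diff[symmetric]) (auto simp: F_def left_diff_distrib)
      ultimately show ?thesis by simp
    qed
    note [measurable] = test_fun_borel[OF t]
    have "(\<lambda>n. \<integral>x. F x * \<phi> n x \<partial>lborel) \<longlonglongrightarrow> (\<integral>x. F x * indicator (box a b) x \<partial>lborel)"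
    proof (rule integral_dominated_convergence)
      show "integrable lborel (\<lambda>x. \<bar>F x * indicator (box a b) x\<bar>)" using box_int by simp
      show "AE x in lborel. (\<lambda>n. F x * \<phi> n x) \<longlonglongrightarrow> F x * indicator (box a b) x"
        unfolding \<phi>_def by (intro AE_I2 tendsto_mult tendsto_const tprod_bump_tendsto)
      show "AE x in lborel. norm (F x * \<phi> n x) \<le> \<bar>F x * indicator (box a b) x\<bar>" for n
        using tprod_bump_bounds[of "real (Suc n)" a b] unfolding \<phi>_def
        by (intro AE_I2) (auto simp: abs_mult intro!: mult_left_mono)
    qed measurable
    then show ?thesis unfolding 0 by (simp add: LIMSEQ_const_iff)
  qed
  \<comment> \<open>The difference is integrable only over bounded sets, so it is cut off to a
    growing sequence of boxes; since boxes intersect in boxes, the integrals of the cut-off function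
    over boxes still vanish.\<close>
  have "AE x in lborel. indicator (box (- (real N *\<^sub>R One)) (real N *\<^sub>R One)) x * F x = 0" for N
  proof (rule AE_zero_if_box_integrals_zero)
    show "integrable lborel (\<lambda>x. indicator (box (- (real N *\<^sub>R One)) (real N *\<^sub>R One)) x * F x)"
      using box_int by (simp add: mult.commute)
    fix a b :: "real ^ 'n"
    obtain c d where cd: "box a b \<inter> box (- (real N *\<^sub>R One)) (real N *\<^sub>R One) = box c d"
      using box_Int_box by blast
    have "indicator (box a b) x * (indicator (box (- (real N *\<^sub>R One)) (real N *\<^sub>R One)) x * F x) = F x * indicator (box c d) x" for x
      unfolding cd[symmetric] by (auto simp: indicator_def)
    then show "(\<integral>x. indicator (box a b) x * (indicator (box (- (real N *\<^sub>R One)) (real N *\<^sub>R One)) x * F x) \<partial>lborel) = 0"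
      by (simp only: box0)
  qed
  then have "AE x in lborel. \<forall>N. indicator (box (- (real N *\<^sub>R One)) (real N *\<^sub>R One)) x * F x = 0"
    by (subst AE_all_countable) auto
  then show ?thesis
  proof eventually_elim
    case (elim x)
    have "x \<in> (\<Union>N. box (- (real N *\<^sub>R One)) (real N *\<^sub>R One))" by (simp add: UN_box_eq_UNIV)
    then obtain N where "x \<in> box (- (real N *\<^sub>R One)) (real N *\<^sub>R One)" by blast
    with elim[rule_format, of N] have "F x = 0" by simp
    then show ?case by (simp add: F_def I_def)
  qed
qed

text \<open>The only consequence of weak differentiability used for the positive results: \<open>G\<close> bounds the
  increments of \<open>v\<close> along segments. Unlike weak differentiability itself, this passes to truncations
  and differences without any chain rule.\<close>

definition tgrad :: "('a::euclidean_space \<Rightarrow> real) \<Rightarrow> ('a \<Rightarrow> real) \<Rightarrow> bool" where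
  "tgrad v G \<longleftrightarrow> v \<in> borel_measurable borel \<and> G \<in> borel_measurable borel \<and> (\<forall>x. 0 \<le> G x) \<and>
    (\<forall>z. AE x in lborel. ennreal \<bar>v (x + z) - v x\<bar> \<le> ennreal (norm z) * (\<integral>\<^sup>+t. ennreal (G (x + t *\<^sub>R z)) * indicator {0..1} t \<partial>lborel))"

text \<open>Every coordinate of \<open>z\<close> is at most \<open>norm z\<close> in absolute value,
  which lets the sum of the absolute values of the partial derivatives serve as the bound.\<close>

lemma weak_grad_tgrad:
  fixes u :: "real ^ 'n::finite \<Rightarrow> real"
  assumes u: "weak_grad u g"
  shows "tgrad u (\<lambda>x. \<Sum>i\<in>UNIV. \<bar>g i x\<bar>)"
proof -
  have lu: "loc_integrable u" and lg: "\<And>i. loc_integrable (g i)" using u by (auto simp: weak_grad_def)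
  note [measurable] = loc_integrable_borel[OF lu] loc_integrable_borel[OF lg]
  show ?thesis unfolding tgrad_def
  proof (intro conjI allI)
    fix z
    show "AE x in lborel. ennreal \<bar>u (x + z) - u x\<bar> \<le> ennreal (norm z) * (\<integral>\<^sup>+t. ennreal (\<Sum>i\<in>UNIV. \<bar>g i (x + t *\<^sub>R z)\<bar>) * indicator {0..1} t \<partial>lborel)"
      using weak_grad_translate_AE[OF u, of z]
    proof eventually_elim
      case (elim x)
      let ?f = "\<lambda>t. indicator {0..1} t * (\<Sum>i\<in>UNIV. z $ i * g i (x + t *\<^sub>R z))"
      have "ennreal \<bar>u (x + z) - u x\<bar> \<le> (\<integral>\<^sup>+t. ennreal (norm (?f t)) \<partial>lborel)"
      proof (cases "integrable lborel ?f")
        case True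
        then show ?thesis using integral_norm_bound_ennreal[OF True] elim by simp
      next
        case False
        \<comment> \<open>Without integrability along the segment the Bochner integral has its
          default value 0, so the increment is 0 and the bound is trivial.\<close>
        then show ?thesis using elim by (simp add: not_integrable_integral_eq)
      qed
      also have "\<dots> \<le> (\<integral>\<^sup>+t. ennreal (norm z) * (ennreal (\<Sum>i\<in>UNIV. \<bar>g i (x + t *\<^sub>R z)\<bar>) * indicator {0..1} t) \<partial>lborel)"
      proof (intro nn_integral_mono)
        fix t
        have "\<bar>\<Sum>i\<in>UNIV. z $ i * g i (x + t *\<^sub>R z)\<bar> \<le> (\<Sum>i\<in>UNIV. \<bar>z $ i * g i (x + t *\<^sub>R z)\<bar>)" by (rule sum_abs)
        also have "\<dots> \<le> (\<Sum>i\<in>UNIV. norm z * \<bar>g i (x + t *\<^sub>R z)\<bar>)"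
          unfolding abs_mult by (intro sum_mono mult_right_mono component_le_norm_cart) auto
        also have "\<dots> = norm z * (\<Sum>i\<in>UNIV. \<bar>g i (x + t *\<^sub>R z)\<bar>)" by (simp add: sum_distrib_left)
        finally have "ennreal \<bar>\<Sum>i\<in>UNIV. z $ i * g i (x + t *\<^sub>R z)\<bar> \<le> ennreal (norm z) * ennreal (\<Sum>i\<in>UNIV. \<bar>g i (x + t *\<^sub>R z)\<bar>)"
          by (subst ennreal_mult[symmetric]) (auto intro!: sum_nonneg ennreal_leI)
        then show "ennreal (norm (?f t)) \<le> ennreal (norm z) * (ennreal (\<Sum>i\<in>UNIV. \<bar>g i (x + t *\<^sub>R z)\<bar>) * indicator {0..1} t)"
          by (auto simp: indicator_def)
      qed
      also have "\<dots> = ennreal (norm z) * (\<integral>\<^sup>+t. ennreal (\<Sum>i\<in>UNIV. \<bar>g i (x + t *\<^sub>R z)\<bar>) * indicator {0..1} t \<partial>lborel)"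
        by (intro nn_integral_cmult) measurable
      finally show ?case .
    qed
  qed (auto intro!: sum_nonneg)
qed

lemma tgrad_borel:
  assumes "tgrad v G" shows "v \<in> borel_measurable borel" "G \<in> borel_measurable borel" "0 \<le> G x"
  using assms by (auto simp: tgrad_def)

lemma tgrad_contract:
  assumes "tgrad v G" and f: "\<And>a b. \<bar>f a - f b\<bar> \<le> \<bar>a - b\<bar>" and [measurable]: "f \<in> borel_measurable borel"
  shows "tgrad (\<lambda>x. f (v x)) G"
  unfolding tgrad_def
proof (intro conjI allI)
  note [measurable] = tgrad_borel(1,2)[OF assms(1)]
  show "(\<lambda>x. f (v x)) \<in> borel_measurable borel" "G \<in> borel_measurable borel" by measurable
  show "0 \<le> G x" for x using tgrad_borel(3)[OF assms(1)] .
  fix z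
  have "AE x in lborel. ennreal \<bar>v (x + z) - v x\<bar> \<le> ennreal (norm z) * (\<integral>\<^sup>+t. ennreal (G (x + t *\<^sub>R z)) * indicator {0..1} t \<partial>lborel)"
    using assms(1) by (simp add: tgrad_def)
  then show "AE x in lborel. ennreal \<bar>f (v (x + z)) - f (v x)\<bar> \<le> ennreal (norm z) * (\<integral>\<^sup>+t. ennreal (G (x + t *\<^sub>R z)) * indicator {0..1} t \<partial>lborel)"
    by eventually_elim (use f in \<open>auto intro: order_trans[OF ennreal_leI]\<close>)
qed

lemma tgrad_diff:
  assumes "tgrad v G" "tgrad w H"
  shows "tgrad (\<lambda>x. v x - w x) (\<lambda>x. G x + H x)"
  unfolding tgrad_def
proof (intro conjI allI)
  note [measurable] = tgrad_borel(1,2)[OF assms(1)] tgrad_borel(1,2)[OF assms(2)]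
  note nn = tgrad_borel(3)[OF assms(1)] tgrad_borel(3)[OF assms(2)]
  show "(\<lambda>x. v x - w x) \<in> borel_measurable borel" "(\<lambda>x. G x + H x) \<in> borel_measurable borel" by measurable
  show "0 \<le> G x + H x" for x using nn[of x] by simp
  fix z
  have "AE x in lborel. ennreal \<bar>v (x + z) - v x\<bar> \<le> ennreal (norm z) * (\<integral>\<^sup>+t. ennreal (G (x + t *\<^sub>R z)) * indicator {0..1} t \<partial>lborel)"
     "AE x in lborel. ennreal \<bar>w (x + z) - w x\<bar> \<le> ennreal (norm z) * (\<integral>\<^sup>+t. ennreal (H (x + t *\<^sub>R z)) * indicator {0..1} t \<partial>lborel)"
    using assms by (simp_all add: tgrad_def)
  then show "AE x in lborel. ennreal \<bar>v (x + z) - w (x + z) - (v x - w x)\<bar> \<le> ennreal (norm z) * (\<integral>\<^sup>+t. ennreal (G (x + t *\<^sub>R z) + H (x + t *\<^sub>R z)) * indicator {0..1} t \<partial>lborel)"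
  proof eventually_elim
    case (elim x)
    have "ennreal \<bar>v (x + z) - w (x + z) - (v x - w x)\<bar> \<le> ennreal (\<bar>v (x + z) - v x\<bar> + \<bar>w (x + z) - w x\<bar>)"
      by (intro ennreal_leI) linarith
    also have "\<dots> = ennreal \<bar>v (x + z) - v x\<bar> + ennreal \<bar>w (x + z) - w x\<bar>" by simp
    also have "\<dots> \<le> ennreal (norm z) * (\<integral>\<^sup>+t. ennreal (G (x + t *\<^sub>R z)) * indicator {0..1} t \<partial>lborel) + ennreal (norm z) * (\<integral>\<^sup>+t. ennreal (H (x + t *\<^sub>R z)) * indicator {0..1} t \<partial>lborel)"
      by (intro add_mono elim)
    also have "\<dots> = ennreal (norm z) * (\<integral>\<^sup>+t. ennreal (G (x + t *\<^sub>R z)) * indicator {0..1} t + ennreal (H (x + t *\<^sub>R z)) * indicator {0..1} t \<partial>lborel)"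
      by (subst nn_integral_add) (auto simp: distrib_left)
    also have "\<dots> = ennreal (norm z) * (\<integral>\<^sup>+t. ennreal (G (x + t *\<^sub>R z) + H (x + t *\<^sub>R z)) * indicator {0..1} t \<partial>lborel)"
      using nn by (simp add: distrib_right)
    finally show ?case .
  qed
qed

text \<open>The unit interval has mass 1, so Jensen's inequality moves the power inside the integral
  along the segment at no cost.\<close>

lemma tgrad_powr:
  assumes vG: "tgrad v G" and p: "1 \<le> p"
  shows "AE x in lborel. ennreal (\<bar>v (x + z) - v x\<bar> powr p) \<le> ennreal (norm z powr p) * (\<integral>\<^sup>+t. ennreal (G (x + t *\<^sub>R z) powr p) * indicator {0..1} t \<partial>lborel)"
proof -
  note [measurable] = tgrad_borel(1,2)[OF vG]
  have nn: "0 \<le> G x" for x by (rule tgrad_borel(3)[OF vG])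
  have "AE x in lborel. ennreal \<bar>v (x + z) - v x\<bar> \<le> ennreal (norm z) * (\<integral>\<^sup>+t. ennreal (G (x + t *\<^sub>R z)) * indicator {0..1} t \<partial>lborel)"
    using vG by (simp add: tgrad_def)
  then show ?thesis
  proof eventually_elim
    case (elim x)
    let ?M = "restrict_space lborel {0..1::real}"
    have "ennreal \<bar>v (x + z) - v x\<bar> \<le> (\<integral>\<^sup>+t. ennreal (norm z * G (x + t *\<^sub>R z)) \<partial>?M)"
    proof -
      have "ennreal (norm z) * (\<integral>\<^sup>+t. ennreal (G (x + t *\<^sub>R z)) * indicator {0..1} t \<partial>lborel) = (\<integral>\<^sup>+t. ennreal (norm z * G (x + t *\<^sub>R z)) * indicator {0..1} t \<partial>lborel)"
        using nn by (subst nn_integral_cmult[symmetric]) (auto simp: ennreal_mult mult.assoc intro!: nn_integral_cong)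
      then show ?thesis using elim by (simp add: nn_integral_restrict_space)
    qed
    then have "ennreal (\<bar>v (x + z) - v x\<bar> powr p) \<le> ennreal (1 powr (p - 1)) * (\<integral>\<^sup>+t. ennreal ((norm z * G (x + t *\<^sub>R z)) powr p) \<partial>?M)"
      using nn p by (intro nn_integral_powr_Jensen) (auto simp: emeasure_restrict_space intro!: measurable_restrict_space1)
    also have "\<dots> = (\<integral>\<^sup>+t. ennreal (norm z powr p) * (ennreal (G (x + t *\<^sub>R z) powr p) * indicator {0..1} t) \<partial>lborel)"
      using nn by (auto simp: nn_integral_restrict_space powr_mult ennreal_mult mult.assoc intro!: nn_integral_cong)
    also have "\<dots> = ennreal (norm z powr p) * (\<integral>\<^sup>+t. ennreal (G (x + t *\<^sub>R z) powr p) * indicator {0..1} t \<partial>lborel)"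
      by (intro nn_integral_cmult) measurable
    finally show ?case .
  qed
qed

section \<open>The weight and its tails\<close>

lemma nn_integral_lborel_prod_vec:
  fixes f :: "'n::finite \<Rightarrow> real \<Rightarrow> ennreal"
  assumes [measurable]: "\<And>i. f i \<in> borel_measurable borel"
  shows "(\<integral>\<^sup>+x. (\<Prod>i\<in>UNIV. f i (x $ i)) \<partial>(lborel :: (real ^ 'n) measure)) = (\<Prod>i\<in>UNIV. (\<integral>\<^sup>+t. f i t \<partial>lborel))"
proof -
  let ?e = "\<lambda>i::'n. axis i (1::real)"
  have inj: "inj ?e" by (auto simp: inj_def axis_eq_axis)
  have B: "(Basis :: (real ^ 'n) set) = range ?e" by (auto simp: Basis_vec_def)
  have inv: "inv ?e (?e i) = i" for i by (rule inv_f_f[OF inj])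
  have "(\<integral>\<^sup>+x. (\<Prod>b\<in>Basis. f (inv ?e b) (x \<bullet> b)) \<partial>(lborel :: (real ^ 'n) measure)) = (\<Prod>b\<in>(Basis :: (real ^ 'n) set). (\<integral>\<^sup>+t. f (inv ?e b) t \<partial>lborel))"
    by (rule nn_integral_lborel_prod) auto
  then show ?thesis
    unfolding B by (simp add: prod.reindex[OF inj] inv cart_eq_inner_axis)
qed

section \<open>Growth of \<Phi>, normalisation and the product density\<close>

context
  fixes \<Phi> :: "real \<Rightarrow> real"
  assumes adm: "admissible_Phi \<Phi>"
begin

lemma Phi_nonneg: "0 \<le> x \<Longrightarrow> 0 \<le> \<Phi> x"
  using adm by (simp add: admissible_Phi_def)

lemma Phi_0: "\<Phi> 0 = 0"
  using adm by (simp add: admissible_Phi_def)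

lemma Phi_less: "0 \<le> x \<Longrightarrow> x < y \<Longrightarrow> \<Phi> x < \<Phi> y"
  using adm by (auto simp: admissible_Phi_def strict_mono_on_def)

lemma Phi_mono: "0 \<le> x \<Longrightarrow> x \<le> y \<Longrightarrow> \<Phi> x \<le> \<Phi> y"
  using Phi_less[of x y] by (cases "x = y") auto

lemma Phi_pos: "0 < x \<Longrightarrow> 0 < \<Phi> x"
  using Phi_less[of 0 x] Phi_0 by simp

lemma Phi_convex: "convex_on {0..} \<Phi>"
  using adm by (simp add: admissible_Phi_def)

text \<open>The point \<open>R\<close> lies between 0 and \<open>s\<close>; convexity and \<Phi>(0)
  = 0 compare the chords from the origin.\<close>

lemma Phi_slope: 
  assumes "0 < R" "R \<le> s"
  shows "\<Phi> R / R \<le> \<Phi> s / s"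
proof -
  have "\<Phi> ((1 - R / s) *\<^sub>R 0 + (R / s) *\<^sub>R s) \<le> (1 - R / s) * \<Phi> 0 + (R / s) * \<Phi> s"
    using assms by (intro convex_onD[OF Phi_convex]) auto
  then have "\<Phi> R \<le> (R / s) * \<Phi> s" using assms Phi_0 by simp
  then show ?thesis using assms by (simp add: field_simps)
qed

text \<open>The source of the exponential gain: moving outward by \<open>h\<close> beyond
  \<open>R\<close> raises \<Phi> by at least \<open>h\<close> times the slope of the chord up to
  \<open>R\<close>.\<close>

lemma Phi_increment:
  assumes "0 < R" "R \<le> s" "0 \<le> h"
  shows "\<Phi> s + h * (\<Phi> R / R) \<le> \<Phi> (s + h)"
proof -
  have "\<Phi> s / s \<le> \<Phi> (s + h) / (s + h)" using assms by (intro Phi_slope) auto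
  then have "\<Phi> (s + h) \<ge> (s + h) * (\<Phi> s / s)" using assms by (simp add: field_simps)
  also have "(s + h) * (\<Phi> s / s) = \<Phi> s + h * (\<Phi> s / s)" using assms by (simp add: field_simps)
  finally show ?thesis using mult_left_mono[OF Phi_slope[OF assms(1,2)] assms(3)] by linarith
qed

lemma Phi_borel [measurable]: "(\<lambda>x. \<Phi> \<bar>x\<bar>) \<in> borel_measurable borel"
proof -
  \<comment> \<open>Nothing is known about \<Phi> at negative arguments; with \<open>max x 0\<close>
    inside, it becomes a monotone function on the whole line.\<close>
  have "(\<lambda>x. \<Phi> (max x 0)) \<in> borel_measurable borel"
    by (intro borel_measurable_mono) (auto simp: mono_def intro!: Phi_mono)
  then have "(\<lambda>x. (\<lambda>x. \<Phi> (max x 0)) \<bar>x\<bar>) \<in> borel_measurable borel" by measurable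
  then show ?thesis by simp
qed

text \<open>Beyond 1 the slope of the chord is at least \<open>\<Phi> 1\<close>; on the unit
  interval the factor \<open>exp (\<Phi> 1)\<close> makes up for the decay of the
  exponential.\<close>

lemma exp_Phi_le: "exp (- \<Phi> \<bar>x\<bar>) \<le> exp (\<Phi> 1) * exp (- \<Phi> 1 * \<bar>x\<bar>)"
proof (cases "\<bar>x\<bar> \<ge> 1")
  case True
  then have "\<Phi> 1 * \<bar>x\<bar> \<le> \<Phi> \<bar>x\<bar>" using Phi_slope[of 1 "\<bar>x\<bar>"] by (simp add: field_simps)
  then show ?thesis using Phi_pos[of 1] unfolding exp_add[symmetric] by simp
next
  case False
  then have "\<Phi> 1 * \<bar>x\<bar> \<le> \<Phi> 1 * 1" using Phi_pos[of 1] by (intro mult_left_mono) auto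
  then show ?thesis using Phi_nonneg[of "\<bar>x\<bar>"] unfolding exp_add[symmetric] by simp
qed

text \<open>Comparison with a Gamma integral on each half-line. The moment of order 0 gives the
  normalisation, the higher ones put monomials into the Sobolev space.\<close>

lemma moment_finite: "(\<integral>\<^sup>+x. ennreal (\<bar>x\<bar> ^ k * exp (- \<Phi> \<bar>x\<bar>)) \<partial>lborel) < \<infinity>"
proof -
  define a where "a = \<Phi> 1"
  have a: "a > 0" using Phi_pos[of 1] by (simp add: a_def)
  define g where "g x = ennreal (x ^ k * exp (- x)) * indicator {0..} x" for x :: real
  have [measurable]: "g \<in> borel_measurable borel" unfolding g_def by measurable
  have gi: "(\<integral>\<^sup>+x. g x \<partial>lborel) = ennreal (fact k)" unfolding g_def using nn_intergal_power_times_exp_Ici[of k] by simp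
  \<comment> \<open>Used with \<open>s = a\<close> for the positive and \<open>s = - a\<close> for
    the negative half-line.\<close>
  have half: "(\<integral>\<^sup>+x. g (0 + s * x) \<partial>lborel) < \<infinity>" if "s \<noteq> 0" for s
  proof -
    have "ennreal \<bar>s\<bar> * (\<integral>\<^sup>+x. g (0 + s * x) \<partial>lborel) = ennreal (fact k)"
      using nn_integral_real_affine[of g s 0] gi that by simp
    then show ?thesis using that
      by (metis ennreal_less_top ennreal_mult_eq_top_iff ennreal_eq_0_iff abs_le_zero_iff infinity_ennreal_def top.not_eq_extremum)
  qed
  have "(\<integral>\<^sup>+x. ennreal (\<bar>x\<bar> ^ k * exp (- \<Phi> \<bar>x\<bar>)) \<partial>lborel) \<le> (\<integral>\<^sup>+x. ennreal (exp a / a ^ k) * (g (0 + a * x) + g (0 + (- a) * x)) \<partial>lborel)"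
  proof (intro nn_integral_mono)
    fix x :: real
    have "\<bar>x\<bar> ^ k * exp (- \<Phi> \<bar>x\<bar>) \<le> \<bar>x\<bar> ^ k * (exp a * exp (- a * \<bar>x\<bar>))"
      using exp_Phi_le[of x] unfolding a_def by (intro mult_left_mono) auto
    also have "\<dots> = (exp a / a ^ k) * ((a * \<bar>x\<bar>) ^ k * exp (- (a * \<bar>x\<bar>)))"
      using a by (simp add: power_mult_distrib)
    finally have "ennreal (\<bar>x\<bar> ^ k * exp (- \<Phi> \<bar>x\<bar>)) \<le> ennreal (exp a / a ^ k) * ennreal ((a * \<bar>x\<bar>) ^ k * exp (- (a * \<bar>x\<bar>)))"
      using a by (subst ennreal_mult[symmetric]) (auto intro: ennreal_leI)
    also have "ennreal ((a * \<bar>x\<bar>) ^ k * exp (- (a * \<bar>x\<bar>))) \<le> g (0 + a * x) + g (0 + (- a) * x)"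
    proof (cases "x \<ge> 0")
      case True
      then have "ennreal ((a * \<bar>x\<bar>) ^ k * exp (- (a * \<bar>x\<bar>))) = g (0 + a * x)" using a by (simp add: g_def)
      then show ?thesis by simp
    next
      case False
      then have "ennreal ((a * \<bar>x\<bar>) ^ k * exp (- (a * \<bar>x\<bar>))) = g (0 + (- a) * x)" using a by (simp add: g_def mult_nonneg_nonpos)
      then show ?thesis by simp
    qed
    finally show "ennreal (\<bar>x\<bar> ^ k * exp (- \<Phi> \<bar>x\<bar>)) \<le> ennreal (exp a / a ^ k) * (g (0 + a * x) + g (0 + (- a) * x))"
      by (simp add: mult_left_mono)
  qed
  also have "\<dots> = ennreal (exp a / a ^ k) * ((\<integral>\<^sup>+x. g (0 + a * x) \<partial>lborel) + (\<integral>\<^sup>+x. g (0 + (- a) * x) \<partial>lborel))"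
    by (subst nn_integral_cmult) (auto simp: nn_integral_add)
  also have "\<dots> < \<infinity>"
    using half[of a] half[of "- a"] a by (simp add: ennreal_mult_less_top)
  finally show ?thesis .
qed

text \<open>The normalising constant is defined through a Bochner integral, so integrability has to
  come first. The integral is not 0, as the integrand is positive everywhere.\<close>

lemma c_Phi_pos: "0 < c_Phi \<Phi>"
  and c_Phi_nn_integral: "(\<integral>\<^sup>+x. ennreal (c_Phi \<Phi> * exp (- \<Phi> \<bar>x\<bar>)) \<partial>lborel) = 1"
proof -
  let ?f = "\<lambda>x. exp (- \<Phi> \<bar>x\<bar>)"
  have fin: "(\<integral>\<^sup>+x. ennreal (?f x) \<partial>lborel) < \<infinity>" using moment_finite[of 0] by simp
  have i: "integrable lborel ?f"
    by (rule integrableI_nonneg) (use fin in auto)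
  have "(\<integral>x. ?f x \<partial>lborel) \<noteq> 0"
  proof
    assume "(\<integral>x. ?f x \<partial>lborel) = 0"
    then have "AE x in lborel. ?f x = 0" using i by (subst (asm) integral_nonneg_eq_0_iff_AE) auto
    then have "AE x in (lborel :: real measure). False" by simp
    then show False using emeasure_lborel_UNIV[where 'a=real] by (auto simp: AE_iff_measurable[OF _ refl])
  qed
  moreover have "(\<integral>x. ?f x \<partial>lborel) \<ge> 0" by simp
  ultimately have pos: "(\<integral>x. ?f x \<partial>lborel) > 0" by linarith
  then show c: "0 < c_Phi \<Phi>" by (simp add: c_Phi_def)
  have "(\<integral>\<^sup>+x. ennreal (c_Phi \<Phi> * ?f x) \<partial>lborel) = ennreal (\<integral>x. c_Phi \<Phi> * ?f x \<partial>lborel)"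
    using i c by (intro nn_integral_eq_integral) auto
  also have "(\<integral>x. c_Phi \<Phi> * ?f x \<partial>lborel) = 1" using pos by (simp add: c_Phi_def)
  finally show "(\<integral>\<^sup>+x. ennreal (c_Phi \<Phi> * exp (- \<Phi> \<bar>x\<bar>)) \<partial>lborel) = 1" by simp
qed

text \<open>Keeping the density separate from Lebesgue measure lets translations act on the latter
  without change, while their effect on the weight is estimated pointwise.\<close>

definition omega :: "real ^ 'n::finite \<Rightarrow> real" where
  "omega x = (\<Prod>i\<in>UNIV. c_Phi \<Phi> * exp (- \<Phi> \<bar>x $ i\<bar>))"

lemma omega_pos: "0 < omega x"
  unfolding omega_def by (intro prod_pos) (auto simp: c_Phi_pos)

lemma omega_nonneg [simp]: "0 \<le> omega x"
  using omega_pos[of x] by simp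

lemma omega_borel [measurable]: "omega \<in> borel_measurable borel"
proof -
  have [measurable]: "(\<lambda>x::real^'n. \<Phi> \<bar>x $ i\<bar>) \<in> borel_measurable borel" for i
    by (rule measurable_compose[OF _ Phi_borel]) measurable
  show ?thesis unfolding omega_def by measurable
qed

lemma mu_eq: "mu_Phi_n \<Phi> = density lborel (\<lambda>x. ennreal (omega x))"
  by (simp add: mu_Phi_n_def omega_def)

lemma sets_mu [measurable_cong, simp]: "sets (mu_Phi_n \<Phi>) = sets borel"
  and space_mu [simp]: "space (mu_Phi_n \<Phi>) = UNIV"
  by (simp_all add: mu_eq)

lemma nn_integral_mu:
  "f \<in> borel_measurable borel \<Longrightarrow> (\<integral>\<^sup>+x. f x \<partial>mu_Phi_n \<Phi>) = (\<integral>\<^sup>+x. ennreal (omega x) * f x \<partial>lborel)"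
  by (simp add: mu_eq nn_integral_density)

lemma AE_mu: "(AE x in mu_Phi_n \<Phi>. P x) \<longleftrightarrow> (AE x in lborel. P x)"
  unfolding mu_eq by (subst AE_density) (auto simp: omega_pos)

text \<open>By the product formula the remaining coordinates contribute factors 1, the mass of the
  one-dimensional measure.\<close>

lemma nn_integral_mu_coord:
  fixes f :: "real \<Rightarrow> ennreal" and i :: "'n::finite"
  assumes [measurable]: "f \<in> borel_measurable borel"
  shows "(\<integral>\<^sup>+x. f (x $ i) \<partial>(mu_Phi_n \<Phi> :: (real ^ 'n) measure)) = (\<integral>\<^sup>+t. ennreal (c_Phi \<Phi> * exp (- \<Phi> \<bar>t\<bar>)) * f t \<partial>lborel)"
proof -
  define w where "w t = ennreal (c_Phi \<Phi> * exp (- \<Phi> \<bar>t\<bar>))" for t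
  define F where "F j t = w t * (if j = i then f t else 1)" for j t
  have [measurable]: "w \<in> borel_measurable borel" unfolding w_def by measurable
  have [measurable]: "F j \<in> borel_measurable borel" for j unfolding F_def by measurable
  have om: "ennreal (omega x) = (\<Prod>j\<in>UNIV. w (x $ j))" for x :: "real ^ 'n"
    unfolding omega_def w_def by (rule prod_ennreal[symmetric]) (use c_Phi_pos in auto)
  have "(\<integral>\<^sup>+x. f (x $ i) \<partial>(mu_Phi_n \<Phi> :: (real ^ 'n) measure)) = (\<integral>\<^sup>+x. (\<Prod>j\<in>UNIV. F j (x $ j)) \<partial>(lborel :: (real ^ 'n) measure))"
    by (subst nn_integral_mu) (auto simp: om F_def prod.distrib prod.delta intro!: nn_integral_cong)
  also have "\<dots> = (\<Prod>j\<in>UNIV. (\<integral>\<^sup>+t. F j t \<partial>lborel))" by (rule nn_integral_lborel_prod_vec) measurable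
  also have "\<dots> = (\<Prod>j\<in>UNIV. if j = i then (\<integral>\<^sup>+t. w t * f t \<partial>lborel) else 1)"
    by (intro prod.cong refl) (auto simp: F_def w_def c_Phi_nn_integral)
  finally show ?thesis by (simp add: prod.delta w_def)
qed

lemma emeasure_mu: "emeasure (mu_Phi_n \<Phi> :: (real ^ 'n::finite) measure) UNIV = 1"
proof -
  fix i :: 'n
  show ?thesis
    using nn_integral_mu_coord[of "\<lambda>_. 1" i] c_Phi_nn_integral by simp
qed

text \<open>Both parts say that the weight falls on the way outward through the half-space selected
  by the sign \<sigma>. The first lets the weight at the end of a segment be replaced by the weight
  at any point of it, so that increments are integrated against the measure itself; the second is
  the gain.\<close>

lemma omega_line:
  fixes x :: "real ^ 'n::finite"
  assumes "\<sigma> = 1 \<or> \<sigma> = - 1" "0 < R" "R < \<sigma> * x $ i" "0 \<le> s" "s \<le> h"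
  shows "omega (x + (\<sigma> * h) *\<^sub>R axis i 1) \<le> omega (x + (\<sigma> * s) *\<^sub>R axis i 1)"
    and "omega (x + (\<sigma> * h) *\<^sub>R axis i 1) \<le> exp (- (h * (\<Phi> R / R))) * omega x"
proof -
  define P where "P = (\<Prod>j\<in>UNIV - {i}. c_Phi \<Phi> * exp (- \<Phi> \<bar>x $ j\<bar>))"
  have P: "0 \<le> P" unfolding P_def by (intro prod_nonneg) (use c_Phi_pos in auto)
  have om: "omega (x + (\<sigma> * s) *\<^sub>R axis i 1) = c_Phi \<Phi> * exp (- \<Phi> (\<sigma> * x $ i + s)) * P" if "0 \<le> s" for s
  proof -
    have "\<bar>(x + (\<sigma> * s) *\<^sub>R axis i 1) $ i\<bar> = \<sigma> * x $ i + s" using assms(1-3) that by (auto simp: axis_def)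
    then show ?thesis unfolding omega_def P_def by (subst prod.remove[of _ i]) (auto intro!: prod.cong simp: axis_def)
  qed
  have om0: "omega x = c_Phi \<Phi> * exp (- \<Phi> (\<sigma> * x $ i)) * P" using om[of 0] by simp
  show "omega (x + (\<sigma> * h) *\<^sub>R axis i 1) \<le> omega (x + (\<sigma> * s) *\<^sub>R axis i 1)"
    using assms P c_Phi_pos by (auto simp: om intro!: mult_right_mono Phi_mono)
  have "exp (- \<Phi> (\<sigma> * x $ i + h)) \<le> exp (- (h * (\<Phi> R / R))) * exp (- \<Phi> (\<sigma> * x $ i))"
    using Phi_increment[of R "\<sigma> * x $ i" h] assms unfolding exp_add[symmetric] by simp
  then have "(c_Phi \<Phi> * P) * exp (- \<Phi> (\<sigma> * x $ i + h)) \<le> (c_Phi \<Phi> * P) * (exp (- (h * (\<Phi> R / R))) * exp (- \<Phi> (\<sigma> * x $ i)))"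
    using P c_Phi_pos by (intro mult_left_mono) auto
  then show "omega (x + (\<sigma> * h) *\<^sub>R axis i 1) \<le> exp (- (h * (\<Phi> R / R))) * omega x"
    using assms by (simp add: om om0 mult_ac)
qed

text \<open>Translating by \<open>h\<close> in the outward direction lowers the weight by the factor
  \<open>exp (- h * \<Phi> R / R)\<close>, so the mass of \<open>v\<close> beyond \<open>R + h\<close> is controlled by the total mass times that factor
  plus the cost \<open>h powr p\<close> of the increments. With \<open>h = (\<Phi> R / R) powr (- 1/2)\<close> both terms vanish as \<open>R\<close>
  grows if \<open>\<Phi>\<close> is superlinear.\<close>

lemma tail_estimate:
  fixes v :: "real ^ 'n::finite \<Rightarrow> real"
  assumes vG: "tgrad v G" and p: "1 \<le> p" and R: "0 < R" and h: "0 \<le> h" and \<sigma>: "\<sigma> = 1 \<or> \<sigma> = - 1"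
  shows "(\<integral>\<^sup>+x. ennreal (\<bar>v x\<bar> powr p) * indicator {x. R + h < \<sigma> * x $ i} x \<partial>mu_Phi_n \<Phi>) \<le>
    ennreal (2 powr p) * (ennreal (exp (- (h * (\<Phi> R / R)))) * (\<integral>\<^sup>+x. ennreal (\<bar>v x\<bar> powr p) \<partial>mu_Phi_n \<Phi>)
       + ennreal (h powr p) * (\<integral>\<^sup>+x. ennreal (G x powr p) \<partial>mu_Phi_n \<Phi>))"
proof -
  note [measurable] = tgrad_borel(1,2)[OF vG]
  define z :: "real ^ 'n" where "z = (\<sigma> * h) *\<^sub>R axis i 1"
  have nz: "norm z = h" using \<sigma> h by (auto simp: z_def)
  let ?S = "{x. R < \<sigma> * x $ i}"
  let ?E = "ennreal (exp (- (h * (\<Phi> R / R))))"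
  have shift_S: "x + z \<in> {x. R + h < \<sigma> * x $ i} \<longleftrightarrow> x \<in> ?S" for x
    using \<sigma> by (auto simp: z_def axis_def)
  have [measurable]: "{x. R + h < \<sigma> * x $ i} \<in> sets borel" "?S \<in> sets borel" by measurable
  have om1: "omega (x + z) \<le> omega (x + t *\<^sub>R z)" if "x \<in> ?S" "0 \<le> t" "t \<le> 1" for x t
  proof -
    have "omega (x + (\<sigma> * h) *\<^sub>R axis i 1) \<le> omega (x + (\<sigma> * (t * h)) *\<^sub>R axis i 1)"
      using that h by (intro omega_line(1)[OF \<sigma> R]) (auto intro: mult_left_le_one_le)
    then show ?thesis by (simp add: z_def mult_ac)
  qed
  have om2: "omega (x + z) \<le> exp (- (h * (\<Phi> R / R))) * omega x" if "x \<in> ?S" for x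
    using that h unfolding z_def by (intro omega_line(2)[OF \<sigma> R, where s=0]) auto
  have "(\<integral>\<^sup>+x. ennreal (\<bar>v x\<bar> powr p) * indicator {x. R + h < \<sigma> * x $ i} x \<partial>mu_Phi_n \<Phi>)
     = (\<integral>\<^sup>+x. ennreal (omega x) * (ennreal (\<bar>v x\<bar> powr p) * indicator {x. R + h < \<sigma> * x $ i} x) \<partial>lborel)"
    by (rule nn_integral_mu) measurable
  \<comment> \<open>The substitution pulls the far half-space back to the one starting at
    \<open>R\<close>, where both comparisons of the weight apply.\<close>
  also have "\<dots> = (\<integral>\<^sup>+x. ennreal (omega (x + z)) * (ennreal (\<bar>v (x + z)\<bar> powr p) * indicator {x. R + h < \<sigma> * x $ i} (x + z)) \<partial>lborel)"
    by (rule nn_integral_lborel_shift[symmetric]) measurable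
  also have "\<dots> \<le> (\<integral>\<^sup>+x. ennreal (2 powr p) * (?E * (ennreal (omega x) * ennreal (\<bar>v x\<bar> powr p))) + 
      ennreal (2 powr p) * (ennreal (h powr p) * (\<integral>\<^sup>+t. ennreal (omega (x + t *\<^sub>R z)) * (ennreal (G (x + t *\<^sub>R z) powr p) * indicator {0..1} t) \<partial>lborel)) \<partial>lborel)"
  proof (intro nn_integral_mono_AE)
    show "AE x in lborel. ennreal (omega (x + z)) * (ennreal (\<bar>v (x + z)\<bar> powr p) * indicator {x. R + h < \<sigma> * x $ i} (x + z)) \<le>
      ennreal (2 powr p) * (?E * (ennreal (omega x) * ennreal (\<bar>v x\<bar> powr p))) + 
      ennreal (2 powr p) * (ennreal (h powr p) * (\<integral>\<^sup>+t. ennreal (omega (x + t *\<^sub>R z)) * (ennreal (G (x + t *\<^sub>R z) powr p) * indicator {0..1} t) \<partial>lborel))"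
      using tgrad_powr[OF vG p, of z]
    proof eventually_elim
      case (elim x)
      show ?case
      proof (cases "x \<in> ?S")
        case True
        have "\<bar>v (x + z)\<bar> powr p \<le> (\<bar>v x\<bar> + \<bar>v (x + z) - v x\<bar>) powr p" using p by (intro powr_mono2) auto
        also have "\<dots> \<le> 2 powr p * (\<bar>v x\<bar> powr p + \<bar>v (x + z) - v x\<bar> powr p)" using p by (intro powr_add_le) auto
        finally have "ennreal (omega (x + z)) * ennreal (\<bar>v (x + z)\<bar> powr p) \<le> ennreal (omega (x + z)) * ennreal (2 powr p * (\<bar>v x\<bar> powr p + \<bar>v (x + z) - v x\<bar> powr p))"
          by (intro mult_left_mono ennreal_leI) auto
        also have "\<dots> = ennreal (2 powr p) * (ennreal (omega (x + z)) * ennreal (\<bar>v x\<bar> powr p)) + ennreal (2 powr p) * (ennreal (omega (x + z)) * ennreal (\<bar>v (x + z) - v x\<bar> powr p))"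
          by (simp add: ennreal_mult distrib_left mult_ac)
        also have "\<dots> \<le> ennreal (2 powr p) * (?E * (ennreal (omega x) * ennreal (\<bar>v x\<bar> powr p))) + 
            ennreal (2 powr p) * (ennreal (h powr p) * (\<integral>\<^sup>+t. ennreal (omega (x + t *\<^sub>R z)) * (ennreal (G (x + t *\<^sub>R z) powr p) * indicator {0..1} t) \<partial>lborel))"
        proof (intro add_mono mult_left_mono)
          have "ennreal (omega (x + z)) \<le> ?E * ennreal (omega x)"
            using om2[OF True] by (subst ennreal_mult[symmetric]) (auto intro: ennreal_leI)
          then show "ennreal (omega (x + z)) * ennreal (\<bar>v x\<bar> powr p) \<le> ?E * (ennreal (omega x) * ennreal (\<bar>v x\<bar> powr p))"
            by (metis mult.assoc mult_right_mono zero_le)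
          have "ennreal (omega (x + z)) * ennreal (\<bar>v (x + z) - v x\<bar> powr p) \<le> ennreal (omega (x + z)) * (ennreal (h powr p) * (\<integral>\<^sup>+t. ennreal (G (x + t *\<^sub>R z) powr p) * indicator {0..1} t \<partial>lborel))"
            using elim unfolding nz by (rule mult_left_mono) simp
          also have "\<dots> = ennreal (h powr p) * (\<integral>\<^sup>+t. ennreal (omega (x + z)) * (ennreal (G (x + t *\<^sub>R z) powr p) * indicator {0..1} t) \<partial>lborel)"
            by (subst nn_integral_cmult) (auto simp: mult_ac)
          also have "\<dots> \<le> ennreal (h powr p) * (\<integral>\<^sup>+t. ennreal (omega (x + t *\<^sub>R z)) * (ennreal (G (x + t *\<^sub>R z) powr p) * indicator {0..1} t) \<partial>lborel)"
            using om1[OF True] by (intro mult_left_mono nn_integral_mono) (auto simp: indicator_def intro!: mult_right_mono ennreal_leI)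
          finally show "ennreal (omega (x + z)) * ennreal (\<bar>v (x + z) - v x\<bar> powr p) \<le> ennreal (h powr p) * (\<integral>\<^sup>+t. ennreal (omega (x + t *\<^sub>R z)) * (ennreal (G (x + t *\<^sub>R z) powr p) * indicator {0..1} t) \<partial>lborel)" .
        qed auto
        finally show ?thesis using True shift_S[of x] by (simp add: indicator_def)
      next
        case False
        then have "indicator {x. R + h < \<sigma> * x $ i} (x + z) = (0::ennreal)" using shift_S[of x] by (simp add: indicator_def)
        then show ?thesis by (simp only: mult_zero_right zero_le)
      qed
    qed
  qed
  also have "\<dots> = ennreal (2 powr p) * (?E * (\<integral>\<^sup>+x. ennreal (omega x) * ennreal (\<bar>v x\<bar> powr p) \<partial>lborel)) + 
      ennreal (2 powr p) * (ennreal (h powr p) * (\<integral>\<^sup>+x. \<integral>\<^sup>+t. ennreal (omega (x + t *\<^sub>R z)) * (ennreal (G (x + t *\<^sub>R z) powr p) * indicator {0..1} t) \<partial>lborel \<partial>lborel))"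
    by (subst nn_integral_add) (auto simp: nn_integral_cmult)
  \<comment> \<open>After the exchange of integrals, weight and gradient are evaluated at the same
    translated point; translation invariance makes every slice equal to the full integral of
    \<open>G powr p\<close>.\<close>
  also have "(\<integral>\<^sup>+x. \<integral>\<^sup>+t. ennreal (omega (x + t *\<^sub>R z)) * (ennreal (G (x + t *\<^sub>R z) powr p) * indicator {0..1} t) \<partial>lborel \<partial>lborel)
      = (\<integral>\<^sup>+t. \<integral>\<^sup>+x. ennreal (omega (x + t *\<^sub>R z)) * (ennreal (G (x + t *\<^sub>R z) powr p) * indicator {0..1} t) \<partial>lborel \<partial>lborel)"
    by (intro lborel_pair.Fubini'[symmetric]) measurable
  also have "\<dots> = (\<integral>\<^sup>+t. (\<integral>\<^sup>+x. ennreal (omega x) * ennreal (G x powr p) \<partial>lborel) * indicator {0..1::real} t \<partial>lborel)"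
  proof (intro nn_integral_cong)
    fix t :: real
    have "(\<integral>\<^sup>+x. ennreal (omega (x + t *\<^sub>R z)) * (ennreal (G (x + t *\<^sub>R z) powr p) * indicator {0..1} t) \<partial>lborel)
       = (\<integral>\<^sup>+x. (ennreal (omega (x + t *\<^sub>R z)) * ennreal (G (x + t *\<^sub>R z) powr p)) * indicator {0..1} t \<partial>lborel)"
      by (simp add: mult.assoc)
    also have "\<dots> = (\<integral>\<^sup>+x. ennreal (omega (x + t *\<^sub>R z)) * ennreal (G (x + t *\<^sub>R z) powr p) \<partial>lborel) * indicator {0..1} t"
      by (rule nn_integral_multc) measurable
    also have "(\<integral>\<^sup>+x. ennreal (omega (x + t *\<^sub>R z)) * ennreal (G (x + t *\<^sub>R z) powr p) \<partial>lborel) = (\<integral>\<^sup>+x. ennreal (omega x) * ennreal (G x powr p) \<partial>lborel)"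
      by (rule nn_integral_lborel_shift) measurable
    finally show "(\<integral>\<^sup>+x. ennreal (omega (x + t *\<^sub>R z)) * (ennreal (G (x + t *\<^sub>R z) powr p) * indicator {0..1} t) \<partial>lborel) = (\<integral>\<^sup>+x. ennreal (omega x) * ennreal (G x powr p) \<partial>lborel) * indicator {0..1::real} t" .
  qed
  also have "\<dots> = (\<integral>\<^sup>+x. ennreal (omega x) * ennreal (G x powr p) \<partial>lborel)"
    by (subst nn_integral_cmult) auto
  finally show ?thesis by (simp add: nn_integral_mu distrib_left)
qed

end

section \<open>Local Poincare inequality and precompactness\<close>

text \<open>The deviation of \<open>v x\<close> from its mean is the mean over \<open>y\<close> in
  \<open>Q\<close> of \<open>v x - v y\<close>. Jensen's inequality and the substitution y = x + z
  produce an integral over translations \<open>z\<close> in \<open>Z\<close>; for each of them the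
  segment stays in \<open>Q\<close> and costs at most \<open>d powr p\<close> times the integral of
  \<open>G powr p\<close> over \<open>Q\<close>. The factor \<open>W / V\<close> compares the
  measure of the translations with that of \<open>Q\<close>.\<close>

lemma local_Poincare:
  fixes v :: "'a::euclidean_space \<Rightarrow> real"
  assumes vG: "tgrad v G" and p: "1 \<le> p"
    and Q[measurable]: "Q \<in> sets borel" and Z[measurable]: "Z \<in> sets borel"
    and V: "emeasure lborel Q = ennreal V" "0 < V"
    and cvx: "\<And>x z t. x \<in> Q \<Longrightarrow> x + z \<in> Q \<Longrightarrow> 0 \<le> t \<Longrightarrow> t \<le> 1 \<Longrightarrow> x + t *\<^sub>R z \<in> Q"
    and QZ: "\<And>x z. x \<in> Q \<Longrightarrow> x + z \<in> Q \<Longrightarrow> z \<in> Z"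
    and W: "emeasure lborel Z \<le> ennreal W" "0 \<le> W"
    and d: "\<And>z. z \<in> Z \<Longrightarrow> norm z \<le> d" "0 \<le> d"
    and vi: "set_integrable lborel Q v" and a: "a = (\<integral>x. indicator Q x * v x \<partial>lborel) / V"
  shows "(\<integral>\<^sup>+x. ennreal (\<bar>v x\<bar> powr p) * indicator Q x \<partial>lborel) \<le>
     ennreal (2 powr p) * (ennreal (V * \<bar>a\<bar> powr p) + ennreal (W / V * d powr p) * (\<integral>\<^sup>+x. ennreal (G x powr p) * indicator Q x \<partial>lborel))"
proof -
  note [measurable] = tgrad_borel(1,2)[OF vG]
  let ?IG = "\<integral>\<^sup>+x. ennreal (G x powr p) * indicator Q x \<partial>lborel"
  let ?M = "restrict_space lborel Q"
  have M: "emeasure ?M (space ?M) = ennreal V" using V by (simp add: emeasure_restrict_space space_restrict_space)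
  have J: "ennreal (\<bar>v x - a\<bar> powr p) \<le> ennreal (1 / V) * (\<integral>\<^sup>+y. ennreal (\<bar>v x - v y\<bar> powr p) * indicator Q y \<partial>lborel)" for x
  proof -
    have iQ: "integrable lborel (indicator Q :: 'a \<Rightarrow> real)"
      using V by (intro integrable_real_indicator) auto
    have "v x - a = (\<integral>y. indicator Q y * ((v x - v y) / V) \<partial>lborel)"
    proof -
      have "(\<integral>y. indicator Q y * ((v x - v y) / V) \<partial>lborel) = (\<integral>y. (v x / V) * indicator Q y - (1 / V) * (indicator Q y * v y) \<partial>lborel)"
        by (intro Bochner_Integration.integral_cong refl) (auto simp: field_simps diff_divide_distrib)
      also have "\<dots> = (v x / V) * measure lborel Q - (1 / V) * (\<integral>x. indicator Q x * v x \<partial>lborel)"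
        using iQ vi unfolding set_integrable_def by (subst Bochner_Integration.integral_diff) auto
      finally show ?thesis using V by (simp add: a measure_def)
    qed
    then have "ennreal \<bar>v x - a\<bar> \<le> (\<integral>\<^sup>+y. ennreal (norm (indicator Q y * ((v x - v y) / V))) \<partial>lborel)"
    proof -
      have "integrable lborel (\<lambda>y. (v x / V) * indicator Q y - (1 / V) * (indicator Q y * v y))"
        using iQ vi unfolding set_integrable_def by auto
      also have "(\<lambda>y. (v x / V) * indicator Q y - (1 / V) * (indicator Q y * v y)) = (\<lambda>y. indicator Q y * ((v x - v y) / V))"
        by (auto simp: field_simps diff_divide_distrib fun_eq_iff)
      finally have i: "integrable lborel (\<lambda>y. indicator Q y * ((v x - v y) / V))" .
      show ?thesis using integral_norm_bound_ennreal[OF i] \<open>v x - a = _\<close> by simp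
    qed
    also have "\<dots> = (\<integral>\<^sup>+y. ennreal (\<bar>v x - v y\<bar> / V) \<partial>?M)"
      using V by (auto simp: nn_integral_restrict_space indicator_def intro!: nn_integral_cong)
    finally have "ennreal (\<bar>v x - a\<bar> powr p) \<le> ennreal (V powr (p - 1)) * (\<integral>\<^sup>+y. ennreal ((\<bar>v x - v y\<bar> / V) powr p) \<partial>?M)"
      using V p by (intro nn_integral_powr_Jensen[OF M]) (auto intro!: measurable_restrict_space1)
    also have "\<dots> = ennreal (V powr (p - 1)) * (\<integral>\<^sup>+y. ennreal (V powr (- p)) * (ennreal (\<bar>v x - v y\<bar> powr p) * indicator Q y) \<partial>lborel)"
    proof -
      have "(\<bar>v x - v y\<bar> / V) powr p = V powr (- p) * \<bar>v x - v y\<bar> powr p" for y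
        using V by (simp add: powr_divide powr_minus_divide)
      then show ?thesis by (simp add: nn_integral_restrict_space ennreal_mult mult.assoc)
    qed
    also have "\<dots> = ennreal (V powr (p - 1)) * (ennreal (V powr (- p)) * (\<integral>\<^sup>+y. ennreal (\<bar>v x - v y\<bar> powr p) * indicator Q y \<partial>lborel))"
      by (subst nn_integral_cmult) auto
    also have "\<dots> = ennreal (V powr (p - 1) * V powr (- p)) * (\<integral>\<^sup>+y. ennreal (\<bar>v x - v y\<bar> powr p) * indicator Q y \<partial>lborel)"
      by (simp add: ennreal_mult mult.assoc)
    \<comment> \<open>One power comes from the mass in Jensen's inequality, the other from the
      factor 1/V inside the mean.\<close>
    also have "V powr (p - 1) * V powr (- p) = 1 / V"
      using V powr_minus_divide[of V 1] by (simp only: powr_add[symmetric]) simp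
    finally show ?thesis .
  qed
  have inner: "(\<integral>\<^sup>+x. ennreal (\<bar>v (x + z) - v x\<bar> powr p) * indicator Q x * indicator Q (x + z) \<partial>lborel) \<le> ennreal (d powr p) * ?IG * indicator Z z" for z
  proof (cases "z \<in> Z")
    case True
    have "(\<integral>\<^sup>+x. ennreal (\<bar>v (x + z) - v x\<bar> powr p) * indicator Q x * indicator Q (x + z) \<partial>lborel)
      \<le> (\<integral>\<^sup>+x. ennreal (d powr p) * (\<integral>\<^sup>+t. ennreal (G (x + t *\<^sub>R z) powr p) * indicator Q (x + t *\<^sub>R z) * indicator {0..1} t \<partial>lborel) \<partial>lborel)"
    proof (intro nn_integral_mono_AE)
      show "AE x in lborel. ennreal (\<bar>v (x + z) - v x\<bar> powr p) * indicator Q x * indicator Q (x + z) \<le> ennreal (d powr p) * (\<integral>\<^sup>+t. ennreal (G (x + t *\<^sub>R z) powr p) * indicator Q (x + t *\<^sub>R z) * indicator {0..1} t \<partial>lborel)"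
        using tgrad_powr[OF vG p, of z]
      proof eventually_elim
        case (elim x)
        show ?case
        proof (cases "x \<in> Q \<and> x + z \<in> Q")
          case True
          have "ennreal (\<bar>v (x + z) - v x\<bar> powr p) \<le> ennreal (norm z powr p) * (\<integral>\<^sup>+t. ennreal (G (x + t *\<^sub>R z) powr p) * indicator {0..1} t \<partial>lborel)" by fact
          also have "\<dots> \<le> ennreal (d powr p) * (\<integral>\<^sup>+t. ennreal (G (x + t *\<^sub>R z) powr p) * indicator Q (x + t *\<^sub>R z) * indicator {0..1} t \<partial>lborel)"
          proof (rule mult_mono)
            show "ennreal (norm z powr p) \<le> ennreal (d powr p)"
              using d(1)[OF \<open>z \<in> Z\<close>] p by (intro ennreal_leI powr_mono2) auto
            show "(\<integral>\<^sup>+t. ennreal (G (x + t *\<^sub>R z) powr p) * indicator {0..1} t \<partial>lborel) \<le> (\<integral>\<^sup>+t. ennreal (G (x + t *\<^sub>R z) powr p) * indicator Q (x + t *\<^sub>R z) * indicator {0..1} t \<partial>lborel)"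
            proof (rule nn_integral_mono)
              fix t :: real
              show "ennreal (G (x + t *\<^sub>R z) powr p) * indicator {0..1} t \<le> ennreal (G (x + t *\<^sub>R z) powr p) * indicator Q (x + t *\<^sub>R z) * indicator {0..1} t"
                using True cvx[of x z t] by (cases "t \<in> {0..1}") auto
            qed
          qed auto
          finally show ?thesis using True by simp
        qed (auto simp: indicator_def)
      qed
    qed
    also have "\<dots> = ennreal (d powr p) * (\<integral>\<^sup>+x. \<integral>\<^sup>+t. ennreal (G (x + t *\<^sub>R z) powr p) * indicator Q (x + t *\<^sub>R z) * indicator {0..1} t \<partial>lborel \<partial>lborel)"
      by (rule nn_integral_cmult) measurable
    also have "(\<integral>\<^sup>+x. \<integral>\<^sup>+t. ennreal (G (x + t *\<^sub>R z) powr p) * indicator Q (x + t *\<^sub>R z) * indicator {0..1} t \<partial>lborel \<partial>lborel)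
      = (\<integral>\<^sup>+t. \<integral>\<^sup>+x. ennreal (G (x + t *\<^sub>R z) powr p) * indicator Q (x + t *\<^sub>R z) * indicator {0..1} t \<partial>lborel \<partial>lborel)"
      by (intro lborel_pair.Fubini'[symmetric]) measurable
    also have "\<dots> = (\<integral>\<^sup>+t. ?IG * indicator {0..1::real} t \<partial>lborel)"
    proof (intro nn_integral_cong)
      fix t :: real
      have "(\<integral>\<^sup>+x. ennreal (G (x + t *\<^sub>R z) powr p) * indicator Q (x + t *\<^sub>R z) * indicator {0..1} t \<partial>lborel)
         = (\<integral>\<^sup>+x. ennreal (G (x + t *\<^sub>R z) powr p) * indicator Q (x + t *\<^sub>R z) \<partial>lborel) * indicator {0..1} t"
        by (rule nn_integral_multc) measurable
      also have "(\<integral>\<^sup>+x. ennreal (G (x + t *\<^sub>R z) powr p) * indicator Q (x + t *\<^sub>R z) \<partial>lborel) = ?IG"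
        by (rule nn_integral_lborel_shift) measurable
      finally show "(\<integral>\<^sup>+x. ennreal (G (x + t *\<^sub>R z) powr p) * indicator Q (x + t *\<^sub>R z) * indicator {0..1} t \<partial>lborel) = ?IG * indicator {0..1::real} t" .
    qed
    also have "\<dots> = ?IG" by (subst nn_integral_cmult) auto
    finally show ?thesis using True by simp
  next
    case False
    then have "indicator Q x * indicator Q (x + z) = (0::ennreal)" for x using QZ[of x z] by (auto simp: indicator_def)
    then show ?thesis by (simp only: mult.assoc mult_zero_right zero_le nn_integral_const mult_zero_left)
  qed
  have "(\<integral>\<^sup>+x. ennreal (\<bar>v x - a\<bar> powr p) * indicator Q x \<partial>lborel) \<le> (\<integral>\<^sup>+x. ennreal (1 / V) * (\<integral>\<^sup>+y. ennreal (\<bar>v x - v y\<bar> powr p) * indicator Q y \<partial>lborel) * indicator Q x \<partial>lborel)"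
    using J by (intro nn_integral_mono mult_right_mono) auto
  \<comment> \<open>The substitution y = x + z; the condition on \<open>y\<close> becomes the second
    indicator.\<close>
  also have "\<dots> = (\<integral>\<^sup>+x. ennreal (1 / V) * (\<integral>\<^sup>+z. ennreal (\<bar>v (x + z) - v x\<bar> powr p) * indicator Q x * indicator Q (x + z) \<partial>lborel) \<partial>lborel)"
  proof (intro nn_integral_cong)
    fix x
    have "(\<integral>\<^sup>+y. ennreal (\<bar>v x - v y\<bar> powr p) * indicator Q y \<partial>lborel) = (\<integral>\<^sup>+z. ennreal (\<bar>v x - v (z + x)\<bar> powr p) * indicator Q (z + x) \<partial>lborel)"
      by (rule nn_integral_lborel_shift[symmetric]) measurable
    then have "(\<integral>\<^sup>+y. ennreal (\<bar>v x - v y\<bar> powr p) * indicator Q y \<partial>lborel) = (\<integral>\<^sup>+z. ennreal (\<bar>v (x + z) - v x\<bar> powr p) * indicator Q (x + z) \<partial>lborel)"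
      by (simp add: add.commute abs_minus_commute)
    then show "ennreal (1 / V) * (\<integral>\<^sup>+y. ennreal (\<bar>v x - v y\<bar> powr p) * indicator Q y \<partial>lborel) * indicator Q x = ennreal (1 / V) * (\<integral>\<^sup>+z. ennreal (\<bar>v (x + z) - v x\<bar> powr p) * indicator Q x * indicator Q (x + z) \<partial>lborel)"
      by (cases "x \<in> Q") auto
  qed
  also have "\<dots> = ennreal (1 / V) * (\<integral>\<^sup>+x. \<integral>\<^sup>+z. ennreal (\<bar>v (x + z) - v x\<bar> powr p) * indicator Q x * indicator Q (x + z) \<partial>lborel \<partial>lborel)"
    by (rule nn_integral_cmult) measurable
  also have "(\<integral>\<^sup>+x. \<integral>\<^sup>+z. ennreal (\<bar>v (x + z) - v x\<bar> powr p) * indicator Q x * indicator Q (x + z) \<partial>lborel \<partial>lborel)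
     = (\<integral>\<^sup>+z. \<integral>\<^sup>+x. ennreal (\<bar>v (x + z) - v x\<bar> powr p) * indicator Q x * indicator Q (x + z) \<partial>lborel \<partial>lborel)"
    by (intro lborel_pair.Fubini'[symmetric]) measurable
  also have "\<dots> \<le> (\<integral>\<^sup>+z. ennreal (d powr p) * ?IG * indicator Z z \<partial>lborel)"
    by (intro nn_integral_mono inner)
  also have "\<dots> = ennreal (d powr p) * ?IG * emeasure lborel Z"
    by (subst nn_integral_cmult) auto
  finally have "(\<integral>\<^sup>+x. ennreal (\<bar>v x - a\<bar> powr p) * indicator Q x \<partial>lborel) \<le> ennreal (1 / V) * (ennreal (d powr p) * ?IG * emeasure lborel Z)"
    by (simp add: mult_left_mono)
  also have "\<dots> \<le> ennreal (1 / V) * (ennreal (d powr p) * ?IG * ennreal W)"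
    by (intro mult_left_mono W) auto
  also have "\<dots> = ennreal (W / V * d powr p) * ?IG"
    using V W by (simp add: ennreal_mult divide_inverse mult_ac)
  finally have osc: "(\<integral>\<^sup>+x. ennreal (\<bar>v x - a\<bar> powr p) * indicator Q x \<partial>lborel) \<le> ennreal (W / V * d powr p) * ?IG" .
  have "(\<integral>\<^sup>+x. ennreal (\<bar>v x\<bar> powr p) * indicator Q x \<partial>lborel) \<le> (\<integral>\<^sup>+x. ennreal (2 powr p) * (ennreal (\<bar>a\<bar> powr p) * indicator Q x + ennreal (\<bar>v x - a\<bar> powr p) * indicator Q x) \<partial>lborel)"
  proof (intro nn_integral_mono)
    fix x
    have "\<bar>v x\<bar> powr p \<le> (\<bar>a\<bar> + \<bar>v x - a\<bar>) powr p" using p by (intro powr_mono2) auto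
    also have "\<dots> \<le> 2 powr p * (\<bar>a\<bar> powr p + \<bar>v x - a\<bar> powr p)" using p by (intro powr_add_le) auto
    finally have "ennreal (\<bar>v x\<bar> powr p) \<le> ennreal (2 powr p) * (ennreal (\<bar>a\<bar> powr p) + ennreal (\<bar>v x - a\<bar> powr p))"
      by (subst ennreal_plus[symmetric], simp, simp, subst ennreal_mult[symmetric]) (auto intro: ennreal_leI)
    then show "ennreal (\<bar>v x\<bar> powr p) * indicator Q x \<le> ennreal (2 powr p) * (ennreal (\<bar>a\<bar> powr p) * indicator Q x + ennreal (\<bar>v x - a\<bar> powr p) * indicator Q x)"
      by (cases "x \<in> Q") auto
  qed
  also have "\<dots> = ennreal (2 powr p) * (ennreal (\<bar>a\<bar> powr p) * emeasure lborel Q + (\<integral>\<^sup>+x. ennreal (\<bar>v x - a\<bar> powr p) * indicator Q x \<partial>lborel))"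
    by (simp add: nn_integral_cmult nn_integral_add)
  also have "\<dots> \<le> ennreal (2 powr p) * (ennreal (V * \<bar>a\<bar> powr p) + ennreal (W / V * d powr p) * ?IG)"
    using V by (intro mult_left_mono add_mono osc) (auto simp: ennreal_mult mult.commute)
  finally show ?thesis .
qed

section \<open>Half-open cubes and averages over them\<close>

definition cell :: "real ^ 'n::finite \<Rightarrow> real \<Rightarrow> (real ^ 'n) set" where
  "cell a s = {x. \<forall>i. a $ i \<le> x $ i \<and> x $ i < a $ i + s}"

lemma cell_borel [measurable]: "cell a s \<in> sets borel"
  unfolding cell_def by measurable

lemma emeasure_cell:
  fixes a :: "real ^ 'n::finite"
  assumes "0 \<le> s"
  shows "emeasure lborel (cell a s) = ennreal (s ^ CARD('n))"
proof -
  have "indicator (cell a s) x = (\<Prod>i\<in>UNIV. indicator {a $ i..<a $ i + s} (x $ i) :: ennreal)" for x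
  proof (cases "x \<in> cell a s")
    case True
    then show ?thesis by (auto simp: cell_def)
  next
    case False
    then obtain i where "\<not> (a $ i \<le> x $ i \<and> x $ i < a $ i + s)" by (auto simp: cell_def)
    then have "(\<Prod>i\<in>UNIV. indicator {a $ i..<a $ i + s} (x $ i) :: ennreal) = 0"
      by (intro prod_zero) (auto intro!: bexI[of _ i] simp: indicator_def)
    with False show ?thesis by simp
  qed
  then have "emeasure lborel (cell a s) = (\<integral>\<^sup>+x. (\<Prod>i\<in>UNIV. indicator {a $ i..<a $ i + s} (x $ i)) \<partial>(lborel :: (real ^ 'n) measure))"
    by (simp only: nn_integral_indicator[OF cell_borel[folded sets_lborel], symmetric])
  also have "\<dots> = (\<Prod>i\<in>(UNIV::'n set). ennreal s)"
    using assms by (subst nn_integral_lborel_prod_vec) auto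
  finally show ?thesis using assms by (simp add: ennreal_power)
qed

definition cell_avg :: "real ^ 'n::finite \<Rightarrow> real \<Rightarrow> (real ^ 'n \<Rightarrow> real) \<Rightarrow> real" where
  "cell_avg a s v = (\<integral>x. indicator (cell a s) x * v x \<partial>lborel) / s ^ CARD('n)"

text \<open>Two points of a cube of side \<open>s\<close> differ by a vector in the cube with
  coordinates in [-s, s]. Its volume is \<open>2 ^ CARD('n)\<close> times that of the cell, and by
  the l^1 bound its vectors have norm at most \<open>CARD('n) * s\<close>.\<close>

lemma cell_Poincare:
  fixes v :: "real ^ 'n::finite \<Rightarrow> real" and s :: real
  assumes vG: "tgrad v G" and p: "1 \<le> p" and s: "0 < s" and vi: "set_integrable lborel (cell a s) v"
  shows "(\<integral>\<^sup>+x. ennreal (\<bar>v x\<bar> powr p) * indicator (cell a s) x \<partial>lborel) \<le>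
     ennreal (2 powr p) * (ennreal (s ^ CARD('n) * \<bar>cell_avg a s v\<bar> powr p) + ennreal (2 ^ CARD('n) * (CARD('n) * s) powr p) * (\<integral>\<^sup>+x. ennreal (G x powr p) * indicator (cell a s) x \<partial>lborel))"
proof -
  let ?Z = "cbox (\<chi> i. - s) (\<chi> i. s) :: (real ^ 'n) set"
  have Z: "z \<in> ?Z \<longleftrightarrow> (\<forall>i. \<bar>z $ i\<bar> \<le> s)" for z
  proof -
    have "- s \<le> t \<and> t \<le> s \<longleftrightarrow> \<bar>t\<bar> \<le> s" for t by linarith
    then show ?thesis by (simp add: mem_box_cart)
  qed
  have mZ: "emeasure lborel ?Z = ennreal ((2 * s) ^ CARD('n))"
  proof -
    have "emeasure lborel ?Z = ennreal (\<Prod>b\<in>(Basis :: (real ^ 'n) set). ((\<chi> i. s) - (\<chi> i. - s)) \<bullet> b)"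
      using s by (intro emeasure_lborel_cbox) (auto simp: Basis_vec_def inner_axis)
    also have "(\<Prod>b\<in>(Basis :: (real ^ 'n) set). ((\<chi> i. s) - (\<chi> i. - s)) \<bullet> b) = (\<Prod>b\<in>(Basis :: (real ^ 'n) set). 2 * s)"
      by (intro prod.cong refl) (auto simp: Basis_vec_def inner_axis)
    finally show ?thesis by simp
  qed
  have "(\<integral>\<^sup>+x. ennreal (\<bar>v x\<bar> powr p) * indicator (cell a s) x \<partial>lborel) \<le>
     ennreal (2 powr p) * (ennreal (s ^ CARD('n) * \<bar>cell_avg a s v\<bar> powr p) + ennreal ((2 * s) ^ CARD('n) / s ^ CARD('n) * (CARD('n) * s) powr p) * (\<integral>\<^sup>+x. ennreal (G x powr p) * indicator (cell a s) x \<partial>lborel))"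
  proof (rule local_Poincare[OF vG p, where Z="?Z"])
    show "x + t *\<^sub>R z \<in> cell a s" if "x \<in> cell a s" "x + z \<in> cell a s" "0 \<le> t" "t \<le> 1" for x z t
      unfolding cell_def
    proof (clarify)
      fix i
      have i: "a $ i \<le> x $ i" "x $ i < a $ i + s" "a $ i \<le> x $ i + z $ i" "x $ i + z $ i < a $ i + s"
        using that by (auto simp: cell_def)
      have "x $ i + t * z $ i = (1 - t) * x $ i + t * (x $ i + z $ i)" by (simp add: algebra_simps)
      moreover have "(1 - t) * x $ i + t * (x $ i + z $ i) \<ge> (1 - t) * a $ i + t * a $ i"
        using i that by (intro add_mono mult_left_mono) auto
      moreover have "(1 - t) * x $ i + t * (x $ i + z $ i) \<le> max (x $ i) (x $ i + z $ i)"
        using that by (intro convex_bound_le) auto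
      ultimately show "a $ i \<le> (x + t *\<^sub>R z) $ i \<and> (x + t *\<^sub>R z) $ i < a $ i + s" using i by (auto simp: algebra_simps)
    qed
    show "z \<in> ?Z" if "x \<in> cell a s" "x + z \<in> cell a s" for x z
      unfolding Z
    proof
      fix i
      have "a $ i \<le> x $ i" "x $ i < a $ i + s" "a $ i \<le> x $ i + z $ i" "x $ i + z $ i < a $ i + s"
        using that by (auto simp: cell_def)
      then show "\<bar>z $ i\<bar> \<le> s" by linarith
    qed
    show "norm z \<le> CARD('n) * s" if "z \<in> ?Z" for z
    proof -
      have "norm z \<le> (\<Sum>i\<in>UNIV. \<bar>z $ i\<bar>)" by (rule norm_le_l1_cart)
      also have "\<dots> \<le> (\<Sum>i\<in>(UNIV::'n set). s)" using that Z by (intro sum_mono) auto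
      finally show ?thesis by simp
    qed
    show "cell_avg a s v = (\<integral>x. indicator (cell a s) x * v x \<partial>lborel) / s ^ CARD('n)" by (simp add: cell_avg_def)
  qed (use s vi mZ emeasure_cell[of s a] in auto)
  also have "(2 * s) ^ CARD('n) / s ^ CARD('n) = 2 ^ CARD('n)" using s by (simp add: power_mult_distrib)
  finally show ?thesis .
qed

lemma set_integrable_cellI:
  fixes v :: "real ^ 'n::finite \<Rightarrow> real"
  assumes [measurable]: "v \<in> borel_measurable borel" "A \<in> sets borel" and fin: "(\<integral>\<^sup>+x. ennreal \<bar>v x\<bar> * indicator A x \<partial>lborel) < \<infinity>"
  shows "set_integrable lborel A v"
  unfolding set_integrable_def
proof (rule integrableI_bounded)
  have "(\<integral>\<^sup>+x. ennreal (norm (indicator A x *\<^sub>R v x)) \<partial>lborel) = (\<integral>\<^sup>+x. ennreal \<bar>v x\<bar> * indicator A x \<partial>lborel)"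
    by (intro nn_integral_cong) (auto simp: indicator_def)
  then show "(\<integral>\<^sup>+x. ennreal (norm (indicator A x *\<^sub>R v x)) \<partial>lborel) < \<infinity>" using fin by simp
qed measurable

lemma cell_avg_le:
  fixes v :: "real ^ 'n::finite \<Rightarrow> real"
  assumes [measurable]: "v \<in> borel_measurable borel" and s: "0 < s" and K: "0 \<le> K" "(\<integral>\<^sup>+x. ennreal \<bar>v x\<bar> * indicator (cell a s) x \<partial>lborel) \<le> ennreal K"
  shows "\<bar>cell_avg a s v\<bar> \<le> K / s ^ CARD('n)"
proof -
  have i: "integrable lborel (\<lambda>x. indicator (cell a s) x * v x)"
    using set_integrable_cellI[of v "cell a s"] K(2) by (simp add: set_integrable_def le_less_trans)
  have "ennreal (norm (\<integral>x. indicator (cell a s) x * v x \<partial>lborel)) \<le> (\<integral>\<^sup>+x. ennreal (norm (indicator (cell a s) x * v x)) \<partial>lborel)"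
    by (rule integral_norm_bound_ennreal[OF i])
  also have "\<dots> = (\<integral>\<^sup>+x. ennreal \<bar>v x\<bar> * indicator (cell a s) x \<partial>lborel)"
    by (intro nn_integral_cong) (auto simp: indicator_def)
  also have "\<dots> \<le> ennreal K" by fact
  finally have "\<bar>\<integral>x. indicator (cell a s) x * v x \<partial>lborel\<bar> \<le> K" using K by simp
  then show ?thesis using s unfolding cell_avg_def by (simp add: divide_right_mono)
qed

section \<open>Diagonal subsequences and completeness of L^p\<close>

lemma bounded_family_convergent_subseq:
  fixes f :: "nat \<Rightarrow> 'b::countable \<Rightarrow> real"
  assumes M: "\<And>j b. \<bar>f j b\<bar> \<le> M b"
  obtains r where "strict_mono (r :: nat \<Rightarrow> nat)" "\<And>b. convergent (\<lambda>j. f (r j) b)"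
proof -
  interpret subseqs "\<lambda>n s. convergent (\<lambda>j. f (s j) (from_nat n))"
  proof
    fix n and s :: "nat \<Rightarrow> nat"
    have "bounded (range (\<lambda>j. f (s j) (from_nat n)))"
      unfolding bounded_iff using M by (intro exI[of _ "M (from_nat n)"]) auto
    from bounded_imp_convergent_subsequence[OF this] obtain l r where "strict_mono r" "((\<lambda>j. f (s j) (from_nat n)) \<circ> r) \<longlonglongrightarrow> l" by blast
    then show "\<exists>r'. strict_mono r' \<and> convergent (\<lambda>j. f ((s \<circ> r') j) (from_nat n))"
      by (auto simp: convergent_def o_def)
  qed
  show thesis
  proof (rule that[OF subseq_diagseq])
    fix b :: 'b
    \<comment> \<open>The diagonal sequence is a subsequence of the one selected for the index
      \<open>to_nat b\<close> only from a certain term on; dropping the initial terms does not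
      affect convergence.\<close>
    have "convergent (\<lambda>j. f ((diagseq \<circ> ((+) (Suc (to_nat b)))) j) (from_nat (to_nat b)))"
    proof (rule diagseq_holds)
      fix r s :: "nat \<Rightarrow> nat" and n assume "strict_mono r" "convergent (\<lambda>j. f (s j) (from_nat n))"
      then show "convergent (\<lambda>j. f ((s \<circ> r) j) (from_nat n))"
        using convergent_subseq_convergent[of "\<lambda>j. f (s j) (from_nat n)" r] by (simp add: o_def)
    qed
    then have "convergent (\<lambda>j. f (diagseq (j + Suc (to_nat b))) b)" by (simp add: o_def add.commute)
    then show "convergent (\<lambda>j. f (diagseq j) b)" by (subst (asm) convergent_ignore_initial_segment)
  qed
qed

text \<open>The Riesz-Fischer argument, carried out with integrals of p-th powers instead of norms:
  a rapidly Cauchy subsequence converges almost everywhere, and Fatou's lemma carries the Cauchy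
  bound over to the limit.\<close>

lemma Lp_complete:
  fixes u :: "nat \<Rightarrow> 'a \<Rightarrow> real"
  assumes [measurable]: "\<And>j. u j \<in> borel_measurable M" and p: "1 \<le> p"
    and C: "\<And>e. 0 < e \<Longrightarrow> \<exists>N. \<forall>i\<ge>N. \<forall>j\<ge>N. (\<integral>\<^sup>+x. ennreal (\<bar>u i x - u j x\<bar> powr p) \<partial>M) \<le> ennreal e"
  obtains g where "g \<in> borel_measurable M"
    "\<And>e. 0 < e \<Longrightarrow> \<exists>N. \<forall>j\<ge>N. (\<integral>\<^sup>+x. ennreal (\<bar>u j x - g x\<bar> powr p) \<partial>M) \<le> ennreal e"
proof -
  \<comment> \<open>The second denominator permits weighting the k-th increment by
    \<open>(2 powr p) ^ k\<close> with the series still integrable; finiteness of the weighted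
    series at a point then bounds the increment there by a multiple of
    \<open>(1/2) ^ k\<close>.\<close>
  define e where "e k = (1/2) ^ k / (2 powr p) ^ k" for k :: nat
  have e0: "e k > 0" for k by (simp add: e_def)
  obtain N where N: "\<And>k i j. i \<ge> N k \<Longrightarrow> j \<ge> N k \<Longrightarrow> (\<integral>\<^sup>+x. ennreal (\<bar>u i x - u j x\<bar> powr p) \<partial>M) \<le> ennreal (e k)"
    using C[OF e0] by metis
  \<comment> \<open>The sum makes the indices nondecreasing and at least \<open>N k\<close>; the
    summand \<open>k\<close> sends them to infinity.\<close>
  define s where "s k = k + (\<Sum>l\<le>k. N l)" for k
  have sN: "s k \<ge> N k" for k unfolding s_def by (simp add: trans_le_add2 member_le_sum)
  have smono: "s k \<le> s (Suc k)" for k by (simp add: s_def)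
  have sk: "k \<le> s k" for k by (simp add: s_def)
  define D where "D k x = u (s (Suc k)) x - u (s k) x" for k x
  have [measurable]: "D k \<in> borel_measurable M" for k unfolding D_def by measurable
  have Dk: "(\<integral>\<^sup>+x. ennreal (\<bar>D k x\<bar> powr p) \<partial>M) \<le> ennreal (e k)" for k
    unfolding D_def using sN[of k] smono[of k] by (intro N) auto
  have "(\<integral>\<^sup>+x. (\<Sum>k. ennreal ((2 powr p) ^ k) * ennreal (\<bar>D k x\<bar> powr p)) \<partial>M) = (\<Sum>k. \<integral>\<^sup>+x. ennreal ((2 powr p) ^ k) * ennreal (\<bar>D k x\<bar> powr p) \<partial>M)"
    by (rule nn_integral_suminf) measurable
  also have "\<dots> \<le> (\<Sum>k. ennreal ((1/2) ^ k))"
  proof (intro suminf_le)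
    fix k
    have "(\<integral>\<^sup>+x. ennreal ((2 powr p) ^ k) * ennreal (\<bar>D k x\<bar> powr p) \<partial>M) = ennreal ((2 powr p) ^ k) * (\<integral>\<^sup>+x. ennreal (\<bar>D k x\<bar> powr p) \<partial>M)"
      by (rule nn_integral_cmult) measurable
    also have "\<dots> \<le> ennreal ((2 powr p) ^ k) * ennreal (e k)" by (intro mult_left_mono Dk) simp
    also have "\<dots> = ennreal ((1/2) ^ k)" by (subst ennreal_mult[symmetric]) (auto simp: e_def)
    finally show "(\<integral>\<^sup>+x. ennreal ((2 powr p) ^ k) * ennreal (\<bar>D k x\<bar> powr p) \<partial>M) \<le> ennreal ((1/2) ^ k)" .
  qed auto
  also have "\<dots> = ennreal (\<Sum>k. (1/2) ^ k)"
    by (intro suminf_ennreal2) (auto intro: summable_geometric)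
  also have "\<dots> < \<infinity>" by simp
  finally have "AE x in M. (\<Sum>k. ennreal ((2 powr p) ^ k) * ennreal (\<bar>D k x\<bar> powr p)) \<noteq> \<infinity>"
    by (intro nn_integral_noteq_infinite) auto
  then have conv: "AE x in M. convergent (\<lambda>k. u (s k) x)"
  proof eventually_elim
    case (elim x)
    then obtain c where c: "(\<Sum>k. ennreal ((2 powr p) ^ k) * ennreal (\<bar>D k x\<bar> powr p)) = ennreal c" "c \<ge> 0"
      by (cases "(\<Sum>k. ennreal ((2 powr p) ^ k) * ennreal (\<bar>D k x\<bar> powr p))") auto
    have b: "\<bar>D k x\<bar> \<le> c powr (1/p) * (1/2) ^ k" for k
    proof -
      have "ennreal ((2 powr p) ^ k) * ennreal (\<bar>D k x\<bar> powr p) \<le> ennreal c"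
        unfolding c(1)[symmetric] using sum_le_suminf[of "\<lambda>k. ennreal ((2 powr p) ^ k) * ennreal (\<bar>D k x\<bar> powr p)" "{k}"] by simp
      then have "(2 powr p) ^ k * \<bar>D k x\<bar> powr p \<le> c"
        using c by (subst (asm) ennreal_mult[symmetric]) auto
      moreover have "(2 powr p) ^ k * \<bar>D k x\<bar> powr p = (2 ^ k * \<bar>D k x\<bar>) powr p"
        by (simp add: powr_mult powr_realpow[symmetric] powr_powr mult.commute)
      ultimately have "((2 ^ k * \<bar>D k x\<bar>) powr p) powr (1/p) \<le> c powr (1/p)"
        using p by (intro powr_mono2) auto
      then have "2 ^ k * \<bar>D k x\<bar> \<le> c powr (1/p)" using p by (simp add: powr_powr)
      then show ?thesis by (simp add: field_simps power_divide)
    qed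
    have "summable (\<lambda>k. D k x)"
      by (rule summable_comparison_test[OF _ summable_mult[OF summable_geometric[of "1/2::real"], of "c powr (1/p)"]]) (use b in auto)
    then have "summable (\<lambda>k. u (s (Suc k)) x - u (s k) x)" by (simp add: D_def)
    then have "convergent (\<lambda>n. \<Sum>k<n. u (s (Suc k)) x - u (s k) x)" by (simp add: summable_iff_convergent)
    then have "convergent (\<lambda>n. u (s n) x - u (s 0) x)"
      by (simp add: sum_lessThan_telescope[of "\<lambda>k. u (s k) x"])
    then have "convergent (\<lambda>n. (u (s n) x - u (s 0) x) + u (s 0) x)" by (intro convergent_add convergent_const)
    then show ?case by simp
  qed
  define g where "g x = lim (\<lambda>k. u (s k) x)" for x
  have g[measurable]: "g \<in> borel_measurable M" unfolding g_def by (intro borel_measurable_lim_metric) auto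
  show thesis
  proof (rule that[OF g])
    fix e :: real assume "e > 0"
    then obtain N where N: "\<And>i j. i \<ge> N \<Longrightarrow> j \<ge> N \<Longrightarrow> (\<integral>\<^sup>+x. ennreal (\<bar>u i x - u j x\<bar> powr p) \<partial>M) \<le> ennreal e"
      using C by metis
    have "(\<integral>\<^sup>+x. ennreal (\<bar>u j x - g x\<bar> powr p) \<partial>M) \<le> ennreal e" if j: "j \<ge> N" for j
    proof -
      have "(\<integral>\<^sup>+x. ennreal (\<bar>u j x - g x\<bar> powr p) \<partial>M) = (\<integral>\<^sup>+x. liminf (\<lambda>k. ennreal (\<bar>u j x - u (s k) x\<bar> powr p)) \<partial>M)"
      proof (intro nn_integral_cong_AE)
        show "AE x in M. ennreal (\<bar>u j x - g x\<bar> powr p) = liminf (\<lambda>k. ennreal (\<bar>u j x - u (s k) x\<bar> powr p))"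
          using conv
        proof eventually_elim
          case (elim x)
          then have "(\<lambda>k. u (s k) x) \<longlonglongrightarrow> g x" unfolding g_def by (simp add: convergent_LIMSEQ_iff)
          then have "(\<lambda>k. ennreal (\<bar>u j x - u (s k) x\<bar> powr p)) \<longlonglongrightarrow> ennreal (\<bar>u j x - g x\<bar> powr p)"
            using p by (intro tendsto_ennrealI tendsto_powr') (auto intro!: tendsto_intros)
          then show ?case by (intro lim_imp_Liminf[symmetric]) auto
        qed
      qed
      also have "\<dots> \<le> liminf (\<lambda>k. \<integral>\<^sup>+x. ennreal (\<bar>u j x - u (s k) x\<bar> powr p) \<partial>M)"
        by (rule nn_integral_liminf) measurable
      also have "\<dots> \<le> ennreal e"
      proof (rule Liminf_le)
        have "eventually (\<lambda>k. k \<ge> N) sequentially" by (rule eventually_ge_at_top)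
        then show "eventually (\<lambda>k. (\<integral>\<^sup>+x. ennreal (\<bar>u j x - u (s k) x\<bar> powr p) \<partial>M) \<le> ennreal e) sequentially"
          by eventually_elim (use j sk order_trans in \<open>auto intro!: N\<close>)
      qed simp
      finally show ?thesis .
    qed
    then show "\<exists>N. \<forall>j\<ge>N. (\<integral>\<^sup>+x. ennreal (\<bar>u j x - g x\<bar> powr p) \<partial>M) \<le> ennreal e" by blast
  qed
qed

abbreviation centered_cell :: "real \<Rightarrow> (real ^ 'n::finite) set" where
  "centered_cell S \<equiv> cell (\<chi> i. - S) (2 * S)"

lemma mem_centered_cell: "x \<in> centered_cell S \<longleftrightarrow> (\<forall>i. - S \<le> x $ i \<and> x $ i < S)"
  by (simp add: cell_def)

section \<open>Comparison with Lebesgue measure on cubes, and the gain of integrability\<close>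

context
  fixes \<Phi> :: "real \<Rightarrow> real"
  assumes adm: "admissible_Phi \<Phi>"
begin

abbreviation om :: "real ^ 'n::finite \<Rightarrow> real" where "om \<equiv> omega \<Phi>"

lemma om_le: "om x \<le> c_Phi \<Phi> ^ CARD('n)" for x :: "real ^ 'n::finite"
proof -
  have "om x \<le> (\<Prod>i\<in>(UNIV::'n set). c_Phi \<Phi>)"
    unfolding omega_def[OF adm] using c_Phi_pos[OF adm] Phi_nonneg[OF adm]
    by (intro prod_mono) (auto simp: mult_left_le)
  then show ?thesis by simp
qed

text \<open>On a bounded cube the weight is bounded below, and by \<open>om_le\<close> also above,
  so local estimates may be made with Lebesgue measure and carried back.\<close>

lemma om_lower_cell:
  obtains w where "0 < w" "\<And>x :: real ^ 'n::finite. x \<in> centered_cell S \<Longrightarrow> w \<le> om x"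
proof (rule that)
  let ?w = "(\<Prod>i\<in>(UNIV::'n set). c_Phi \<Phi> * exp (- \<Phi> \<bar>S\<bar>))"
  show "0 < ?w" using c_Phi_pos[OF adm] by (intro prod_pos) auto
  fix x :: "real ^ 'n" assume "x \<in> centered_cell S"
  then have "\<bar>x $ i\<bar> \<le> \<bar>S\<bar>" for i unfolding mem_centered_cell by (smt (verit))
  then show "?w \<le> om x"
    unfolding omega_def[OF adm] using c_Phi_pos[OF adm] Phi_mono[OF adm]
    by (intro prod_mono) (auto intro!: mult_left_mono)
qed

lemma nn_integral_cell_le_mu:
  fixes f :: "real ^ 'n::finite \<Rightarrow> ennreal"
  assumes [measurable]: "f \<in> borel_measurable borel" and w: "0 < w" "\<And>x. x \<in> A \<Longrightarrow> w \<le> om x"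
  shows "(\<integral>\<^sup>+x. f x * indicator A x \<partial>lborel) \<le> ennreal (1 / w) * (\<integral>\<^sup>+x. f x \<partial>mu_Phi_n \<Phi>)"
proof -
  note [measurable] = omega_borel[OF adm]
  have "(\<integral>\<^sup>+x. f x * indicator A x \<partial>lborel) \<le> (\<integral>\<^sup>+x. ennreal (1 / w) * (ennreal (om x) * f x) \<partial>lborel)"
  proof (intro nn_integral_mono)
    fix x
    show "f x * indicator A x \<le> ennreal (1 / w) * (ennreal (om x) * f x)"
    proof (cases "x \<in> A")
      case True
      then have "1 \<le> 1 / w * om x" using w by (simp add: field_simps)
      then have "ennreal 1 \<le> ennreal (1 / w) * ennreal (om x)"
        using w omega_nonneg[OF adm, of x] by (subst ennreal_mult[symmetric]) (auto intro: ennreal_leI)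
      then have "1 * f x \<le> (ennreal (1 / w) * ennreal (om x)) * f x" by (intro mult_right_mono) auto
      then show ?thesis using True by (simp add: mult.assoc)
    qed simp
  qed
  also have "\<dots> = ennreal (1 / w) * (\<integral>\<^sup>+x. f x \<partial>mu_Phi_n \<Phi>)"
    by (subst nn_integral_mu[OF adm], measurable) (rule nn_integral_cmult, measurable)
  finally show ?thesis .
qed

lemma nn_integral_mu_cell_le:
  fixes f :: "real ^ 'n::finite \<Rightarrow> ennreal"
  assumes [measurable]: "f \<in> borel_measurable borel" "A \<in> sets borel"
  shows "(\<integral>\<^sup>+x. f x * indicator A x \<partial>mu_Phi_n \<Phi>) \<le> ennreal (c_Phi \<Phi> ^ CARD('n)) * (\<integral>\<^sup>+x. f x * indicator A x \<partial>lborel)"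
proof -
  note [measurable] = omega_borel[OF adm]
  have "(\<integral>\<^sup>+x. f x * indicator A x \<partial>mu_Phi_n \<Phi>) = (\<integral>\<^sup>+x. ennreal (om x) * (f x * indicator A x) \<partial>lborel)"
    by (rule nn_integral_mu[OF adm]) measurable
  also have "\<dots> \<le> (\<integral>\<^sup>+x. ennreal (c_Phi \<Phi> ^ CARD('n)) * (f x * indicator A x) \<partial>lborel)"
    by (intro nn_integral_mono mult_right_mono ennreal_leI om_le) auto
  also have "\<dots> = ennreal (c_Phi \<Phi> ^ CARD('n)) * (\<integral>\<^sup>+x. f x * indicator A x \<partial>lborel)"
    by (rule nn_integral_cmult) measurable
  finally show ?thesis .
qed

text \<open>A point outside the cube has some coordinate below \<open>- S\<close> or at least
  \<open>S\<close>. With S > R + h it lies in one of the half-spaces for the \<open>CARD('n)\<close>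
  coordinates and two signs, and the tail estimates are summed.\<close>

lemma tail_total:
  fixes v :: "real ^ 'n::finite \<Rightarrow> real"
  assumes vG: "tgrad v G" and p: "1 \<le> p" and R: "0 < R" and h: "0 \<le> h" and S: "R + h < S"
  shows "(\<integral>\<^sup>+x. ennreal (\<bar>v x\<bar> powr p) * indicator (- centered_cell S) x \<partial>mu_Phi_n \<Phi>) \<le>
    ennreal (2 * CARD('n) * 2 powr p) * (ennreal (exp (- (h * (\<Phi> R / R)))) * (\<integral>\<^sup>+x. ennreal (\<bar>v x\<bar> powr p) \<partial>mu_Phi_n \<Phi>)
       + ennreal (h powr p) * (\<integral>\<^sup>+x. ennreal (G x powr p) \<partial>mu_Phi_n \<Phi>))"
    (is "_ \<le> _ * ?B")
proof -
  note [measurable] = tgrad_borel(1,2)[OF vG] 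
  note [measurable_cong] = sets_mu[OF adm]
  let ?f = "\<lambda>x. ennreal (\<bar>v x\<bar> powr p)"
  let ?I = "\<lambda>i \<sigma>. {x :: real ^ 'n. R + h < \<sigma> * x $ i}"
  have "(\<integral>\<^sup>+x. ?f x * indicator (- centered_cell S) x \<partial>mu_Phi_n \<Phi>) \<le>
     (\<integral>\<^sup>+x. (\<Sum>i\<in>UNIV. \<Sum>\<sigma>\<in>{1,-1}. ?f x * indicator (?I i \<sigma>) x) \<partial>mu_Phi_n \<Phi>)"
  proof (intro nn_integral_mono)
    fix x
    show "?f x * indicator (- centered_cell S) x \<le> (\<Sum>i\<in>UNIV. \<Sum>\<sigma>\<in>{1,-1}. ?f x * indicator (?I i \<sigma>) x)"
    proof (cases "x \<in> centered_cell S")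
      case False
      then obtain i where "\<not> (- S \<le> x $ i \<and> x $ i < S)" unfolding mem_centered_cell by blast
      define \<sigma> :: real where "\<sigma> = (if x $ i \<ge> S then 1 else - 1)"
      have \<sigma>: "\<sigma> \<in> {1, -1}" "x \<in> ?I i \<sigma>"
        using S \<open>\<not> (- S \<le> x $ i \<and> x $ i < S)\<close> by (auto simp: \<sigma>_def)
      have "?f x * indicator (- centered_cell S) x \<le> ?f x * indicator (?I i \<sigma>) x" using \<sigma> by (simp add: indicator_def)
      also have "\<dots> \<le> (\<Sum>\<sigma>\<in>{1,-1}. ?f x * indicator (?I i \<sigma>) x)"
        using \<sigma> by (intro member_le_sum[of \<sigma> _ "\<lambda>\<sigma>. ?f x * indicator (?I i \<sigma>) x"]) auto
      also have "\<dots> \<le> (\<Sum>i\<in>UNIV. \<Sum>\<sigma>\<in>{1,-1}. ?f x * indicator (?I i \<sigma>) x)"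
        by (intro member_le_sum[of i UNIV "\<lambda>i. \<Sum>\<sigma>\<in>{1,-1}. ?f x * indicator (?I i \<sigma>) x"]) auto
      finally show ?thesis .
    qed simp
  qed
  also have "\<dots> = (\<Sum>i\<in>UNIV. \<Sum>\<sigma>\<in>{1,-1}. (\<integral>\<^sup>+x. ?f x * indicator (?I i \<sigma>) x \<partial>mu_Phi_n \<Phi>))"
  proof -
    have "(\<integral>\<^sup>+x. (\<Sum>i\<in>UNIV. \<Sum>\<sigma>\<in>{1,-1}. ?f x * indicator (?I i \<sigma>) x) \<partial>mu_Phi_n \<Phi>) = (\<Sum>i\<in>UNIV. (\<integral>\<^sup>+x. (\<Sum>\<sigma>\<in>{1,-1}. ?f x * indicator (?I i \<sigma>) x) \<partial>mu_Phi_n \<Phi>))"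
      by (rule nn_integral_sum) measurable
    also have "\<dots> = (\<Sum>i\<in>UNIV. \<Sum>\<sigma>\<in>{1,-1}. (\<integral>\<^sup>+x. ?f x * indicator (?I i \<sigma>) x \<partial>mu_Phi_n \<Phi>))"
      by (rule sum.cong[OF refl], rule nn_integral_sum) measurable
    finally show ?thesis .
  qed
  also have "\<dots> \<le> (\<Sum>i\<in>(UNIV::'n set). \<Sum>\<sigma>\<in>{1,-1::real}. ennreal (2 powr p) * ?B)"
    by (intro sum_mono tail_estimate[OF adm vG p R h]) auto
  also have "\<dots> = of_nat (CARD('n)) * (of_nat (card {1,-1::real}) * (ennreal (2 powr p) * ?B))"
    by (simp only: sum_constant)
  also have "\<dots> = (ennreal (CARD('n)) * ennreal 2 * ennreal (2 powr p)) * ?B"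
    by (simp only: mult.assoc ennreal_of_nat_eq_real_of_nat) simp
  also have "ennreal (CARD('n)) * ennreal 2 * ennreal (2 powr p) = ennreal (2 * CARD('n) * 2 powr p)"
    by (subst ennreal_mult[symmetric], simp, simp, subst ennreal_mult[symmetric], simp, simp, simp add: mult_ac)
  finally show ?thesis .
qed

lemma nn_integral_split_cell:
  fixes f :: "real ^ 'n::finite \<Rightarrow> ennreal"
  assumes [measurable]: "f \<in> borel_measurable borel"
  shows "(\<integral>\<^sup>+x. f x \<partial>mu_Phi_n \<Phi>) = (\<integral>\<^sup>+x. f x * indicator (centered_cell S) x \<partial>mu_Phi_n \<Phi>) + (\<integral>\<^sup>+x. f x * indicator (- centered_cell S) x \<partial>mu_Phi_n \<Phi>)"
proof -
  note [measurable_cong] = sets_mu[OF adm]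
  have "(\<integral>\<^sup>+x. f x \<partial>mu_Phi_n \<Phi>) = (\<integral>\<^sup>+x. f x * indicator (centered_cell S) x + f x * indicator (- centered_cell S) x \<partial>mu_Phi_n \<Phi>)"
    by (intro nn_integral_cong) (auto simp: indicator_def)
  also have "\<dots> = (\<integral>\<^sup>+x. f x * indicator (centered_cell S) x \<partial>mu_Phi_n \<Phi>) + (\<integral>\<^sup>+x. f x * indicator (- centered_cell S) x \<partial>mu_Phi_n \<Phi>)"
    by (rule nn_integral_add) measurable
  finally show ?thesis .
qed

text \<open>The tail estimate is applied to truncations of \<open>v\<close>, whose \<open>p\<close>-th moments are finite beforehand, so
  that half of that moment can be absorbed into the left-hand side.\<close>

lemma Poincare_boost:
  fixes p K :: real
  assumes p: "1 \<le> p" and K: "0 \<le> K"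
  obtains K' where "0 \<le> K'" and
    "\<And>(v :: real ^ 'n::finite \<Rightarrow> real) G. tgrad v G \<Longrightarrow> (\<integral>\<^sup>+x. ennreal \<bar>v x\<bar> \<partial>mu_Phi_n \<Phi>) \<le> ennreal K \<Longrightarrow>
       (\<integral>\<^sup>+x. ennreal (G x powr p) \<partial>mu_Phi_n \<Phi>) \<le> ennreal K \<Longrightarrow> (\<integral>\<^sup>+x. ennreal (\<bar>v x\<bar> powr p) \<partial>mu_Phi_n \<Phi>) \<le> ennreal K'"
proof -
  note [measurable_cong] = sets_mu[OF adm]
  let ?n = "CARD('n)"
  define B where "B = 2 * ?n * 2 powr p"
  have B1: "B \<ge> 1" 
  proof -
    have "2 * ?n * 2 powr p \<ge> (1::real) * 1"
    proof (intro mult_mono)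
      have "1 \<le> CARD('n)" by (simp add: Suc_leI)
      then show "(1::real) \<le> 2 * ?n" by linarith
    qed (use p in \<open>auto simp: ge_one_powr_ge_zero\<close>)
    then show ?thesis by (simp add: B_def)
  qed
  \<comment> \<open>The translation length for R = 1 at which the coefficient of the total moment
    becomes exactly 1/2.\<close>
  define h where "h = ln (2 * B) / \<Phi> 1"
  have h: "h \<ge> 0" unfolding h_def using B1 Phi_pos[OF adm, of 1] by (intro divide_nonneg_pos) auto
  have Bh: "B * exp (- (h * (\<Phi> 1 / 1))) = 1 / 2"
    using B1 Phi_pos[OF adm, of 1] by (simp add: h_def exp_minus field_simps)
  define S where "S = 1 + h + 1"
  have S: "1 + h < S" "0 < 2 * S" using h by (auto simp: S_def)
  obtain w where w: "0 < w" "\<And>x :: real ^ 'n. x \<in> centered_cell S \<Longrightarrow> w \<le> om x" using om_lower_cell by blast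
  define c where "c = c_Phi \<Phi> ^ ?n"
  have c: "c \<ge> 0" using c_Phi_pos[OF adm] by (simp add: c_def)
  define A where "A = (K / w) / (2 * S) ^ ?n"
  define L where "L = c * (2 powr p * ((2 * S) ^ ?n * A powr p + 2 ^ ?n * (?n * (2 * S)) powr p * (K / w)))"
  \<comment> \<open>\<open>L\<close> bounds the part inside the cube; the factor 2 pays for moving
    half of the moment to the left.\<close>
  define K' where "K' = 2 * (L + B * h powr p * K)"
  have L: "L \<ge> 0" unfolding L_def using c S K w by simp
  have K': "0 \<le> K'" using L K B1 by (simp add: K'_def)
  show thesis
  proof (rule that[OF K'])
    fix v :: "real ^ 'n \<Rightarrow> real" and G assume vG: "tgrad v G"
      and vK: "(\<integral>\<^sup>+x. ennreal \<bar>v x\<bar> \<partial>mu_Phi_n \<Phi>) \<le> ennreal K" and GK: "(\<integral>\<^sup>+x. ennreal (G x powr p) \<partial>mu_Phi_n \<Phi>) \<le> ennreal K"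
    note [measurable] = tgrad_borel(1,2)[OF vG]
    have cellv: "(\<integral>\<^sup>+x. ennreal \<bar>v x\<bar> * indicator (centered_cell S) x \<partial>lborel) \<le> ennreal (K / w)"
    proof -
      have "(\<integral>\<^sup>+x. ennreal \<bar>v x\<bar> * indicator (centered_cell S) x \<partial>lborel) \<le> ennreal (1 / w) * ennreal K"
        by (rule order_trans[OF nn_integral_cell_le_mu[OF _ w]]) (auto intro!: mult_left_mono vK)
      then show ?thesis using K w by (simp add: ennreal_mult[symmetric])
    qed
    have cellG: "(\<integral>\<^sup>+x. ennreal (G x powr p) * indicator (centered_cell S) x \<partial>lborel) \<le> ennreal (K / w)"
    proof -
      have "(\<integral>\<^sup>+x. ennreal (G x powr p) * indicator (centered_cell S) x \<partial>lborel) \<le> ennreal (1 / w) * ennreal K"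
        by (rule order_trans[OF nn_integral_cell_le_mu[OF _ w]]) (auto intro!: mult_left_mono GK)
      then show ?thesis using K w by (simp add: ennreal_mult[symmetric])
    qed
    have vi: "set_integrable lborel (centered_cell S) v"
      using cellv by (intro set_integrable_cellI) (auto simp: le_less_trans)
    \<comment> \<open>The first moment bounds the mean of \<open>v\<close> over the cube; the
      oscillation around that mean is then a matter of the gradient.\<close>
    have avg: "\<bar>cell_avg (\<chi> i. - S) (2 * S) v\<bar> \<le> A"
      unfolding A_def using K w by (intro cell_avg_le cellv S) auto
    have cell: "(\<integral>\<^sup>+x. ennreal (\<bar>v x\<bar> powr p) * indicator (centered_cell S) x \<partial>mu_Phi_n \<Phi>) \<le> ennreal L"
    proof -
      have "(\<integral>\<^sup>+x. ennreal (\<bar>v x\<bar> powr p) * indicator (centered_cell S) x \<partial>mu_Phi_n \<Phi>) \<le> ennreal c * (\<integral>\<^sup>+x. ennreal (\<bar>v x\<bar> powr p) * indicator (centered_cell S) x \<partial>lborel)"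
        unfolding c_def by (rule nn_integral_mu_cell_le) measurable
      also have "\<dots> \<le> ennreal c * (ennreal (2 powr p) * (ennreal ((2 * S) ^ ?n * \<bar>cell_avg (\<chi> i. - S) (2 * S) v\<bar> powr p) +
           ennreal (2 ^ ?n * (?n * (2 * S)) powr p) * (\<integral>\<^sup>+x. ennreal (G x powr p) * indicator (centered_cell S) x \<partial>lborel)))"
        by (intro mult_left_mono cell_Poincare[OF vG p S(2) vi]) auto
      also have "\<dots> \<le> ennreal c * (ennreal (2 powr p) * (ennreal ((2 * S) ^ ?n * A powr p) + ennreal (2 ^ ?n * (?n * (2 * S)) powr p) * ennreal (K / w)))"
        using S p by (intro mult_left_mono add_mono cellG ennreal_leI powr_mono2 avg) auto
      also have "\<dots> = ennreal L"
        unfolding L_def using c S K w by (simp flip: ennreal_plus ennreal_mult)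
      finally show ?thesis .
    qed
    define v' where "v' N x = max (min (v x) (real N)) (- real N)" for N x
    have v'G: "tgrad (v' N) G" for N
      unfolding v'_def by (rule tgrad_contract[OF vG, of "\<lambda>t. max (min t (real N)) (- real N)"]) (auto simp: max_def min_def)
    note [measurable] = tgrad_borel(1)[OF v'G]
    have v'v: "\<bar>v' N x\<bar> \<le> \<bar>v x\<bar>" for N x by (auto simp: v'_def max_def min_def)
    have bound: "(\<integral>\<^sup>+x. ennreal (\<bar>v' N x\<bar> powr p) \<partial>mu_Phi_n \<Phi>) \<le> ennreal K'" for N
    proof -
      have "(\<integral>\<^sup>+x. ennreal (\<bar>v' N x\<bar> powr p) \<partial>mu_Phi_n \<Phi>) \<le> (\<integral>\<^sup>+x. ennreal (real N powr p) \<partial>(mu_Phi_n \<Phi> :: (real ^ 'n) measure))"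
        using p by (intro nn_integral_mono ennreal_leI powr_mono2) (auto simp: v'_def max_def min_def)
      also have "\<dots> < \<infinity>" using emeasure_mu[OF adm, where 'n='n] by (simp add: space_mu[OF adm])
      finally obtain X where X: "(\<integral>\<^sup>+x. ennreal (\<bar>v' N x\<bar> powr p) \<partial>mu_Phi_n \<Phi>) = ennreal X" "X \<ge> 0"
        by (cases "(\<integral>\<^sup>+x. ennreal (\<bar>v' N x\<bar> powr p) \<partial>mu_Phi_n \<Phi>)") auto
      have "ennreal X = (\<integral>\<^sup>+x. ennreal (\<bar>v' N x\<bar> powr p) * indicator (centered_cell S) x \<partial>mu_Phi_n \<Phi>) + (\<integral>\<^sup>+x. ennreal (\<bar>v' N x\<bar> powr p) * indicator (- centered_cell S) x \<partial>mu_Phi_n \<Phi>)"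
        unfolding X(1)[symmetric] by (rule nn_integral_split_cell) measurable
      also have "\<dots> \<le> ennreal L + ennreal B * (ennreal (exp (- (h * (\<Phi> 1 / 1)))) * ennreal X + ennreal (h powr p) * ennreal K)"
      proof (rule add_mono)
        have "(\<integral>\<^sup>+x. ennreal (\<bar>v' N x\<bar> powr p) * indicator (centered_cell S) x \<partial>mu_Phi_n \<Phi>) \<le> (\<integral>\<^sup>+x. ennreal (\<bar>v x\<bar> powr p) * indicator (centered_cell S) x \<partial>mu_Phi_n \<Phi>)"
          using p by (intro nn_integral_mono mult_right_mono ennreal_leI powr_mono2 v'v) auto
        also note cell
        finally show "(\<integral>\<^sup>+x. ennreal (\<bar>v' N x\<bar> powr p) * indicator (centered_cell S) x \<partial>mu_Phi_n \<Phi>) \<le> ennreal L" .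
        have "(\<integral>\<^sup>+x. ennreal (\<bar>v' N x\<bar> powr p) * indicator (- centered_cell S) x \<partial>mu_Phi_n \<Phi>) \<le> ennreal B * (ennreal (exp (- (h * (\<Phi> 1 / 1)))) * (\<integral>\<^sup>+x. ennreal (\<bar>v' N x\<bar> powr p) \<partial>mu_Phi_n \<Phi>)
           + ennreal (h powr p) * (\<integral>\<^sup>+x. ennreal (G x powr p) \<partial>mu_Phi_n \<Phi>))"
          unfolding B_def by (rule tail_total[OF v'G p _ h S(1)]) simp
        also have "\<dots> \<le> ennreal B * (ennreal (exp (- (h * (\<Phi> 1 / 1)))) * ennreal X + ennreal (h powr p) * ennreal K)"
          unfolding X(1) by (intro mult_left_mono add_mono GK) auto
        finally show "(\<integral>\<^sup>+x. ennreal (\<bar>v' N x\<bar> powr p) * indicator (- centered_cell S) x \<partial>mu_Phi_n \<Phi>) \<le> ennreal B * (ennreal (exp (- (h * (\<Phi> 1 / 1)))) * ennreal X + ennreal (h powr p) * ennreal K)" .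
      qed
      also have "\<dots> = ennreal (L + B * (exp (- (h * (\<Phi> 1 / 1))) * X + h powr p * K))"
        using L B1 X(2) K by (simp flip: ennreal_plus ennreal_mult)
      finally have "X \<le> L + B * (exp (- (h * (\<Phi> 1 / 1))) * X + h powr p * K)"
        using L B1 X(2) K by (subst (asm) ennreal_le_iff) auto
      then have "X \<le> L + (B * exp (- (h * (\<Phi> 1 / 1)))) * X + B * h powr p * K" by (simp add: algebra_simps)
      then have "X \<le> K'" unfolding Bh K'_def by simp
      then show ?thesis unfolding X(1) by (rule ennreal_leI)
    qed
    \<comment> \<open>The bound does not depend on the truncation level, and at each point the
      truncations are eventually equal to \<open>v\<close>; Fatou's lemma removes the
      truncation.\<close>
    have "(\<integral>\<^sup>+x. ennreal (\<bar>v x\<bar> powr p) \<partial>mu_Phi_n \<Phi>) = (\<integral>\<^sup>+x. liminf (\<lambda>N. ennreal (\<bar>v' N x\<bar> powr p)) \<partial>mu_Phi_n \<Phi>)"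
    proof (intro nn_integral_cong)
      fix x
      have "eventually (\<lambda>N. v' N x = v x) sequentially"
      proof -
        obtain N0 where "real N0 \<ge> \<bar>v x\<bar>" using real_arch_simple by blast
        then have "v' N x = v x" if "N \<ge> N0" for N
        proof -
          have "real N \<ge> \<bar>v x\<bar>" using that \<open>real N0 \<ge> \<bar>v x\<bar>\<close> by linarith
          then show ?thesis by (auto simp: v'_def max_def min_def)
        qed
        then show ?thesis by (auto simp: eventually_sequentially)
      qed
      then have "(\<lambda>N. ennreal (\<bar>v' N x\<bar> powr p)) \<longlonglongrightarrow> ennreal (\<bar>v x\<bar> powr p)"
        by (intro tendsto_eventually) (auto elim: eventually_mono)
      then show "ennreal (\<bar>v x\<bar> powr p) = liminf (\<lambda>N. ennreal (\<bar>v' N x\<bar> powr p))"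
        by (intro lim_imp_Liminf[symmetric]) auto
    qed
    also have "\<dots> \<le> liminf (\<lambda>N. \<integral>\<^sup>+x. ennreal (\<bar>v' N x\<bar> powr p) \<partial>mu_Phi_n \<Phi>)"
      by (rule nn_integral_liminf) measurable
    also have "\<dots> \<le> ennreal K'"
      by (rule Liminf_le) (auto simp: bound)
    finally show "(\<integral>\<^sup>+x. ennreal (\<bar>v x\<bar> powr p) \<partial>mu_Phi_n \<Phi>) \<le> ennreal K'" .
  qed
qed

end

section \<open>Dyadic decomposition of cubes\<close>

definition dyadic_cell :: "nat \<Rightarrow> ('n::finite \<Rightarrow> int) \<Rightarrow> (real ^ 'n) set" where
  "dyadic_cell k a = cell (\<chi> i. real_of_int (a i) / 2 ^ k) (1 / 2 ^ k)"

lemma dyadic_cell_borel [measurable]: "dyadic_cell k a \<in> sets borel"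
  by (simp add: dyadic_cell_def cell_borel)

text \<open>Half-open cells of one generation are the fibres of a coordinatewise floor function, so
  each point belongs to exactly one of them.\<close>

lemma mem_dyadic_cell: "x \<in> dyadic_cell k a \<longleftrightarrow> a = (\<lambda>i. \<lfloor>2 ^ k * x $ i\<rfloor>)"
proof -
  have "x \<in> dyadic_cell k a \<longleftrightarrow> (\<forall>i. real_of_int (a i) \<le> 2 ^ k * x $ i \<and> 2 ^ k * x $ i < real_of_int (a i) + 1)"
    by (simp add: dyadic_cell_def cell_def field_simps)
  also have "\<dots> \<longleftrightarrow> (\<forall>i. a i = \<lfloor>2 ^ k * x $ i\<rfloor>)"
    by (auto simp: floor_unique[symmetric] intro: floor_unique[symmetric]) 
  finally show ?thesis by auto
qed

definition dyadic_index :: "nat \<Rightarrow> nat \<Rightarrow> ('n::finite \<Rightarrow> int) set" where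
  "dyadic_index k S = {a. \<forall>i. - int (S * 2 ^ k) \<le> a i \<and> a i < int (S * 2 ^ k)}"

lemma finite_dyadic_index: "finite (dyadic_index k S)"
proof -
  have "dyadic_index k S \<subseteq> PiE UNIV (\<lambda>_. {- int (S * 2 ^ k)..<int (S * 2 ^ k)})"
    by (auto simp: dyadic_index_def PiE_def)
  then show ?thesis by (rule finite_subset) (intro finite_PiE; simp)
qed

text \<open>The big cube has integer bounds and is half-open like the small ones, so the tiling is
  exact at every point and needs no null sets.\<close>

lemma sum_dyadic_indicator:
  fixes x :: "real ^ 'n::finite"
  shows "(\<Sum>a\<in>dyadic_index k S. indicator (dyadic_cell k a) x :: ennreal) = indicator (centered_cell (real S)) x"
proof -
  define b where "b = (\<lambda>i. \<lfloor>2 ^ k * x $ i\<rfloor>)"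
  have "(\<Sum>a\<in>dyadic_index k S. indicator (dyadic_cell k a) x :: ennreal) = (\<Sum>a\<in>dyadic_index k S. if b = a then 1 else 0)"
    by (intro sum.cong refl) (auto simp: indicator_def mem_dyadic_cell b_def)
  also have "\<dots> = (if b \<in> dyadic_index k S then 1 else 0)"
    by (simp add: sum.delta finite_dyadic_index)
  also have "b \<in> dyadic_index k S \<longleftrightarrow> x \<in> centered_cell (real S)"
  proof -
    have "- int (S * 2 ^ k) \<le> \<lfloor>2 ^ k * t\<rfloor> \<longleftrightarrow> - real S \<le> t" for t :: real
    proof -
      have "- int (S * 2 ^ k) \<le> \<lfloor>2 ^ k * t\<rfloor> \<longleftrightarrow> (- real S) * 2 ^ k \<le> t * 2 ^ k" by (simp add: le_floor_iff mult.commute)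
      also have "\<dots> \<longleftrightarrow> - real S \<le> t" by (rule mult_le_cancel_right_pos) simp
      finally show ?thesis .
    qed
    moreover have "\<lfloor>2 ^ k * t\<rfloor> < int (S * 2 ^ k) \<longleftrightarrow> t < real S" for t :: real
    proof -
      have "\<lfloor>2 ^ k * t\<rfloor> < int (S * 2 ^ k) \<longleftrightarrow> t * 2 ^ k < real S * 2 ^ k" by (simp add: floor_less_iff mult.commute)
      also have "\<dots> \<longleftrightarrow> t < real S" by (rule mult_less_cancel_right_pos) simp
      finally show ?thesis .
    qed
    ultimately show ?thesis unfolding mem_centered_cell dyadic_index_def b_def by simp
  qed
  finally show ?thesis by (simp add: indicator_def)
qed

lemma nn_integral_dyadic_sum:
  fixes f :: "real ^ 'n::finite \<Rightarrow> ennreal"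
  assumes [measurable]: "f \<in> borel_measurable borel"
  shows "(\<Sum>a\<in>dyadic_index k S. (\<integral>\<^sup>+x. f x * indicator (dyadic_cell k a) x \<partial>lborel)) = (\<integral>\<^sup>+x. f x * indicator (centered_cell (real S)) x \<partial>lborel)"
proof -
  have "(\<Sum>a\<in>dyadic_index k S. (\<integral>\<^sup>+x. f x * indicator (dyadic_cell k a) x \<partial>lborel)) = (\<integral>\<^sup>+x. (\<Sum>a\<in>dyadic_index k S. f x * indicator (dyadic_cell k a) x) \<partial>lborel)"
    by (rule nn_integral_sum[symmetric]) measurable
  also have "\<dots> = (\<integral>\<^sup>+x. f x * indicator (centered_cell (real S)) x \<partial>lborel)"
    by (simp add: sum_distrib_left[symmetric] sum_dyadic_indicator)
  finally show ?thesis .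
qed

text \<open>The gradient term carries a power of the mesh \<open>1 / 2 ^ k\<close> and vanishes as
  \<open>k\<close> grows, while for fixed \<open>k\<close> only finitely many averages occur. The
  volume of a cell, at most 1, is dropped in front of the averages.\<close>

lemma dyadic_Poincare:
  fixes v :: "real ^ 'n::finite \<Rightarrow> real"
  assumes vG: "tgrad v G" and p: "1 \<le> p" and vi: "\<And>a. set_integrable lborel (dyadic_cell k a) v"
  shows "(\<integral>\<^sup>+x. ennreal (\<bar>v x\<bar> powr p) * indicator (centered_cell (real S)) x \<partial>lborel) \<le>
     ennreal (2 powr p) * ((\<Sum>a\<in>dyadic_index k S. ennreal (\<bar>cell_avg (\<chi> i. real_of_int (a i) / 2 ^ k) (1 / 2 ^ k) v\<bar> powr p))
       + ennreal (2 ^ CARD('n) * (CARD('n) / 2 ^ k) powr p) * (\<integral>\<^sup>+x. ennreal (G x powr p) * indicator (centered_cell (real S)) x \<partial>lborel))"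
proof -
  note [measurable] = tgrad_borel(1,2)[OF vG]
  let ?A = "\<lambda>a. cell_avg (\<chi> i. real_of_int (a i) / 2 ^ k) (1 / 2 ^ k) v"
  have "(\<integral>\<^sup>+x. ennreal (\<bar>v x\<bar> powr p) * indicator (centered_cell (real S)) x \<partial>lborel) = (\<Sum>a\<in>dyadic_index k S. (\<integral>\<^sup>+x. ennreal (\<bar>v x\<bar> powr p) * indicator (dyadic_cell k a) x \<partial>lborel))"
    by (rule nn_integral_dyadic_sum[symmetric]) measurable
  also have "\<dots> \<le> (\<Sum>a\<in>dyadic_index k S. ennreal (2 powr p) * (ennreal (\<bar>?A a\<bar> powr p) + ennreal (2 ^ CARD('n) * (CARD('n) / 2 ^ k) powr p) * (\<integral>\<^sup>+x. ennreal (G x powr p) * indicator (dyadic_cell k a) x \<partial>lborel)))"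
  proof (rule sum_mono)
    fix a :: "'n \<Rightarrow> int"
    have "(\<integral>\<^sup>+x. ennreal (\<bar>v x\<bar> powr p) * indicator (dyadic_cell k a) x \<partial>lborel) \<le>
       ennreal (2 powr p) * (ennreal ((1 / 2 ^ k) ^ CARD('n) * \<bar>?A a\<bar> powr p) + ennreal (2 ^ CARD('n) * (CARD('n) * (1 / 2 ^ k)) powr p) * (\<integral>\<^sup>+x. ennreal (G x powr p) * indicator (dyadic_cell k a) x \<partial>lborel))"
      unfolding dyadic_cell_def by (rule cell_Poincare[OF vG p]) (use vi[of a] in \<open>auto simp: dyadic_cell_def\<close>)
    also have "\<dots> \<le> ennreal (2 powr p) * (ennreal (\<bar>?A a\<bar> powr p) + ennreal (2 ^ CARD('n) * (CARD('n) / 2 ^ k) powr p) * (\<integral>\<^sup>+x. ennreal (G x powr p) * indicator (dyadic_cell k a) x \<partial>lborel))"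
      by (intro mult_left_mono add_mono ennreal_leI mult_left_le_one_le power_le_one) auto
    finally show "(\<integral>\<^sup>+x. ennreal (\<bar>v x\<bar> powr p) * indicator (dyadic_cell k a) x \<partial>lborel) \<le> ennreal (2 powr p) * (ennreal (\<bar>?A a\<bar> powr p) + ennreal (2 ^ CARD('n) * (CARD('n) / 2 ^ k) powr p) * (\<integral>\<^sup>+x. ennreal (G x powr p) * indicator (dyadic_cell k a) x \<partial>lborel))" .
  qed
  also have "\<dots> = ennreal (2 powr p) * ((\<Sum>a\<in>dyadic_index k S. ennreal (\<bar>?A a\<bar> powr p)) + ennreal (2 ^ CARD('n) * (CARD('n) / 2 ^ k) powr p) * (\<Sum>a\<in>dyadic_index k S. (\<integral>\<^sup>+x. ennreal (G x powr p) * indicator (dyadic_cell k a) x \<partial>lborel)))"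
    by (simp only: sum_distrib_left sum.distrib distrib_left)
  also have "(\<Sum>a\<in>dyadic_index k S. (\<integral>\<^sup>+x. ennreal (G x powr p) * indicator (dyadic_cell k a) x \<partial>lborel)) = (\<integral>\<^sup>+x. ennreal (G x powr p) * indicator (centered_cell (real S)) x \<partial>lborel)"
    by (rule nn_integral_dyadic_sum) measurable
  finally show ?thesis .
qed

lemma dyadic_cell_subset:
  fixes a :: "'n::finite \<Rightarrow> int"
  obtains S :: nat where "dyadic_cell k a \<subseteq> centered_cell (real S)"
proof
  define S where "S = (\<Sum>i\<in>UNIV. nat \<bar>a i\<bar>) + 1"
  show "dyadic_cell k a \<subseteq> centered_cell (real S)"
  proof
    fix x assume x: "x \<in> dyadic_cell k a"
    show "x \<in> centered_cell (real S)" unfolding mem_centered_cell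
    proof
      fix i
      have "nat \<bar>a i\<bar> \<le> (\<Sum>i\<in>UNIV. nat \<bar>a i\<bar>)" by (intro member_le_sum) auto
      then have "nat \<bar>a i\<bar> + 1 \<le> S" by (simp add: S_def)
      then have "\<bar>a i\<bar> + 1 \<le> int S" by linarith
      then have S: "\<bar>real_of_int (a i)\<bar> + 1 \<le> real S" by linarith
      have x': "real_of_int (a i) / 2 ^ k \<le> x $ i" "x $ i < real_of_int (a i) / 2 ^ k + 1 / 2 ^ k"
        using x by (auto simp: dyadic_cell_def cell_def)
      have "\<bar>real_of_int (a i) / 2 ^ k\<bar> \<le> \<bar>real_of_int (a i)\<bar>" by (simp add: divide_le_eq mult_le_cancel_left1)
      moreover have "(1::real) / 2 ^ k \<le> 1" by simp
      ultimately show "- real S \<le> x $ i \<and> x $ i < real S" using x' S by linarith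
    qed
  qed
qed

lemma nn_integral_powr_add_le:
  assumes [measurable]: "f \<in> borel_measurable M" "g \<in> borel_measurable M" and p: "0 \<le> p"
    and h: "\<And>x. \<bar>h x\<bar> \<le> \<bar>f x\<bar> + \<bar>g x\<bar>" and A[measurable]: "A \<in> sets M"
  shows "(\<integral>\<^sup>+x. ennreal (\<bar>h x\<bar> powr p) * indicator A x \<partial>M) \<le> ennreal (2 powr p) * ((\<integral>\<^sup>+x. ennreal (\<bar>f x\<bar> powr p) * indicator A x \<partial>M) + (\<integral>\<^sup>+x. ennreal (\<bar>g x\<bar> powr p) * indicator A x \<partial>M))"
proof -
  have "(\<integral>\<^sup>+x. ennreal (\<bar>h x\<bar> powr p) * indicator A x \<partial>M) \<le> (\<integral>\<^sup>+x. ennreal (2 powr p) * (ennreal (\<bar>f x\<bar> powr p) * indicator A x + ennreal (\<bar>g x\<bar> powr p) * indicator A x) \<partial>M)"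
  proof (intro nn_integral_mono)
    fix x
    have "\<bar>h x\<bar> powr p \<le> (\<bar>f x\<bar> + \<bar>g x\<bar>) powr p" using h p by (intro powr_mono2) auto
    also have "\<dots> \<le> 2 powr p * (\<bar>f x\<bar> powr p + \<bar>g x\<bar> powr p)" using p by (intro powr_add_le) auto
    finally have "ennreal (\<bar>h x\<bar> powr p) \<le> ennreal (2 powr p) * (ennreal (\<bar>f x\<bar> powr p) + ennreal (\<bar>g x\<bar> powr p))"
      by (subst ennreal_plus[symmetric], simp, simp, subst ennreal_mult[symmetric]) (auto intro: ennreal_leI)
    then show "ennreal (\<bar>h x\<bar> powr p) * indicator A x \<le> ennreal (2 powr p) * (ennreal (\<bar>f x\<bar> powr p) * indicator A x + ennreal (\<bar>g x\<bar> powr p) * indicator A x)"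
      by (cases "x \<in> A") auto
  qed
  also have "\<dots> = ennreal (2 powr p) * ((\<integral>\<^sup>+x. ennreal (\<bar>f x\<bar> powr p) * indicator A x \<partial>M) + (\<integral>\<^sup>+x. ennreal (\<bar>g x\<bar> powr p) * indicator A x \<partial>M))"
    by (simp add: nn_integral_cmult nn_integral_add)
  finally show ?thesis .
qed

section \<open>Extraction of a Cauchy subsequence\<close>

context
  fixes \<Phi> :: "real \<Rightarrow> real"
  assumes adm: "admissible_Phi \<Phi>"
begin

lemma Lp_cell_bound:
  fixes v :: "real ^ 'n::finite \<Rightarrow> real"
  assumes [measurable]: "v \<in> borel_measurable borel" and p: "1 \<le> p" and K: "0 \<le> K" "(\<integral>\<^sup>+x. ennreal (\<bar>v x\<bar> powr p) \<partial>mu_Phi_n \<Phi>) \<le> ennreal K"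
    and w: "0 < w" "\<And>x. x \<in> A \<Longrightarrow> w \<le> omega \<Phi> x"
  shows "(\<integral>\<^sup>+x. ennreal \<bar>v x\<bar> * indicator A x \<partial>lborel) \<le> ennreal ((1 + K) / w)"
proof -
  note [measurable_cong] = sets_mu[OF adm]
  have "(\<integral>\<^sup>+x. ennreal \<bar>v x\<bar> * indicator A x \<partial>lborel) \<le> ennreal (1 / w) * (\<integral>\<^sup>+x. ennreal \<bar>v x\<bar> \<partial>mu_Phi_n \<Phi>)"
    by (rule nn_integral_cell_le_mu[OF adm _ w]) measurable
  also have "\<dots> \<le> ennreal (1 / w) * (\<integral>\<^sup>+x. 1 + ennreal (\<bar>v x\<bar> powr p) \<partial>mu_Phi_n \<Phi>)"
  proof (intro mult_left_mono nn_integral_mono)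
    fix x
    have "\<bar>v x\<bar> \<le> 1 + \<bar>v x\<bar> powr p"
    proof (cases "\<bar>v x\<bar> \<ge> 1")
      case True
      then have "\<bar>v x\<bar> powr 1 \<le> \<bar>v x\<bar> powr p" using p by (intro powr_mono) auto
      then show ?thesis using True by simp
    next
      case False
      then show ?thesis by (smt (verit) powr_ge_zero)
    qed
    then have "ennreal \<bar>v x\<bar> \<le> ennreal (1 + \<bar>v x\<bar> powr p)" by (rule ennreal_leI)
    then show "ennreal \<bar>v x\<bar> \<le> 1 + ennreal (\<bar>v x\<bar> powr p)" by simp
  qed simp
  also have "(\<integral>\<^sup>+x. 1 + ennreal (\<bar>v x\<bar> powr p) \<partial>mu_Phi_n \<Phi>) = 1 + (\<integral>\<^sup>+x. ennreal (\<bar>v x\<bar> powr p) \<partial>mu_Phi_n \<Phi>)"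
    using emeasure_mu[OF adm, where 'n='n] by (subst nn_integral_add) (auto simp: space_mu[OF adm])
  also have "ennreal (1 / w) * (1 + (\<integral>\<^sup>+x. ennreal (\<bar>v x\<bar> powr p) \<partial>mu_Phi_n \<Phi>)) \<le> ennreal (1 / w) * (1 + ennreal K)"
    by (intro mult_left_mono add_left_mono K) simp
  also have "\<dots> = ennreal ((1 + K) / w)"
    using K w by (simp flip: ennreal_1 ennreal_plus ennreal_mult)
  finally show ?thesis .
qed

text \<open>The subsequence is chosen once for all generations of dyadic cells. For given
  \<open>e\<close> the choices are nested: the cube by the tails, then the mesh by the gradient
  bound on that cube, then the index by the finitely many averages on that mesh. The Poincare
  inequality applies because a difference of two members again has an increment bound.\<close>

lemma Cauchy_subsequence:
  fixes u G :: "nat \<Rightarrow> real ^ 'n::finite \<Rightarrow> real" and p K :: real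
  assumes p: "1 \<le> p" and K: "0 \<le> K"
    and uG: "\<And>j. tgrad (u j) (G j)"
    and uK: "\<And>j. (\<integral>\<^sup>+x. ennreal (\<bar>u j x\<bar> powr p) \<partial>mu_Phi_n \<Phi>) \<le> ennreal K"
    and GK: "\<And>j. (\<integral>\<^sup>+x. ennreal (G j x powr p) \<partial>mu_Phi_n \<Phi>) \<le> ennreal K"
    and tail: "\<And>e. 0 < e \<Longrightarrow> \<exists>S::nat. \<forall>j. (\<integral>\<^sup>+x. ennreal (\<bar>u j x\<bar> powr p) * indicator (- centered_cell (real S)) x \<partial>mu_Phi_n \<Phi>) \<le> ennreal e"
  obtains r where "strict_mono (r :: nat \<Rightarrow> nat)"
    "\<And>e. 0 < e \<Longrightarrow> \<exists>N. \<forall>i\<ge>N. \<forall>j\<ge>N. (\<integral>\<^sup>+x. ennreal (\<bar>u (r i) x - u (r j) x\<bar> powr p) \<partial>mu_Phi_n \<Phi>) \<le> ennreal e"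
proof -
  note [measurable_cong] = sets_mu[OF adm]
  note [measurable] = tgrad_borel(1,2)[OF uG]
  let ?n = "CARD('n)"
  define A where "A k a v = cell_avg (\<chi> i::'n. real_of_int (a i) / 2 ^ k) (1 / 2 ^ k) v" for k a v
  have bnd: "\<exists>M. \<forall>j. (\<integral>\<^sup>+x. ennreal \<bar>u j x\<bar> * indicator (dyadic_cell k a) x \<partial>lborel) \<le> ennreal M \<and> 0 \<le> M" for k and a :: "'n \<Rightarrow> int"
  proof -
    obtain S where S: "dyadic_cell k a \<subseteq> centered_cell (real S)" by (rule dyadic_cell_subset)
    obtain w where w: "0 < w" "\<And>x :: real ^ 'n. x \<in> centered_cell (real S) \<Longrightarrow> w \<le> omega \<Phi> x" using om_lower_cell[OF adm] by blast
    have "(\<integral>\<^sup>+x. ennreal \<bar>u j x\<bar> * indicator (dyadic_cell k a) x \<partial>lborel) \<le> ennreal ((1 + K) / w)" for j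
      by (rule Lp_cell_bound[OF _ p K uK w(1)]) (use S w in auto)
    then show ?thesis using K w by (intro exI[of _ "(1 + K) / w"]) auto
  qed
  have ui: "set_integrable lborel (dyadic_cell k a) (u j)" for k a j
  proof -
    obtain M where "(\<integral>\<^sup>+x. ennreal \<bar>u j x\<bar> * indicator (dyadic_cell k a) x \<partial>lborel) \<le> ennreal M" using bnd by blast
    then show ?thesis by (intro set_integrable_cellI) (auto simp: le_less_trans)
  qed
  have Ab: "\<exists>M. \<forall>j. \<bar>A k a (u j)\<bar> \<le> M" for k a
  proof -
    obtain M where M: "\<And>j. (\<integral>\<^sup>+x. ennreal \<bar>u j x\<bar> * indicator (dyadic_cell k a) x \<partial>lborel) \<le> ennreal M" "0 \<le> M" using bnd by blast
    have "\<bar>A k a (u j)\<bar> \<le> M / (1 / 2 ^ k) ^ ?n" for j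
      unfolding A_def by (rule cell_avg_le) (use M in \<open>auto simp: dyadic_cell_def\<close>)
    then show ?thesis by blast
  qed
  define F where "F j ka = (case ka of (k, a) \<Rightarrow> A k a (u j))" for j and ka :: "nat \<times> ('n \<Rightarrow> int)"
  have "\<exists>M. \<forall>j. \<bar>F j ka\<bar> \<le> M" for ka using Ab unfolding F_def by (cases ka) auto
  then obtain M where M: "\<And>j ka. \<bar>F j ka\<bar> \<le> M ka" by metis
  obtain r where r: "strict_mono r" "\<And>ka. convergent (\<lambda>j. F (r j) ka)"
    using bounded_family_convergent_subseq[of F M, OF M] by blast
  have Acauchy: "Cauchy (\<lambda>j. A k a (u (r j)))" for k a
    using r(2)[of "(k, a)"] by (simp add: F_def convergent_Cauchy)
  have Adiff: "A k a (\<lambda>x. u i x - u j x) = A k a (u i) - A k a (u j)" for k a i j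
    using ui[of k a i] ui[of k a j] unfolding A_def cell_avg_def dyadic_cell_def[symmetric] set_integrable_def
    by (simp add: right_diff_distrib diff_divide_distrib)
  define c where "c = c_Phi \<Phi> ^ ?n"
  have c: "c > 0" using c_Phi_pos[OF adm] by (simp add: c_def)
  show thesis
  proof (rule that[OF r(1)])
    fix e :: real assume e: "e > 0"
    \<comment> \<open>The tail of a difference costs \<open>2 powr p\<close> times two tails, and
      half of \<open>e\<close> is reserved for it.\<close>
    define e1 where "e1 = e / (2 * (2 powr p * 2))"
    have e1: "e1 > 0" using e by (simp add: e1_def)
    obtain S :: nat where S: "\<And>j. (\<integral>\<^sup>+x. ennreal (\<bar>u j x\<bar> powr p) * indicator (- centered_cell (real S)) x \<partial>mu_Phi_n \<Phi>) \<le> ennreal e1"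
      using tail[OF e1] by blast
    obtain w where w: "0 < w" "\<And>x :: real ^ 'n. x \<in> centered_cell (real S) \<Longrightarrow> w \<le> omega \<Phi> x" using om_lower_cell[OF adm] by blast
    \<comment> \<open>The factor \<open>1 / w\<close> makes this gradient bound depend on the cube
      but not on the mesh, so the mesh can be chosen afterwards.\<close>
    define H where "H = 2 powr p * (2 * K) / w"
    have H: "H \<ge> 0" using K w by (simp add: H_def)
    have GH: "(\<integral>\<^sup>+x. ennreal ((G i x + G j x) powr p) * indicator (centered_cell (real S)) x \<partial>lborel) \<le> ennreal H" for i j
    proof -
      have "(\<integral>\<^sup>+x. ennreal ((G i x + G j x) powr p) * indicator (centered_cell (real S)) x \<partial>lborel) \<le> ennreal (1 / w) * (\<integral>\<^sup>+x. ennreal ((G i x + G j x) powr p) \<partial>mu_Phi_n \<Phi>)"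
        by (rule nn_integral_cell_le_mu[OF adm _ w]) measurable
      also have "(\<integral>\<^sup>+x. ennreal ((G i x + G j x) powr p) \<partial>mu_Phi_n \<Phi>) \<le> ennreal (2 powr p) * (ennreal K + ennreal K)"
      proof -
        have "(\<integral>\<^sup>+x. ennreal (\<bar>G i x + G j x\<bar> powr p) * indicator UNIV x \<partial>mu_Phi_n \<Phi>) \<le> ennreal (2 powr p) * ((\<integral>\<^sup>+x. ennreal (\<bar>G i x\<bar> powr p) * indicator UNIV x \<partial>mu_Phi_n \<Phi>) + (\<integral>\<^sup>+x. ennreal (\<bar>G j x\<bar> powr p) * indicator UNIV x \<partial>mu_Phi_n \<Phi>))"
          using p by (intro nn_integral_powr_add_le) (auto simp: sets_mu[OF adm])
        also have "\<dots> \<le> ennreal (2 powr p) * (ennreal K + ennreal K)"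
          using GK tgrad_borel(3)[OF uG] by (intro mult_left_mono add_mono) auto
        finally show ?thesis using tgrad_borel(3)[OF uG] by simp
      qed
      then have "ennreal (1 / w) * (\<integral>\<^sup>+x. ennreal ((G i x + G j x) powr p) \<partial>mu_Phi_n \<Phi>) \<le> ennreal (1 / w) * (ennreal (2 powr p) * (ennreal K + ennreal K))"
        by (rule mult_left_mono) simp
      also have "\<dots> = ennreal H" using K w by (simp add: H_def flip: ennreal_plus ennreal_mult)
      finally show ?thesis .
    qed
    have "(\<lambda>k. c * (2 powr p * (2 ^ ?n * (?n * (1 / 2) ^ k) powr p * H))) \<longlonglongrightarrow> c * (2 powr p * (2 ^ ?n * (?n * 0) powr p * H))"
    proof -
      have "(\<lambda>k. (1 / 2 :: real) ^ k) \<longlonglongrightarrow> 0" by (rule LIMSEQ_realpow_zero) auto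
      then show ?thesis using p by (intro tendsto_mult tendsto_const tendsto_powr') auto
    qed
    then have "(\<lambda>k. c * (2 powr p * (2 ^ ?n * (?n / 2 ^ k) powr p * H))) \<longlonglongrightarrow> 0" by (simp add: power_divide)
    then have "eventually (\<lambda>k. c * (2 powr p * (2 ^ ?n * (?n / 2 ^ k) powr p * H)) < e / 4) sequentially"
      using e by (intro order_tendstoD) auto
    then obtain k where k: "c * (2 powr p * (2 ^ ?n * (?n / 2 ^ k) powr p * H)) < e / 4" by (auto simp: eventually_sequentially)
    let ?D = "dyadic_index k S :: ('n \<Rightarrow> int) set"
    \<comment> \<open>The size of the averages at which all cells together contribute at most
      \<open>e / 4\<close>. The added 1 keeps the denominator positive when the cube is
      empty.\<close>
    define d where "d = (e / 4 / (c * 2 powr p * (real (card ?D) + 1))) powr (1 / p)"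
    have d: "d > 0" using e c by (simp add: d_def)
    have dp: "c * 2 powr p * (real (card ?D) * d powr p) \<le> e / 4"
    proof -
      have "d powr p = e / 4 / (c * 2 powr p * (real (card ?D) + 1))" unfolding d_def using p e c by (simp add: powr_powr)
      then have "c * 2 powr p * (real (card ?D) * d powr p) = (e / 4) * (real (card ?D) / (real (card ?D) + 1))"
      proof -
        have "B * (N * (x / (B * (N + 1)))) = x * (N / (N + 1))" if "0 < B" "0 \<le> N" for B N x :: real
          using that by simp
        from this[of "c * 2 powr p" "real (card ?D)" "e / 4"] show ?thesis
          using c \<open>d powr p = _\<close> by simp
      qed
      also have "\<dots> \<le> (e / 4) * 1" using e by (intro mult_left_mono) auto
      finally show ?thesis by simp
    qed
    have "\<forall>a. \<exists>N. \<forall>i\<ge>N. \<forall>j\<ge>N. \<bar>A k a (u (r i)) - A k a (u (r j))\<bar> < d"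
      using Acauchy d unfolding Cauchy_def dist_real_def by blast
    then obtain N where N: "\<And>a i j. i \<ge> N a \<Longrightarrow> j \<ge> N a \<Longrightarrow> \<bar>A k a (u (r i)) - A k a (u (r j))\<bar> < d" by metis
    \<comment> \<open>A finite sum of natural numbers dominates each of them, which gives one index
      for all cells.\<close>
    define N0 where "N0 = (\<Sum>a\<in>?D. N a)"
    have N0: "N a \<le> N0" if "a \<in> ?D" for a unfolding N0_def using that by (intro member_le_sum finite_dyadic_index) auto
    have "(\<integral>\<^sup>+x. ennreal (\<bar>u (r i) x - u (r j) x\<bar> powr p) \<partial>mu_Phi_n \<Phi>) \<le> ennreal e" if ij: "i \<ge> N0" "j \<ge> N0" for i j
    proof -
      let ?v = "\<lambda>x. u (r i) x - u (r j) x" and ?G = "\<lambda>x. G (r i) x + G (r j) x"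
      have vG: "tgrad ?v ?G" by (rule tgrad_diff[OF uG uG])
      have vi: "set_integrable lborel (dyadic_cell k a) ?v" for a using ui by (intro set_integral_diff)
      have "(\<integral>\<^sup>+x. ennreal (\<bar>?v x\<bar> powr p) * indicator (centered_cell (real S)) x \<partial>mu_Phi_n \<Phi>) \<le> ennreal c * (\<integral>\<^sup>+x. ennreal (\<bar>?v x\<bar> powr p) * indicator (centered_cell (real S)) x \<partial>lborel)"
        unfolding c_def by (rule nn_integral_mu_cell_le[OF adm]) measurable
      also have "\<dots> \<le> ennreal c * (ennreal (2 powr p) * ((\<Sum>a\<in>?D. ennreal (\<bar>A k a ?v\<bar> powr p))
         + ennreal (2 ^ ?n * (?n / 2 ^ k) powr p) * (\<integral>\<^sup>+x. ennreal (?G x powr p) * indicator (centered_cell (real S)) x \<partial>lborel)))"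
        unfolding A_def by (intro mult_left_mono dyadic_Poincare[OF vG p vi]) simp
      also have "\<dots> \<le> ennreal c * (ennreal (2 powr p) * ((\<Sum>a\<in>?D. ennreal (d powr p)) + ennreal (2 ^ ?n * (?n / 2 ^ k) powr p) * ennreal H))"
      proof (intro mult_left_mono add_mono sum_mono GH ennreal_leI powr_mono2)
        fix a assume "a \<in> ?D"
        then show "\<bar>A k a ?v\<bar> \<le> d" unfolding Adiff using N[of a i j] N0[of a] ij by auto
      qed (use p in auto)
      also have "\<dots> = ennreal (c * 2 powr p * (real (card ?D) * d powr p) + c * (2 powr p * (2 ^ ?n * (?n / 2 ^ k) powr p * H)))"
        using c H by (simp add: ennreal_of_nat_eq_real_of_nat distrib_left mult.assoc flip: ennreal_plus ennreal_mult)
      also have "\<dots> \<le> ennreal (e / 4 + e / 4)" using dp k by (intro ennreal_leI) linarith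
      finally have in1: "(\<integral>\<^sup>+x. ennreal (\<bar>?v x\<bar> powr p) * indicator (centered_cell (real S)) x \<partial>mu_Phi_n \<Phi>) \<le> ennreal (e / 4 + e / 4)" .
      have "(\<integral>\<^sup>+x. ennreal (\<bar>?v x\<bar> powr p) * indicator (- centered_cell (real S)) x \<partial>mu_Phi_n \<Phi>) \<le>
         ennreal (2 powr p) * ((\<integral>\<^sup>+x. ennreal (\<bar>u (r i) x\<bar> powr p) * indicator (- centered_cell (real S)) x \<partial>mu_Phi_n \<Phi>) + (\<integral>\<^sup>+x. ennreal (\<bar>u (r j) x\<bar> powr p) * indicator (- centered_cell (real S)) x \<partial>mu_Phi_n \<Phi>))"
        using p by (intro nn_integral_powr_add_le) (auto simp: sets_mu[OF adm])
      also have "\<dots> \<le> ennreal (2 powr p) * (ennreal e1 + ennreal e1)"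
        by (intro mult_left_mono add_mono S) simp
      also have "\<dots> = ennreal (e / 2)"
      proof -
        have "2 powr p * (e1 + e1) = e / 2" by (simp add: e1_def)
        moreover have "ennreal (2 powr p * (e1 + e1)) = ennreal (2 powr p) * (ennreal e1 + ennreal e1)"
          using e1 by (simp only: ennreal_mult ennreal_plus less_imp_le powr_ge_zero add_nonneg_nonneg)
        ultimately show ?thesis by (simp only:)
      qed
      finally have in2: "(\<integral>\<^sup>+x. ennreal (\<bar>?v x\<bar> powr p) * indicator (- centered_cell (real S)) x \<partial>mu_Phi_n \<Phi>) \<le> ennreal (e / 2)" .
      have "(\<integral>\<^sup>+x. ennreal (\<bar>?v x\<bar> powr p) \<partial>mu_Phi_n \<Phi>) \<le> ennreal (e / 4 + e / 4) + ennreal (e / 2)"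
        by (subst nn_integral_split_cell[OF adm, of _ "real S"], measurable) (rule add_mono[OF in1 in2])
      also have "\<dots> = ennreal e" using e by (simp flip: ennreal_plus)
      finally show ?thesis .
    qed
    then show "\<exists>N. \<forall>i\<ge>N. \<forall>j\<ge>N. (\<integral>\<^sup>+x. ennreal (\<bar>u (r i) x - u (r j) x\<bar> powr p) \<partial>mu_Phi_n \<Phi>) \<le> ennreal e" by blast
  qed
qed

end

section \<open>Compact embeddings\<close>

lemma powr_le_one_plus:
  fixes a p q :: real
  assumes "0 \<le> a" "0 \<le> q" "q \<le> p"
  shows "a powr q \<le> 1 + a powr p"
proof (cases "a \<ge> 1")
  case True
  then show ?thesis using powr_mono[of q p a] assms by simp
next
  case False
  then have "a powr q \<le> 1" using assms by (intro powr_le1) auto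
  then show ?thesis by (simp add: add_increasing2)
qed

text \<open>The sum is at most its number of terms times the largest one, and the power of the
  largest term is one of the summands on the right.\<close>

lemma powr_sum_le:
  fixes f :: "'i \<Rightarrow> real" and q :: real
  assumes "finite I" "\<And>i. i \<in> I \<Longrightarrow> 0 \<le> f i" "0 \<le> q"
  shows "(\<Sum>i\<in>I. f i) powr q \<le> card I powr q * (\<Sum>i\<in>I. f i powr q)"
proof (cases "I = {}")
  case False
  define M where "M = Max (f ` I)"
  have M: "M \<in> f ` I" "\<And>i. i \<in> I \<Longrightarrow> f i \<le> M" using assms False by (auto simp: M_def)
  have "(\<Sum>i\<in>I. f i) \<le> card I * M" using M by (intro sum_bounded_above) auto
  then have "(\<Sum>i\<in>I. f i) powr q \<le> (card I * M) powr q" using assms by (intro powr_mono2 sum_nonneg) auto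
  also have "\<dots> = card I powr q * M powr q" using M assms by (auto simp: powr_mult)
  also have "M powr q \<le> (\<Sum>i\<in>I. f i powr q)"
  proof -
    obtain i where i: "i \<in> I" "M = f i" using M by auto
    show ?thesis unfolding i(2) using assms i by (intro member_le_sum) auto
  qed
  finally show ?thesis by (simp add: mult_left_mono)
qed simp

lemma finite_lists_length: "finite {is :: 'n::finite list. length is = k}"
  using finite_lists_length_eq[of "UNIV :: 'n set" k] by simp

lemma abs_le_grad_norm:
  assumes "length is = k" shows "\<bar>D is x\<bar> \<le> grad_norm D k x"
proof -
  have "(D is x)\<^sup>2 \<le> (\<Sum>is\<in>{is. length is = k}. (D is x)\<^sup>2)"
    using assms finite_lists_length by (intro member_le_sum) auto
  then have "sqrt ((D is x)\<^sup>2) \<le> grad_norm D k x" unfolding grad_norm_def by (rule real_sqrt_le_mono)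
  then show ?thesis by simp
qed

lemma grad_norm_nonneg: "0 \<le> grad_norm D k x"
  by (simp add: grad_norm_def sum_nonneg)

lemma weak_derivs_tgrad:
  assumes "weak_derivs m u D" "length is < m"
  shows "tgrad (D is) (\<lambda>x. \<Sum>i\<in>UNIV. \<bar>D (is @ [i]) x\<bar>)"
  by (rule weak_grad_tgrad[OF weak_derivs_grad[OF assms]])

section \<open>From the Sobolev norm to moments of all derivatives\<close>

context
  fixes \<Phi> :: "real \<Rightarrow> real"
  assumes adm: "admissible_Phi \<Phi>"
begin

lemma memLp_borel: "memLp (mu_Phi_n \<Phi>) p f \<Longrightarrow> f \<in> borel_measurable borel"
  unfolding memLp_def using measurable_cong_sets[OF sets_mu[OF adm] refl] by blast

text \<open>The constant 0 has essential supremum 0 because the measure has mass 1; over a null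
  measure it would be -\<infinity>.\<close>

lemma esssup_abs_nonneg:
  fixes f :: "real ^ 'n::finite \<Rightarrow> real"
  assumes [measurable]: "f \<in> borel_measurable borel"
  shows "0 \<le> esssup (mu_Phi_n \<Phi>) (\<lambda>x. ereal \<bar>f x\<bar>)"
proof -
  note [measurable_cong] = sets_mu[OF adm]
  have "esssup (mu_Phi_n \<Phi> :: (real ^ 'n) measure) (\<lambda>x. 0 :: ereal) = 0"
    by (rule esssup_const) (simp add: space_mu[OF adm] emeasure_mu[OF adm])
  then show ?thesis using esssup_mono[of "\<lambda>x. 0 :: ereal" "mu_Phi_n \<Phi>" "\<lambda>x. ereal \<bar>f x\<bar>"] by simp
qed

lemma Lnorm_nonneg:
  fixes f :: "real ^ 'n::finite \<Rightarrow> real"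
  assumes "f \<in> borel_measurable borel"
  shows "0 \<le> Lnorm (mu_Phi_n \<Phi>) p f"
  unfolding Lnorm_def using esssup_abs_nonneg[OF assms] by (auto simp: real_of_ereal_pos)

lemma nn_integral_powr_Lnorm:
  fixes f :: "real ^ 'n::finite \<Rightarrow> real"
  assumes f: "memLp (mu_Phi_n \<Phi>) (ereal p) f" and p: "0 < p"
  shows "(\<integral>\<^sup>+x. ennreal (\<bar>f x\<bar> powr p) \<partial>mu_Phi_n \<Phi>) = ennreal (Lnorm (mu_Phi_n \<Phi>) (ereal p) f powr p)"
proof -
  have i: "integrable (mu_Phi_n \<Phi>) (\<lambda>x. \<bar>f x\<bar> powr p)" using f by (simp add: memLp_def)
  have "(\<integral>\<^sup>+x. ennreal (\<bar>f x\<bar> powr p) \<partial>mu_Phi_n \<Phi>) = ennreal (\<integral>x. \<bar>f x\<bar> powr p \<partial>mu_Phi_n \<Phi>)"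
    by (rule nn_integral_eq_integral[OF i]) simp
  also have "(\<integral>x. \<bar>f x\<bar> powr p \<partial>mu_Phi_n \<Phi>) = Lnorm (mu_Phi_n \<Phi>) (ereal p) f powr p"
    using p by (simp add: Lnorm_def powr_powr integral_nonneg_AE)
  finally show ?thesis .
qed

text \<open>One right-hand side for both kinds of \<open>p\<close>: if \<open>p\<close> is finite,
  \<open>1 + C powr p\<close> suffices, as the q-th power is at most 1 plus the p-th and the mass is
  1; if p = \<infinity>, \<open>real_of_ereal p\<close> is 0 and the summand \<open>C powr q\<close>
  does the work.\<close>

lemma Lnorm_bound:
  fixes f :: "real ^ 'n::finite \<Rightarrow> real" and p :: ereal and q C :: real
  assumes f: "memLp (mu_Phi_n \<Phi>) p f" and C: "Lnorm (mu_Phi_n \<Phi>) p f \<le> C" and q: "1 \<le> q" "ereal q \<le> p"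
  shows "(\<integral>\<^sup>+x. ennreal (\<bar>f x\<bar> powr q) \<partial>mu_Phi_n \<Phi>) \<le> ennreal (1 + C powr real_of_ereal p + C powr q)"
proof -
  note [measurable_cong] = sets_mu[OF adm]
  have fb[measurable]: "f \<in> borel_measurable borel" by (rule memLp_borel[OF f])
  have total: "(\<integral>\<^sup>+x. c \<partial>(mu_Phi_n \<Phi> :: (real ^ 'n) measure)) = c" for c
    by (simp add: space_mu[OF adm] emeasure_mu[OF adm])
  show ?thesis
  proof (cases p)
    case (real p')
    then have p': "q \<le> p'" using q by simp
    have "(\<integral>\<^sup>+x. ennreal (\<bar>f x\<bar> powr q) \<partial>mu_Phi_n \<Phi>) \<le> (\<integral>\<^sup>+x. 1 + ennreal (\<bar>f x\<bar> powr p') \<partial>mu_Phi_n \<Phi>)"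
    proof (intro nn_integral_mono)
      fix x
      have "ennreal (\<bar>f x\<bar> powr q) \<le> ennreal (1 + \<bar>f x\<bar> powr p')"
        using p' q by (intro ennreal_leI powr_le_one_plus) auto
      then show "ennreal (\<bar>f x\<bar> powr q) \<le> 1 + ennreal (\<bar>f x\<bar> powr p')" by simp
    qed
    also have "\<dots> = 1 + (\<integral>\<^sup>+x. ennreal (\<bar>f x\<bar> powr p') \<partial>mu_Phi_n \<Phi>)"
      by (subst nn_integral_add) (auto simp: space_mu[OF adm] emeasure_mu[OF adm])
    also have "(\<integral>\<^sup>+x. ennreal (\<bar>f x\<bar> powr p') \<partial>mu_Phi_n \<Phi>) = ennreal (Lnorm (mu_Phi_n \<Phi>) (ereal p') f powr p')"
      using f q p' real by (intro nn_integral_powr_Lnorm) auto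
    also have "\<dots> \<le> ennreal (C powr p')"
      using C real p' q Lnorm_nonneg[OF fb, of "ereal p'"] by (intro ennreal_leI powr_mono2) auto
    also have "1 + ennreal (C powr p') = ennreal (1 + C powr p')" by simp
    also have "\<dots> \<le> ennreal (1 + C powr real_of_ereal p + C powr q)" using real by (intro ennreal_leI) simp
    finally show ?thesis by (simp add: add_left_mono)
  next
    case PInf
    have "AE x in mu_Phi_n \<Phi>. ereal \<bar>f x\<bar> \<le> esssup (mu_Phi_n \<Phi>) (\<lambda>x. ereal \<bar>f x\<bar>)" by (rule esssup_AE)
    then have "AE x in mu_Phi_n \<Phi>. ennreal (\<bar>f x\<bar> powr q) \<le> ennreal (C powr q)"
    proof eventually_elim
      case (elim x)
      obtain r where r: "esssup (mu_Phi_n \<Phi>) (\<lambda>x. ereal \<bar>f x\<bar>) = ereal r"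
        using f PInf esssup_abs_nonneg[OF fb] by (cases "esssup (mu_Phi_n \<Phi>) (\<lambda>x. ereal \<bar>f x\<bar>)") (auto simp: memLp_def)
      then have "\<bar>f x\<bar> \<le> C" using elim C PInf by (simp add: Lnorm_def)
      then show ?case using q by (intro ennreal_leI powr_mono2) auto
    qed
    then have "(\<integral>\<^sup>+x. ennreal (\<bar>f x\<bar> powr q) \<partial>mu_Phi_n \<Phi>) \<le> (\<integral>\<^sup>+x. ennreal (C powr q) \<partial>(mu_Phi_n \<Phi> :: (real ^ 'n) measure))"
      by (rule nn_integral_mono_AE)
    also have "\<dots> = ennreal (C powr q)" by (rule total)
    also have "\<dots> \<le> ennreal (1 + C powr real_of_ereal p + C powr q)" by (intro ennreal_leI) (simp add: add_nonneg_nonneg)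
    finally show ?thesis .
  next
    case MInf
    then show ?thesis using q by simp
  qed
qed

text \<open>Turns the norm into plain integrals with a real exponent \<open>q\<close>, so that the
  case p = \<infinity> needs no further attention. The constant is independent of the
  function.\<close>

lemma VmLp_bounds:
  fixes p :: ereal and q C :: real
  assumes p: "1 \<le> p" and q: "1 \<le> q" "ereal q \<le> p"
  obtains K where "0 \<le> K" and "\<And>(u :: real ^ 'n::finite \<Rightarrow> real) D. in_VmLp \<Phi> m p u D \<Longrightarrow> VmLp_norm \<Phi> m p D \<le> C \<Longrightarrow>
     (\<forall>k<m. (\<integral>\<^sup>+x. ennreal (grad_norm D k x) \<partial>mu_Phi_n \<Phi>) \<le> ennreal K) \<and> (\<integral>\<^sup>+x. ennreal (grad_norm D m x powr q) \<partial>mu_Phi_n \<Phi>) \<le> ennreal K"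
proof -
  define K where "K = 1 + C powr real_of_ereal p + C powr q + \<bar>C\<bar>"
  have K: "0 \<le> K" unfolding K_def by (simp add: add_nonneg_nonneg)
  show thesis
  proof (rule that[OF K])
    fix u :: "real ^ 'n \<Rightarrow> real" and D assume uD: "in_VmLp \<Phi> m p u D" and C: "VmLp_norm \<Phi> m p D \<le> C"
    have mk: "memLp (mu_Phi_n \<Phi>) 1 (grad_norm D k)" if "k < m" for k using uD that by (simp add: in_VmLp_def)
    have mm: "memLp (mu_Phi_n \<Phi>) p (grad_norm D m)" using uD by (simp add: in_VmLp_def)
    have nk: "0 \<le> Lnorm (mu_Phi_n \<Phi>) 1 (grad_norm D k)" if "k < m" for k
      by (rule Lnorm_nonneg[OF memLp_borel[OF mk[OF that]]])
    have nm: "0 \<le> Lnorm (mu_Phi_n \<Phi>) p (grad_norm D m)"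
      by (rule Lnorm_nonneg[OF memLp_borel[OF mm]])
    have Ck: "Lnorm (mu_Phi_n \<Phi>) 1 (grad_norm D k) \<le> C" if "k < m" for k
    proof -
      have "Lnorm (mu_Phi_n \<Phi>) 1 (grad_norm D k) \<le> (\<Sum>k<m. Lnorm (mu_Phi_n \<Phi>) 1 (grad_norm D k))"
        using nk that by (intro member_le_sum) auto
      then show ?thesis using C nm unfolding VmLp_norm_def by linarith
    qed
    have "0 \<le> (\<Sum>k<m. Lnorm (mu_Phi_n \<Phi>) 1 (grad_norm D k))" using nk by (intro sum_nonneg) auto
    then have Cm: "Lnorm (mu_Phi_n \<Phi>) p (grad_norm D m) \<le> C" using C unfolding VmLp_norm_def by linarith
    have "(\<integral>\<^sup>+x. ennreal (grad_norm D k x) \<partial>mu_Phi_n \<Phi>) \<le> ennreal K" if k: "k < m" for k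
    proof -
      have "(\<integral>\<^sup>+x. ennreal (\<bar>grad_norm D k x\<bar> powr 1) \<partial>mu_Phi_n \<Phi>) = ennreal (Lnorm (mu_Phi_n \<Phi>) (ereal 1) (grad_norm D k) powr 1)"
        using mk[OF k] by (intro nn_integral_powr_Lnorm) (simp_all add: one_ereal_def)
      then have "(\<integral>\<^sup>+x. ennreal (grad_norm D k x) \<partial>mu_Phi_n \<Phi>) = ennreal (Lnorm (mu_Phi_n \<Phi>) 1 (grad_norm D k))"
        using nk[OF k] by (simp add: grad_norm_nonneg one_ereal_def)
      also have "\<dots> \<le> ennreal K" using Ck[OF k] by (intro ennreal_leI) (auto simp: K_def intro: order_trans add_increasing)
      finally show ?thesis .
    qed
    moreover have "(\<integral>\<^sup>+x. ennreal (grad_norm D m x powr q) \<partial>mu_Phi_n \<Phi>) \<le> ennreal K"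
    proof -
      have "(\<integral>\<^sup>+x. ennreal (\<bar>grad_norm D m x\<bar> powr q) \<partial>mu_Phi_n \<Phi>) \<le> ennreal (1 + C powr real_of_ereal p + C powr q)"
        by (rule Lnorm_bound[OF mm Cm q])
      also have "\<dots> \<le> ennreal K" by (intro ennreal_leI) (simp add: K_def)
      finally show ?thesis by (simp add: grad_norm_nonneg)
    qed
    ultimately show "(\<forall>k<m. (\<integral>\<^sup>+x. ennreal (grad_norm D k x) \<partial>mu_Phi_n \<Phi>) \<le> ennreal K) \<and> (\<integral>\<^sup>+x. ennreal (grad_norm D m x powr q) \<partial>mu_Phi_n \<Phi>) \<le> ennreal K" by blast
  qed
qed

lemma nn_integral_gradient_sum:
  fixes D :: "'n::finite list \<Rightarrow> real ^ 'n \<Rightarrow> real" and q K :: real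
  assumes q: "0 \<le> q" and K: "0 \<le> K" and D[measurable]: "\<And>i. D (is @ [i]) \<in> borel_measurable borel"
    and b: "\<And>i. (\<integral>\<^sup>+x. ennreal (\<bar>D (is @ [i]) x\<bar> powr q) \<partial>mu_Phi_n \<Phi>) \<le> ennreal K"
  shows "(\<integral>\<^sup>+x. ennreal ((\<Sum>i\<in>UNIV. \<bar>D (is @ [i]) x\<bar>) powr q) \<partial>mu_Phi_n \<Phi>) \<le> ennreal (CARD('n) powr q * (CARD('n) * K))"
proof -
  note [measurable_cong] = sets_mu[OF adm]
  have "(\<integral>\<^sup>+x. ennreal ((\<Sum>i\<in>UNIV. \<bar>D (is @ [i]) x\<bar>) powr q) \<partial>mu_Phi_n \<Phi>) \<le> (\<integral>\<^sup>+x. ennreal (CARD('n) powr q) * (\<Sum>i\<in>UNIV. ennreal (\<bar>D (is @ [i]) x\<bar> powr q)) \<partial>mu_Phi_n \<Phi>)"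
  proof (intro nn_integral_mono)
    fix x
    have "ennreal ((\<Sum>i\<in>UNIV. \<bar>D (is @ [i]) x\<bar>) powr q) \<le> ennreal (CARD('n) powr q * (\<Sum>i\<in>UNIV. \<bar>D (is @ [i]) x\<bar> powr q))"
      using q by (intro ennreal_leI powr_sum_le) auto
    also have "\<dots> = ennreal (CARD('n) powr q) * (\<Sum>i\<in>UNIV. ennreal (\<bar>D (is @ [i]) x\<bar> powr q))"
      by (simp add: ennreal_mult sum_nonneg)
    finally show "ennreal ((\<Sum>i\<in>UNIV. \<bar>D (is @ [i]) x\<bar>) powr q) \<le> ennreal (CARD('n) powr q) * (\<Sum>i\<in>UNIV. ennreal (\<bar>D (is @ [i]) x\<bar> powr q))" .
  qed
  also have "\<dots> = ennreal (CARD('n) powr q) * (\<Sum>i\<in>UNIV. (\<integral>\<^sup>+x. ennreal (\<bar>D (is @ [i]) x\<bar> powr q) \<partial>mu_Phi_n \<Phi>))"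
  proof -
    have "(\<integral>\<^sup>+x. (\<Sum>i\<in>UNIV. ennreal (\<bar>D (is @ [i]) x\<bar> powr q)) \<partial>mu_Phi_n \<Phi>) = (\<Sum>i\<in>UNIV. (\<integral>\<^sup>+x. ennreal (\<bar>D (is @ [i]) x\<bar> powr q) \<partial>mu_Phi_n \<Phi>))"
      by (rule nn_integral_sum) measurable
    then show ?thesis by (subst nn_integral_cmult) auto
  qed
  also have "\<dots> \<le> ennreal (CARD('n) powr q) * (\<Sum>i\<in>(UNIV::'n set). ennreal K)"
    by (intro mult_left_mono sum_mono b) simp
  also have "\<dots> = ennreal (CARD('n) powr q * (CARD('n) * K))"
    using K by (simp add: ennreal_of_nat_eq_real_of_nat flip: ennreal_mult)
  finally show ?thesis .
qed

text \<open>Induction on the distance from the top order: at order \<open>m\<close> the bound is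
  given, and one order down the Poincare boost combines the first moment of the derivative with the
  q-th moments of its partial derivatives. The constants are produced before the function is, so
  they are uniform.\<close>

lemma all_derivs_Lq:
  fixes q K :: real
  assumes q: "1 \<le> q" and K: "0 \<le> K"
  obtains K' where "0 \<le> K'" and "\<And>(u :: real ^ 'n::finite \<Rightarrow> real) D is. weak_derivs m u D \<Longrightarrow>
     (\<forall>k<m. (\<integral>\<^sup>+x. ennreal (grad_norm D k x) \<partial>mu_Phi_n \<Phi>) \<le> ennreal K) \<Longrightarrow> (\<integral>\<^sup>+x. ennreal (grad_norm D m x powr q) \<partial>mu_Phi_n \<Phi>) \<le> ennreal K \<Longrightarrow>
     length is \<le> m \<Longrightarrow> (\<integral>\<^sup>+x. ennreal (\<bar>D is x\<bar> powr q) \<partial>mu_Phi_n \<Phi>) \<le> ennreal K'"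
proof -
  define adm_D where "adm_D u D \<longleftrightarrow> weak_derivs m u D \<and> (\<forall>k<m. (\<integral>\<^sup>+x. ennreal (grad_norm D k x) \<partial>mu_Phi_n \<Phi>) \<le> ennreal K) \<and> (\<integral>\<^sup>+x. ennreal (grad_norm D m x powr q) \<partial>mu_Phi_n \<Phi>) \<le> ennreal K" for u :: "real ^ 'n \<Rightarrow> real" and D
  have step: "\<exists>K'\<ge>0. \<forall>u D is. adm_D u D \<longrightarrow> length is = m - k \<longrightarrow> (\<integral>\<^sup>+x. ennreal (\<bar>D is x\<bar> powr q) \<partial>mu_Phi_n \<Phi>) \<le> ennreal K'" if "k \<le> m" for k
    using that
  proof (induction k)
    case 0
    have "(\<integral>\<^sup>+x. ennreal (\<bar>D is x\<bar> powr q) \<partial>mu_Phi_n \<Phi>) \<le> ennreal K" if "adm_D u D" "length is = m" for u D "is"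
    proof -
      have "(\<integral>\<^sup>+x. ennreal (\<bar>D is x\<bar> powr q) \<partial>mu_Phi_n \<Phi>) \<le> (\<integral>\<^sup>+x. ennreal (grad_norm D m x powr q) \<partial>mu_Phi_n \<Phi>)"
        using q by (intro nn_integral_mono ennreal_leI powr_mono2 abs_le_grad_norm that(2)) auto
      also have "\<dots> \<le> ennreal K" using that by (simp add: adm_D_def)
      finally show ?thesis .
    qed
    then show ?case using K by auto
  next
    case (Suc k)
    then obtain K1 where K1: "K1 \<ge> 0" "\<And>u D is. adm_D u D \<Longrightarrow> length is = m - k \<Longrightarrow> (\<integral>\<^sup>+x. ennreal (\<bar>D is x\<bar> powr q) \<partial>mu_Phi_n \<Phi>) \<le> ennreal K1"
      by auto
    \<comment> \<open>The boost takes a single constant for the first moment and for the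
      gradient.\<close>
    define K2 where "K2 = max K (CARD('n) powr q * (CARD('n) * K1))"
    have K2: "0 \<le> K2" using K by (simp add: K2_def)
    obtain K3 where K3: "0 \<le> K3"
      "\<And>(v :: real ^ 'n \<Rightarrow> real) G. tgrad v G \<Longrightarrow> (\<integral>\<^sup>+x. ennreal \<bar>v x\<bar> \<partial>mu_Phi_n \<Phi>) \<le> ennreal K2 \<Longrightarrow>
       (\<integral>\<^sup>+x. ennreal (G x powr q) \<partial>mu_Phi_n \<Phi>) \<le> ennreal K2 \<Longrightarrow> (\<integral>\<^sup>+x. ennreal (\<bar>v x\<bar> powr q) \<partial>mu_Phi_n \<Phi>) \<le> ennreal K3"
      by (rule Poincare_boost[OF adm q K2]) blast
    have "(\<integral>\<^sup>+x. ennreal (\<bar>D is x\<bar> powr q) \<partial>mu_Phi_n \<Phi>) \<le> ennreal K3" if uD: "adm_D u D" and l: "length is = m - Suc k" for u D "is"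
    proof (rule K3(2))
      have w: "weak_derivs m u D" using uD by (simp add: adm_D_def)
      have lm: "length is < m" using l Suc.prems by simp
      show "tgrad (D is) (\<lambda>x. \<Sum>i\<in>UNIV. \<bar>D (is @ [i]) x\<bar>)" by (rule weak_derivs_tgrad[OF w lm])
      have "(\<integral>\<^sup>+x. ennreal \<bar>D is x\<bar> \<partial>mu_Phi_n \<Phi>) \<le> (\<integral>\<^sup>+x. ennreal (grad_norm D (length is) x) \<partial>mu_Phi_n \<Phi>)"
        by (intro nn_integral_mono ennreal_leI abs_le_grad_norm) simp
      also have "\<dots> \<le> ennreal K" using uD lm by (simp add: adm_D_def)
      also have "\<dots> \<le> ennreal K2" by (intro ennreal_leI) (simp add: K2_def)
      finally show "(\<integral>\<^sup>+x. ennreal \<bar>D is x\<bar> \<partial>mu_Phi_n \<Phi>) \<le> ennreal K2" .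
      have "(\<integral>\<^sup>+x. ennreal ((\<Sum>i\<in>UNIV. \<bar>D (is @ [i]) x\<bar>) powr q) \<partial>mu_Phi_n \<Phi>) \<le> ennreal (CARD('n) powr q * (CARD('n) * K1))"
      proof (rule nn_integral_gradient_sum[of q K1 D "is"])
        fix i
        show "D (is @ [i]) \<in> borel_measurable borel" using loc_integrable_borel[OF weak_derivs_loc[OF w, of "is @ [i]"]] lm by simp
        show "(\<integral>\<^sup>+x. ennreal (\<bar>D (is @ [i]) x\<bar> powr q) \<partial>mu_Phi_n \<Phi>) \<le> ennreal K1" using l Suc.prems by (intro K1(2)[OF uD]) auto
      qed (use q K1 in auto)
      also have "\<dots> \<le> ennreal K2" by (intro ennreal_leI) (simp add: K2_def)
      finally show "(\<integral>\<^sup>+x. ennreal ((\<Sum>i\<in>UNIV. \<bar>D (is @ [i]) x\<bar>) powr q) \<partial>mu_Phi_n \<Phi>) \<le> ennreal K2" .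
    qed
    then show ?case using K3(1) by blast
  qed
  then obtain F where F: "\<And>k. k \<le> m \<Longrightarrow> F k \<ge> 0" "\<And>k u D is. k \<le> m \<Longrightarrow> adm_D u D \<Longrightarrow> length is = m - k \<Longrightarrow> (\<integral>\<^sup>+x. ennreal (\<bar>D is x\<bar> powr q) \<partial>mu_Phi_n \<Phi>) \<le> ennreal (F k)"
    by metis
  \<comment> \<open>The sum serves all orders at once, each single constant being
    nonnegative.\<close>
  define K' where "K' = (\<Sum>k\<le>m. F k)"
  show thesis
  proof (rule that[of K'])
    show "0 \<le> K'" unfolding K'_def using F(1) by (intro sum_nonneg) auto
    fix u :: "real ^ 'n \<Rightarrow> real" and D and "is" :: "'n list"
    assume "weak_derivs m u D" "\<forall>k<m. (\<integral>\<^sup>+x. ennreal (grad_norm D k x) \<partial>mu_Phi_n \<Phi>) \<le> ennreal K" "(\<integral>\<^sup>+x. ennreal (grad_norm D m x powr q) \<partial>mu_Phi_n \<Phi>) \<le> ennreal K"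
    then have uD: "adm_D u D" by (simp add: adm_D_def)
    assume l: "length is \<le> m"
    have "(\<integral>\<^sup>+x. ennreal (\<bar>D is x\<bar> powr q) \<partial>mu_Phi_n \<Phi>) \<le> ennreal (F (m - length is))"
      using l by (intro F(2)[OF _ uD]) auto
    also have "\<dots> \<le> ennreal K'" unfolding K'_def using F(1) by (intro ennreal_leI member_le_sum) auto
    finally show "(\<integral>\<^sup>+x. ennreal (\<bar>D is x\<bar> powr q) \<partial>mu_Phi_n \<Phi>) \<le> ennreal K'" .
  qed
qed

end

section \<open>A compactness criterion and its two applications\<close>

context
  fixes \<Phi> :: "real \<Rightarrow> real"
  assumes adm: "admissible_Phi \<Phi>"
begin

lemma memLp_finiteI:
  fixes f :: "real ^ 'n::finite \<Rightarrow> real" and q :: real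
  assumes [measurable]: "f \<in> borel_measurable borel" and fin: "(\<integral>\<^sup>+x. ennreal (\<bar>f x\<bar> powr q) \<partial>mu_Phi_n \<Phi>) < \<infinity>"
  shows "memLp (mu_Phi_n \<Phi>) (ereal q) f"
proof -
  note [measurable_cong] = sets_mu[OF adm]
  have "integrable (mu_Phi_n \<Phi>) (\<lambda>x. \<bar>f x\<bar> powr q)"
    by (rule integrableI_nonneg) (use fin in auto)
  moreover have "f \<in> borel_measurable (mu_Phi_n \<Phi>)" by measurable
  ultimately show ?thesis by (simp add: memLp_def)
qed

lemma Lnorm_le:
  fixes f :: "real ^ 'n::finite \<Rightarrow> real" and q e :: real
  assumes [measurable]: "f \<in> borel_measurable borel" and q: "0 < q" and e: "0 \<le> e"
    and b: "(\<integral>\<^sup>+x. ennreal (\<bar>f x\<bar> powr q) \<partial>mu_Phi_n \<Phi>) \<le> ennreal (e powr q)"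
  shows "Lnorm (mu_Phi_n \<Phi>) (ereal q) f \<le> e"
proof -
  note [measurable_cong] = sets_mu[OF adm]
  have "(\<integral>x. \<bar>f x\<bar> powr q \<partial>mu_Phi_n \<Phi>) = enn2real (\<integral>\<^sup>+x. ennreal (\<bar>f x\<bar> powr q) \<partial>mu_Phi_n \<Phi>)"
    by (rule integral_eq_nn_integral) auto
  also have "\<dots> \<le> e powr q" using b by (intro enn2real_leI) auto
  finally have "(\<integral>x. \<bar>f x\<bar> powr q \<partial>mu_Phi_n \<Phi>) powr (1 / q) \<le> (e powr q) powr (1 / q)"
    using q by (intro powr_mono2) auto
  then show ?thesis using q e by (simp add: Lnorm_def powr_powr)
qed

lemma nn_integral_powr_le_one_plus:
  fixes f :: "real ^ 'n::finite \<Rightarrow> real" and q q' K :: real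
  assumes [measurable]: "f \<in> borel_measurable borel" and q: "0 \<le> q" "q \<le> q'" and K: "0 \<le> K"
    and b: "(\<integral>\<^sup>+x. ennreal (\<bar>f x\<bar> powr q') \<partial>mu_Phi_n \<Phi>) \<le> ennreal K"
  shows "(\<integral>\<^sup>+x. ennreal (\<bar>f x\<bar> powr q) \<partial>mu_Phi_n \<Phi>) \<le> ennreal (1 + K)"
proof -
  note [measurable_cong] = sets_mu[OF adm]
  have "(\<integral>\<^sup>+x. ennreal (\<bar>f x\<bar> powr q) \<partial>mu_Phi_n \<Phi>) \<le> (\<integral>\<^sup>+x. 1 + ennreal (\<bar>f x\<bar> powr q') \<partial>mu_Phi_n \<Phi>)"
  proof (intro nn_integral_mono)
    fix x
    have "ennreal (\<bar>f x\<bar> powr q) \<le> ennreal (1 + \<bar>f x\<bar> powr q')"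
      using q by (intro ennreal_leI powr_le_one_plus) auto
    then show "ennreal (\<bar>f x\<bar> powr q) \<le> 1 + ennreal (\<bar>f x\<bar> powr q')" by simp
  qed
  also have "\<dots> = 1 + (\<integral>\<^sup>+x. ennreal (\<bar>f x\<bar> powr q') \<partial>mu_Phi_n \<Phi>)"
    by (subst nn_integral_add) (auto simp: space_mu[OF adm] emeasure_mu[OF adm])
  also have "\<dots> \<le> 1 + ennreal K" by (intro add_left_mono b)
  also have "\<dots> = ennreal (1 + K)" using K by simp
  finally show ?thesis .
qed

text \<open>Two exponents are kept apart: bounds hold in the exponent \<open>q'\<close>, tails are
  small in \<open>q\<close>. For superlinear \<Phi> they coincide; otherwise the gap between them is
  what makes the tails small.\<close>

lemma compact_embI:
  fixes p :: ereal and q q' :: real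
  assumes m: "1 \<le> m" and p: "1 \<le> p" and q: "1 \<le> q" "q \<le> q'" "ereal q' \<le> p"
    and tail: "\<And>K e. 0 \<le> K \<Longrightarrow> 0 < e \<Longrightarrow> \<exists>S::nat. \<forall>(v :: real ^ 'n::finite \<Rightarrow> real) G. tgrad v G \<longrightarrow>
        (\<integral>\<^sup>+x. ennreal (\<bar>v x\<bar> powr q') \<partial>mu_Phi_n \<Phi>) \<le> ennreal K \<longrightarrow> (\<integral>\<^sup>+x. ennreal (G x powr q') \<partial>mu_Phi_n \<Phi>) \<le> ennreal K \<longrightarrow>
        (\<integral>\<^sup>+x. ennreal (\<bar>v x\<bar> powr q) * indicator (- centered_cell (real S)) x \<partial>mu_Phi_n \<Phi>) \<le> ennreal e"
  shows "compact_emb \<Phi> TYPE('n) m p (ereal q)"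
proof -
  note [measurable_cong] = sets_mu[OF adm]
  have q'1: "1 \<le> q'" using q by simp
  have bounds: "\<exists>K\<ge>0. \<forall>(u :: real ^ 'n \<Rightarrow> real) D. in_VmLp \<Phi> m p u D \<longrightarrow> VmLp_norm \<Phi> m p D \<le> C \<longrightarrow>
     tgrad u (\<lambda>x. \<Sum>i\<in>UNIV. \<bar>D [i] x\<bar>) \<and> (\<integral>\<^sup>+x. ennreal (\<bar>u x\<bar> powr q') \<partial>mu_Phi_n \<Phi>) \<le> ennreal K
     \<and> (\<integral>\<^sup>+x. ennreal ((\<Sum>i\<in>UNIV. \<bar>D [i] x\<bar>) powr q') \<partial>mu_Phi_n \<Phi>) \<le> ennreal K" for C
  proof -
    obtain K1 where K1: "0 \<le> K1" "\<And>(u :: real ^ 'n \<Rightarrow> real) D. in_VmLp \<Phi> m p u D \<Longrightarrow> VmLp_norm \<Phi> m p D \<le> C \<Longrightarrow>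
     (\<forall>k<m. (\<integral>\<^sup>+x. ennreal (grad_norm D k x) \<partial>mu_Phi_n \<Phi>) \<le> ennreal K1) \<and> (\<integral>\<^sup>+x. ennreal (grad_norm D m x powr q') \<partial>mu_Phi_n \<Phi>) \<le> ennreal K1"
      by (rule VmLp_bounds[OF adm p q'1 q(3)]) blast
    obtain K2 where K2: "0 \<le> K2" "\<And>(u :: real ^ 'n \<Rightarrow> real) D is. weak_derivs m u D \<Longrightarrow>
     (\<forall>k<m. (\<integral>\<^sup>+x. ennreal (grad_norm D k x) \<partial>mu_Phi_n \<Phi>) \<le> ennreal K1) \<Longrightarrow> (\<integral>\<^sup>+x. ennreal (grad_norm D m x powr q') \<partial>mu_Phi_n \<Phi>) \<le> ennreal K1 \<Longrightarrow>
     length is \<le> m \<Longrightarrow> (\<integral>\<^sup>+x. ennreal (\<bar>D is x\<bar> powr q') \<partial>mu_Phi_n \<Phi>) \<le> ennreal K2"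
      by (rule all_derivs_Lq[OF adm q'1 K1(1)]) blast
    define K where "K = max K2 (CARD('n) powr q' * (CARD('n) * K2))"
    have K: "0 \<le> K" using K2 by (simp add: K_def)
    show ?thesis
    proof (intro exI[of _ K] conjI K allI impI)
      fix u :: "real ^ 'n \<Rightarrow> real" and D assume uD: "in_VmLp \<Phi> m p u D" and C: "VmLp_norm \<Phi> m p D \<le> C"
      have w: "weak_derivs m u D" using uD by (simp add: in_VmLp_def)
      have D0: "D [] = u" using w by (simp add: weak_derivs_def)
      note b = K1(2)[OF uD C]
      have Dq: "(\<integral>\<^sup>+x. ennreal (\<bar>D is x\<bar> powr q') \<partial>mu_Phi_n \<Phi>) \<le> ennreal K2" if "length is \<le> m" for "is"
        using b by (intro K2(2)[OF w _ _ that]) auto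
      show "tgrad u (\<lambda>x. \<Sum>i\<in>UNIV. \<bar>D [i] x\<bar>)"
        using weak_derivs_tgrad[OF w, of "[]"] m by (simp add: D0)
      have "(\<integral>\<^sup>+x. ennreal (\<bar>u x\<bar> powr q') \<partial>mu_Phi_n \<Phi>) \<le> ennreal K2" using Dq[of "[]"] by (simp add: D0)
      also have "\<dots> \<le> ennreal K" by (intro ennreal_leI) (simp add: K_def)
      finally show "(\<integral>\<^sup>+x. ennreal (\<bar>u x\<bar> powr q') \<partial>mu_Phi_n \<Phi>) \<le> ennreal K" .
      have "(\<integral>\<^sup>+x. ennreal ((\<Sum>i\<in>UNIV. \<bar>D ([] @ [i]) x\<bar>) powr q') \<partial>mu_Phi_n \<Phi>) \<le> ennreal (CARD('n) powr q' * (CARD('n) * K2))"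
      proof (rule nn_integral_gradient_sum[OF adm, of q' K2 D "[]"])
        fix i
        show "D ([] @ [i]) \<in> borel_measurable borel" using loc_integrable_borel[OF weak_derivs_loc[OF w, of "[i]"]] m by simp
        show "(\<integral>\<^sup>+x. ennreal (\<bar>D ([] @ [i]) x\<bar> powr q') \<partial>mu_Phi_n \<Phi>) \<le> ennreal K2" using m by (intro Dq) auto
      qed (use q K2 in auto)
      also have "\<dots> \<le> ennreal K" by (intro ennreal_leI) (simp add: K_def)
      finally show "(\<integral>\<^sup>+x. ennreal ((\<Sum>i\<in>UNIV. \<bar>D [i] x\<bar>) powr q') \<partial>mu_Phi_n \<Phi>) \<le> ennreal K" by simp
    qed
  qed
  show ?thesis unfolding compact_emb_def
  proof (intro conjI allI impI)
    fix u :: "real ^ 'n \<Rightarrow> real" and D assume uD: "in_VmLp \<Phi> m p u D"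
    obtain K where K: "K \<ge> 0" "tgrad u (\<lambda>x. \<Sum>i\<in>UNIV. \<bar>D [i] x\<bar>)" "(\<integral>\<^sup>+x. ennreal (\<bar>u x\<bar> powr q') \<partial>mu_Phi_n \<Phi>) \<le> ennreal K"
      using bounds[of "VmLp_norm \<Phi> m p D"] uD by blast
    note ub = tgrad_borel(1)[OF K(2)]
    have "(\<integral>\<^sup>+x. ennreal (\<bar>u x\<bar> powr q) \<partial>mu_Phi_n \<Phi>) \<le> ennreal (1 + K)"
      using q by (intro nn_integral_powr_le_one_plus[OF ub _ _ K(1) K(3)]) auto
    then show "memLp (mu_Phi_n \<Phi>) (ereal q) u"
      by (intro memLp_finiteI[OF ub]) (auto simp: le_less_trans)
  next
    fix u :: "nat \<Rightarrow> real ^ 'n \<Rightarrow> real" and D C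
    assume uD: "\<forall>j. in_VmLp \<Phi> m p (u j) (D j) \<and> VmLp_norm \<Phi> m p (D j) \<le> C"
    define G where "G j = (\<lambda>x. \<Sum>i\<in>UNIV. \<bar>D j [i] x\<bar>)" for j
    obtain K where K: "K \<ge> 0" and uG: "\<And>j. tgrad (u j) (G j)" and uK: "\<And>j. (\<integral>\<^sup>+x. ennreal (\<bar>u j x\<bar> powr q') \<partial>mu_Phi_n \<Phi>) \<le> ennreal K"
      and GK: "\<And>j. (\<integral>\<^sup>+x. ennreal (G j x powr q') \<partial>mu_Phi_n \<Phi>) \<le> ennreal K"
      using bounds[of C] uD unfolding G_def by blast
    note [measurable] = tgrad_borel(1,2)[OF uG]
    have uK1: "(\<integral>\<^sup>+x. ennreal (\<bar>u j x\<bar> powr q) \<partial>mu_Phi_n \<Phi>) \<le> ennreal (1 + K)" for j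
      using q by (intro nn_integral_powr_le_one_plus[OF _ _ _ K uK]) auto
    have GK1: "(\<integral>\<^sup>+x. ennreal (G j x powr q) \<partial>mu_Phi_n \<Phi>) \<le> ennreal (1 + K)" for j
      using nn_integral_powr_le_one_plus[of "G j" q q' K] q K GK[of j] tgrad_borel(3)[OF uG] by simp
    have tails: "\<exists>S::nat. \<forall>j. (\<integral>\<^sup>+x. ennreal (\<bar>u j x\<bar> powr q) * indicator (- centered_cell (real S)) x \<partial>mu_Phi_n \<Phi>) \<le> ennreal e" if "0 < e" for e
      using tail[OF K that] uG uK GK by blast
    have K1: "0 \<le> 1 + K" using K by simp
    obtain r where r: "strict_mono (r :: nat \<Rightarrow> nat)"
      "\<And>e. 0 < e \<Longrightarrow> \<exists>N. \<forall>i\<ge>N. \<forall>j\<ge>N. (\<integral>\<^sup>+x. ennreal (\<bar>u (r i) x - u (r j) x\<bar> powr q) \<partial>mu_Phi_n \<Phi>) \<le> ennreal e"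
      by (rule Cauchy_subsequence[where u=u and G=G, OF adm q(1) K1 uG uK1 GK1 tails], assumption, rule that, assumption, simp)
    obtain g where g[measurable]: "g \<in> borel_measurable (mu_Phi_n \<Phi>)"
      "\<And>e. 0 < e \<Longrightarrow> \<exists>N. \<forall>j\<ge>N. (\<integral>\<^sup>+x. ennreal (\<bar>u (r j) x - g x\<bar> powr q) \<partial>mu_Phi_n \<Phi>) \<le> ennreal e"
      by (rule Lp_complete[of "\<lambda>j. u (r j)" "mu_Phi_n \<Phi>" q]) (use r(2) q(1) in \<open>auto, measurable\<close>)
    have [measurable]: "g \<in> borel_measurable borel" using g(1) measurable_cong_sets[OF sets_mu[OF adm] refl] by blast
    show "\<exists>r g. strict_mono r \<and> memLp (mu_Phi_n \<Phi>) (ereal q) g \<and> (\<lambda>j. Lnorm (mu_Phi_n \<Phi>) (ereal q) (\<lambda>x. u (r j) x - g x)) \<longlonglongrightarrow> 0"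
    proof (intro exI conjI)
      show "strict_mono r" by fact
      show "memLp (mu_Phi_n \<Phi>) (ereal q) g"
      proof (rule memLp_finiteI)
        obtain N where N: "(\<integral>\<^sup>+x. ennreal (\<bar>u (r N) x - g x\<bar> powr q) \<partial>mu_Phi_n \<Phi>) \<le> ennreal 1"
          using g(2)[of 1] by auto
        have "(\<integral>\<^sup>+x. ennreal (\<bar>g x\<bar> powr q) * indicator UNIV x \<partial>mu_Phi_n \<Phi>) \<le> ennreal (2 powr q) * ((\<integral>\<^sup>+x. ennreal (\<bar>u (r N) x\<bar> powr q) * indicator UNIV x \<partial>mu_Phi_n \<Phi>) + (\<integral>\<^sup>+x. ennreal (\<bar>u (r N) x - g x\<bar> powr q) * indicator UNIV x \<partial>mu_Phi_n \<Phi>))"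
          using q by (intro nn_integral_powr_add_le) (auto simp: sets_mu[OF adm])
        also have "\<dots> \<le> ennreal (2 powr q) * (ennreal (1 + K) + ennreal 1)"
          using N uK1[of "r N"] by (intro mult_left_mono add_mono) auto
        also have "\<dots> < \<infinity>" by (simp add: ennreal_mult_less_top)
        finally show "(\<integral>\<^sup>+x. ennreal (\<bar>g x\<bar> powr q) \<partial>mu_Phi_n \<Phi>) < \<infinity>" by simp
      qed measurable
      show "(\<lambda>j. Lnorm (mu_Phi_n \<Phi>) (ereal q) (\<lambda>x. u (r j) x - g x)) \<longlonglongrightarrow> 0"
      proof (rule LIMSEQ_I)
        fix e :: real assume e: "0 < e"
        then have "0 < (e / 2) powr q" by simp
        then obtain N where N: "\<And>j. j \<ge> N \<Longrightarrow> (\<integral>\<^sup>+x. ennreal (\<bar>u (r j) x - g x\<bar> powr q) \<partial>mu_Phi_n \<Phi>) \<le> ennreal ((e / 2) powr q)"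
          using g(2) by blast
        show "\<exists>N. \<forall>j\<ge>N. norm (Lnorm (mu_Phi_n \<Phi>) (ereal q) (\<lambda>x. u (r j) x - g x) - 0) < e"
        proof (intro exI allI impI)
          fix j assume "j \<ge> N"
          then have "Lnorm (mu_Phi_n \<Phi>) (ereal q) (\<lambda>x. u (r j) x - g x) \<le> e / 2"
            using N q e by (intro Lnorm_le) auto
          moreover have "0 \<le> Lnorm (mu_Phi_n \<Phi>) (ereal q) (\<lambda>x. u (r j) x - g x)" by (rule Lnorm_nonneg[OF adm]) measurable
          ultimately show "norm (Lnorm (mu_Phi_n \<Phi>) (ereal q) (\<lambda>x. u (r j) x - g x) - 0) < e" using e by simp
        qed
      qed
    qed
  qed
qed

lemma superlinear_slope_at_top:
  assumes "((\<lambda>s. s / \<Phi> s) \<longlongrightarrow> 0) at_top"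
  shows "filterlim (\<lambda>s. \<Phi> s / s) at_top at_top"
proof -
  have "eventually (\<lambda>s. 0 < s / \<Phi> s) at_top"
    using eventually_gt_at_top[of 0] by eventually_elim (simp add: Phi_pos[OF adm])
  then have "filterlim (\<lambda>s. inverse (s / \<Phi> s)) at_top at_top"
    by (rule filterlim_inverse_at_top[OF assms])
  then show ?thesis by (simp add: inverse_eq_divide)
qed

text \<open>\<open>R\<close>, and with it \<open>h\<close> and \<open>S\<close>, is chosen from the
  growth of \<Phi>, the bound \<open>K\<close> and \<open>e\<close> alone, so one cube serves all
  functions obeying the bound.\<close>

lemma compact_emb_superlinear:
  fixes p :: ereal and q :: real
  assumes m: "1 \<le> m" and q: "1 \<le> q" "ereal q \<le> p"
    and sup: "((\<lambda>s. s / \<Phi> s) \<longlongrightarrow> 0) at_top"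
  shows "compact_emb \<Phi> TYPE('n::finite) m p (ereal q)"
proof (rule compact_embI[OF m _ q(1) order_refl q(2)])
  show "1 \<le> p" using q by (metis ereal_less_eq(3) one_ereal_def order_trans)
  fix K e :: real assume K: "0 \<le> K" and e: "0 < e"
  define B where "B = 2 * CARD('n) * 2 powr q"
  have B: "0 \<le> B" by (simp add: B_def)
  let ?\<kappa> = "\<lambda>R. \<Phi> R / R"
  have s: "filterlim (\<lambda>R. sqrt (?\<kappa> R)) at_top at_top"
    by (rule filterlim_compose[OF sqrt_at_top superlinear_slope_at_top[OF sup]])
  have "((\<lambda>R. B * (exp (- sqrt (?\<kappa> R)) * K + inverse (sqrt (?\<kappa> R)) powr q * K)) \<longlongrightarrow> B * (0 * K + 0 powr q * K)) at_top"
  proof (intro tendsto_mult tendsto_add tendsto_const)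
    show "((\<lambda>R. exp (- sqrt (?\<kappa> R))) \<longlongrightarrow> 0) at_top"
      by (rule filterlim_compose[OF exp_at_bot]) (rule filterlim_compose[OF filterlim_uminus_at_bot_at_top s])
    show "((\<lambda>R. inverse (sqrt (?\<kappa> R)) powr q) \<longlongrightarrow> 0 powr q) at_top"
    proof (rule tendsto_powr'[OF tendsto_inverse_0_at_top[OF s] tendsto_const])
      have "eventually (\<lambda>R. 0 \<le> inverse (sqrt (?\<kappa> R))) at_top"
        using eventually_gt_at_top[of 0] by eventually_elim (simp add: Phi_nonneg[OF adm])
      then show "(0::real) \<noteq> 0 \<or> 0 < q \<and> eventually (\<lambda>R. 0 \<le> inverse (sqrt (?\<kappa> R))) at_top" using q by simp
    qed
  qed
  then have "((\<lambda>R. B * (exp (- sqrt (?\<kappa> R)) * K + inverse (sqrt (?\<kappa> R)) powr q * K)) \<longlongrightarrow> 0) at_top" by simp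
  then have "eventually (\<lambda>R. B * (exp (- sqrt (?\<kappa> R)) * K + inverse (sqrt (?\<kappa> R)) powr q * K) < e) at_top"
    using e by (rule order_tendstoD)
  then have "eventually (\<lambda>R. B * (exp (- sqrt (?\<kappa> R)) * K + inverse (sqrt (?\<kappa> R)) powr q * K) < e \<and> 0 < R) at_top"
    using eventually_gt_at_top[of 0] by eventually_elim simp
  then obtain R where R: "B * (exp (- sqrt (?\<kappa> R)) * K + inverse (sqrt (?\<kappa> R)) powr q * K) < e" "0 < R"
    by (auto simp: eventually_at_top_linorder)
  define h where "h = inverse (sqrt (?\<kappa> R))"
  have \<kappa>: "0 < ?\<kappa> R" using R Phi_pos[OF adm] by simp
  have h: "0 \<le> h" using \<kappa> by (simp add: h_def)
  have h\<kappa>: "h * ?\<kappa> R = sqrt (?\<kappa> R)"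
  proof -
    have "inverse (sqrt k) * k = sqrt k" if "0 < k" for k :: real
      using real_div_sqrt[of k] that by (simp add: divide_inverse mult.commute)
    from this[OF \<kappa>] show ?thesis by (simp only: h_def)
  qed
  obtain S :: nat where S: "R + h < real S" using reals_Archimedean2 by blast
  show "\<exists>S::nat. \<forall>(v :: real ^ 'n \<Rightarrow> real) G. tgrad v G \<longrightarrow> (\<integral>\<^sup>+x. ennreal (\<bar>v x\<bar> powr q) \<partial>mu_Phi_n \<Phi>) \<le> ennreal K \<longrightarrow> (\<integral>\<^sup>+x. ennreal (G x powr q) \<partial>mu_Phi_n \<Phi>) \<le> ennreal K \<longrightarrow>
        (\<integral>\<^sup>+x. ennreal (\<bar>v x\<bar> powr q) * indicator (- centered_cell (real S)) x \<partial>mu_Phi_n \<Phi>) \<le> ennreal e"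
  proof (intro exI[of _ S] allI impI)
    fix v :: "real ^ 'n \<Rightarrow> real" and G
    assume vG: "tgrad v G" and vK: "(\<integral>\<^sup>+x. ennreal (\<bar>v x\<bar> powr q) \<partial>mu_Phi_n \<Phi>) \<le> ennreal K" and GK: "(\<integral>\<^sup>+x. ennreal (G x powr q) \<partial>mu_Phi_n \<Phi>) \<le> ennreal K"
    have "(\<integral>\<^sup>+x. ennreal (\<bar>v x\<bar> powr q) * indicator (- centered_cell (real S)) x \<partial>mu_Phi_n \<Phi>) \<le> ennreal B * (ennreal (exp (- (h * ?\<kappa> R))) * (\<integral>\<^sup>+x. ennreal (\<bar>v x\<bar> powr q) \<partial>mu_Phi_n \<Phi>)
       + ennreal (h powr q) * (\<integral>\<^sup>+x. ennreal (G x powr q) \<partial>mu_Phi_n \<Phi>))"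
      unfolding B_def by (rule tail_total[OF adm vG q(1) R(2) h S])
    also have "\<dots> \<le> ennreal B * (ennreal (exp (- (h * ?\<kappa> R))) * ennreal K + ennreal (h powr q) * ennreal K)"
      by (intro mult_left_mono add_mono vK GK) auto
    also have "\<dots> = ennreal (B * (exp (- sqrt (?\<kappa> R)) * K + h powr q * K))"
      unfolding h\<kappa> using B K by (simp flip: ennreal_plus ennreal_mult)
    also have "\<dots> \<le> ennreal e" using R(1) unfolding h_def by (intro ennreal_leI) simp
    finally show "(\<integral>\<^sup>+x. ennreal (\<bar>v x\<bar> powr q) * indicator (- centered_cell (real S)) x \<partial>mu_Phi_n \<Phi>) \<le> ennreal e" .
  qed
qed

lemma mu_tail_small:
  fixes e :: real
  assumes "0 < e"
  shows "\<exists>S::nat. emeasure (mu_Phi_n \<Phi> :: (real ^ 'n::finite) measure) (- centered_cell (real S)) \<le> ennreal e"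
proof -
  let ?M = "mu_Phi_n \<Phi> :: (real ^ 'n) measure"
  let ?A = "\<lambda>S::nat. - centered_cell (real S) :: (real ^ 'n) set"
  have "(\<lambda>S. emeasure ?M (?A S)) \<longlonglongrightarrow> emeasure ?M (\<Inter>S. ?A S)"
  proof (rule Lim_emeasure_decseq)
    show "range ?A \<subseteq> sets ?M" using cell_borel by (auto simp: sets_mu[OF adm])
    show "decseq ?A" unfolding decseq_def
    proof (intro allI impI)
      fix k l :: nat assume "k \<le> l"
      then have kl: "real k \<le> real l" by simp
      have "centered_cell (real k) \<subseteq> (centered_cell (real l) :: (real ^ 'n) set)"
      proof
        fix x :: "real ^ 'n" assume x: "x \<in> centered_cell (real k)"
        show "x \<in> centered_cell (real l)" unfolding mem_centered_cell
        proof
          fix i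
          have "- real k \<le> x $ i \<and> x $ i < real k" using x unfolding mem_centered_cell by blast
          then show "- real l \<le> x $ i \<and> x $ i < real l" using kl by linarith
        qed
      qed
      then show "?A l \<subseteq> ?A k" by blast
    qed
    fix S
    have "emeasure ?M (?A S) \<le> emeasure ?M UNIV" by (rule emeasure_mono) (auto simp: sets_mu[OF adm])
    then show "emeasure ?M (?A S) \<noteq> \<infinity>" by (auto simp: emeasure_mu[OF adm] top_unique)
  qed
  moreover have "(\<Inter>S. ?A S) = {}"
  proof -
    have "\<exists>S::nat. x \<in> centered_cell (real S)" for x :: "real ^ 'n"
    proof -
      obtain S :: nat where S: "norm x < real S" using reals_Archimedean2 by blast
      have "- real S \<le> x $ i \<and> x $ i < real S" for i
        using component_le_norm_cart[of x i] S by linarith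
      then show ?thesis by (auto simp: mem_centered_cell)
    qed
    then show ?thesis by auto
  qed
  ultimately have "(\<lambda>S. emeasure ?M (?A S)) \<longlonglongrightarrow> 0" by simp
  then have "eventually (\<lambda>S. emeasure ?M (?A S) < ennreal e) sequentially"
    using assms by (intro order_tendstoD) auto
  then show ?thesis by (auto simp: eventually_sequentially intro: less_imp_le)
qed

text \<open>The function is split at a level \<open>t\<close>. Where it is larger, its q-th power is
  at most \<open>t powr (q - q')\<close> times its q'-th power, whose integral is bounded; where it
  is smaller, the integral over the tail is at most \<open>t powr q\<close> times the mass of the
  tail.\<close>

lemma compact_emb_subcritical:
  fixes p :: ereal and q q' :: real
  assumes m: "1 \<le> m" and q: "1 \<le> q" "q < q'" "ereal q' \<le> p"
  shows "compact_emb \<Phi> TYPE('n::finite) m p (ereal q)"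
proof (rule compact_embI[OF m _ q(1) less_imp_le[OF q(2)] q(3)])
  note [measurable_cong] = sets_mu[OF adm]
  have "1 \<le> q'" using q by simp
  then show "1 \<le> p" using q by (metis ereal_less_eq(3) one_ereal_def order_trans)
  fix K e :: real assume K: "0 \<le> K" and e: "0 < e"
  have "((\<lambda>t. t powr (q - q') * K) \<longlongrightarrow> 0 * K) at_top"
    using q by (intro tendsto_mult tendsto_const tendsto_neg_powr filterlim_ident) auto
  then have "eventually (\<lambda>t. t powr (q - q') * K < e / 2) at_top"
    using e by (intro order_tendstoD) auto
  then have "eventually (\<lambda>t. t powr (q - q') * K < e / 2 \<and> 0 < t) at_top"
    using eventually_gt_at_top[of 0] by eventually_elim simp
  \<comment> \<open>The level is fixed by the bounded moment first; the cube follows, since the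
    admissible mass of its complement depends on \<open>t\<close>.\<close>
  then obtain t where t: "t powr (q - q') * K < e / 2" "0 < t" by (auto simp: eventually_at_top_linorder)
  obtain S :: nat where S: "emeasure (mu_Phi_n \<Phi> :: (real ^ 'n) measure) (- centered_cell (real S)) \<le> ennreal (e / 2 / t powr q)"
    using mu_tail_small[of "e / 2 / t powr q"] e t by auto
  show "\<exists>S::nat. \<forall>(v :: real ^ 'n \<Rightarrow> real) G. tgrad v G \<longrightarrow> (\<integral>\<^sup>+x. ennreal (\<bar>v x\<bar> powr q') \<partial>mu_Phi_n \<Phi>) \<le> ennreal K \<longrightarrow> (\<integral>\<^sup>+x. ennreal (G x powr q') \<partial>mu_Phi_n \<Phi>) \<le> ennreal K \<longrightarrow>
        (\<integral>\<^sup>+x. ennreal (\<bar>v x\<bar> powr q) * indicator (- centered_cell (real S)) x \<partial>mu_Phi_n \<Phi>) \<le> ennreal e"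
  proof (intro exI[of _ S] allI impI)
    fix v :: "real ^ 'n \<Rightarrow> real" and G
    assume vG: "tgrad v G" and vK: "(\<integral>\<^sup>+x. ennreal (\<bar>v x\<bar> powr q') \<partial>mu_Phi_n \<Phi>) \<le> ennreal K"
    note [measurable] = tgrad_borel(1)[OF vG]
    have "(\<integral>\<^sup>+x. ennreal (\<bar>v x\<bar> powr q) * indicator (- centered_cell (real S)) x \<partial>mu_Phi_n \<Phi>) \<le>
      (\<integral>\<^sup>+x. ennreal (t powr (q - q')) * ennreal (\<bar>v x\<bar> powr q') + ennreal (t powr q) * indicator (- centered_cell (real S)) x \<partial>mu_Phi_n \<Phi>)"
    proof (intro nn_integral_mono)
      fix x
      have *: "\<bar>v x\<bar> powr q \<le> t powr (q - q') * \<bar>v x\<bar> powr q' + t powr q"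
      proof (cases "\<bar>v x\<bar> \<le> t")
        case True
        then have "\<bar>v x\<bar> powr q \<le> t powr q" using q by (intro powr_mono2) auto
        then show ?thesis by (simp add: add_increasing)
      next
        case False
        then have "\<bar>v x\<bar> powr (q - q') \<le> t powr (q - q')" using q t by (intro powr_mono2') auto
        then have "\<bar>v x\<bar> powr (q - q') * \<bar>v x\<bar> powr q' \<le> t powr (q - q') * \<bar>v x\<bar> powr q'" by (rule mult_right_mono) simp
        moreover have "\<bar>v x\<bar> powr (q - q') * \<bar>v x\<bar> powr q' = \<bar>v x\<bar> powr q" using powr_add[of "\<bar>v x\<bar>" "q - q'" q'] by simp
        ultimately show ?thesis by (smt (verit) powr_ge_zero)
      qed
      show "ennreal (\<bar>v x\<bar> powr q) * indicator (- centered_cell (real S)) x \<le> ennreal (t powr (q - q')) * ennreal (\<bar>v x\<bar> powr q') + ennreal (t powr q) * indicator (- centered_cell (real S)) x"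
      proof (cases "x \<in> centered_cell (real S)")
        case False
        have "ennreal (\<bar>v x\<bar> powr q) \<le> ennreal (t powr (q - q') * \<bar>v x\<bar> powr q' + t powr q)" by (rule ennreal_leI[OF *])
        then show ?thesis using False by (simp add: ennreal_mult)
      qed simp
    qed
    also have "\<dots> = ennreal (t powr (q - q')) * (\<integral>\<^sup>+x. ennreal (\<bar>v x\<bar> powr q') \<partial>mu_Phi_n \<Phi>) + ennreal (t powr q) * emeasure (mu_Phi_n \<Phi> :: (real ^ 'n) measure) (- centered_cell (real S))"
      by (subst nn_integral_add) (auto simp: nn_integral_cmult nn_integral_cmult_indicator sets_mu[OF adm])
    also have "\<dots> \<le> ennreal (t powr (q - q')) * ennreal K + ennreal (t powr q) * ennreal (e / 2 / t powr q)"
      by (intro add_mono mult_left_mono vK S) auto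
    also have "\<dots> = ennreal (t powr (q - q') * K + e / 2)"
      using K t e by (simp flip: ennreal_plus ennreal_mult)
    also have "\<dots> \<le> ennreal e" using t by (intro ennreal_leI) simp
    finally show "(\<integral>\<^sup>+x. ennreal (\<bar>v x\<bar> powr q) * indicator (- centered_cell (real S)) x \<partial>mu_Phi_n \<Phi>) \<le> ennreal e" .
  qed
qed

end

section \<open>Failure of compactness\<close>

lemma test_fun_line_deriv:
  assumes "test_fun \<psi>"
  shows "((\<lambda>t. \<psi> (x + t *\<^sub>R axis i 1)) has_real_derivative pdiff i \<psi> (x + t *\<^sub>R axis i 1)) (at t)"
proof -
  have "(\<lambda>s. ipdiff [] \<psi> ((x + t *\<^sub>R axis i 1) + s *\<^sub>R axis i 1)) differentiable (at 0)"
    using assms unfolding test_fun_def smooth_fun_def by blast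
  then have "(\<lambda>s. \<psi> ((x + t *\<^sub>R axis i 1) + s *\<^sub>R axis i 1)) differentiable (at 0)" by simp
  then obtain d where d: "((\<lambda>s. \<psi> ((x + t *\<^sub>R axis i 1) + s *\<^sub>R axis i 1)) has_real_derivative d) (at 0)"
    by (auto simp: real_differentiable_def)
  then have "pdiff i \<psi> (x + t *\<^sub>R axis i 1) = d" unfolding pdiff_def by (rule DERIV_imp_deriv)
  with d have "((\<lambda>s. \<psi> (x + (s + t) *\<^sub>R axis i 1)) has_real_derivative pdiff i \<psi> (x + t *\<^sub>R axis i 1)) (at 0)"
    by (simp add: scaleR_left_distrib add_ac)
  then show ?thesis using DERIV_shift[of "\<lambda>t. \<psi> (x + t *\<^sub>R axis i 1)" "pdiff i \<psi> (x + t *\<^sub>R axis i 1)" 0 t] by simp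
qed

lemma coord_continuous:
  fixes f :: "real \<Rightarrow> real"
  assumes "continuous_on UNIV f" shows "continuous_on UNIV (\<lambda>x :: real ^ 'n::finite. f (x $ i))"
  by (rule continuous_on_compose2[OF assms]) (auto intro!: continuous_intros)

lemma coord_loc_integrable:
  fixes f :: "real \<Rightarrow> real"
  assumes "continuous_on UNIV f" shows "loc_integrable (\<lambda>x :: real ^ 'n::finite. f (x $ i))"
  unfolding loc_integrable_def
proof (intro conjI allI impI)
  note c = coord_continuous[OF assms, of i]
  show "(\<lambda>x :: real ^ 'n. f (x $ i)) \<in> borel_measurable lborel" using borel_measurable_continuous_onI[OF c] by simp
  fix K :: "(real ^ 'n) set" assume "compact K"
  then show "set_integrable lborel K (\<lambda>x. f (x $ i))"
    unfolding set_integrable_def by (rule borel_integrable_compact) (rule continuous_on_subset[OF c], simp)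
qed

text \<open>The product of \<open>f\<close> and \<psi> has compact support, so translating it by a
  unit vector leaves its integral unchanged. The resulting increment of integral 0 is the integral
  along the segment of the partial derivative \<open>h\<close>; after Fubini every slice has the
  same integral, which must be 0.\<close>

lemma coord_integration_by_parts:
  fixes \<psi> :: "real ^ 'n::finite \<Rightarrow> real"
  assumes f: "smooth1 f" and \<psi>: "test_fun \<psi>"
  shows "(\<integral>x. f (x $ i0) * pdiff i \<psi> x \<partial>lborel) = - (\<integral>x. (if i = i0 then deriv f (x $ i0) else 0) * \<psi> x \<partial>lborel)"
proof -
  define g where "g x = (if i = i0 then deriv f (x $ i0) else 0)" for x :: "real ^ 'n"
  define h where "h x = g x * \<psi> x + f (x $ i0) * pdiff i \<psi> x" for x
  have cf: "continuous_on UNIV f" "continuous_on UNIV (deriv f)"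
    using smooth1_continuous[OF f, of 0] smooth1_continuous[OF f, of 1] by auto
  have cg: "continuous_on UNIV g" unfolding g_def using coord_continuous[OF cf(2)] by (cases "i = i0") auto
  have ch: "continuous_on UNIV h" unfolding h_def
    by (intro continuous_intros cg coord_continuous[OF cf(1)] test_fun_continuous \<psi> test_fun_pdiff)
  have [measurable]: "h \<in> borel_measurable borel" by (rule borel_measurable_continuous_onI[OF ch])
  note [measurable] = test_fun_borel[OF \<psi>] test_fun_borel[OF test_fun_pdiff[OF \<psi>]]
  have lg: "loc_integrable g" unfolding g_def using coord_loc_integrable[OF cf(2)] coord_loc_integrable[of "\<lambda>_. 0"] by (cases "i = i0") auto
  have lf: "loc_integrable (\<lambda>x :: real ^ 'n. f (x $ i0))" by (rule coord_loc_integrable[OF cf(1)])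
  obtain B r where Br: "\<And>x. \<bar>\<psi> x\<bar> \<le> B" "\<And>x. \<psi> x \<noteq> 0 \<Longrightarrow> norm x \<le> r" using test_fun_bounded[OF \<psi>] by metis
  obtain B' r' where Br': "\<And>x. \<bar>pdiff i \<psi> x\<bar> \<le> B'" "\<And>x. pdiff i \<psi> x \<noteq> 0 \<Longrightarrow> norm x \<le> r'" using test_fun_bounded[OF test_fun_pdiff[OF \<psi>, of i]] by metis
  have i1: "integrable lborel (\<lambda>x. g x * \<psi> x)" by (rule loc_integrable_bounded[OF lg _ Br]) simp
  have i2: "integrable lborel (\<lambda>x. f (x $ i0) * pdiff i \<psi> x)" by (rule loc_integrable_bounded[OF lf _ Br']) simp
  have ih: "integrable lborel h" unfolding h_def using i1 i2 by simp
  have fu: "integrable lborel (\<lambda>x. f (x $ i0) * \<psi> x)" by (rule loc_integrable_bounded[OF lf _ Br]) simp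
  let ?e = "axis i 1 :: real ^ 'n"
  have d: "((\<lambda>t. f ((x + t *\<^sub>R ?e) $ i0) * \<psi> (x + t *\<^sub>R ?e)) has_real_derivative h (x + t *\<^sub>R ?e)) (at t)" for x t
  proof -
    have "((\<lambda>t. f ((x + t *\<^sub>R ?e) $ i0)) has_real_derivative g (x + t *\<^sub>R ?e)) (at t)"
    proof (cases "i = i0")
      case True
      have "(f has_real_derivative deriv f ((x + t *\<^sub>R ?e) $ i0)) (at ((x + t *\<^sub>R ?e) $ i0))"
        using smooth1_deriv[OF f, where k=0] by simp
      moreover have "((\<lambda>t. (x + t *\<^sub>R ?e) $ i0) has_real_derivative 1) (at t)"
        using True by (auto intro!: derivative_eq_intros simp: axis_def)
      ultimately have "((\<lambda>t. f ((x + t *\<^sub>R ?e) $ i0)) has_real_derivative deriv f ((x + t *\<^sub>R ?e) $ i0) * 1) (at t)"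
        by (rule DERIV_chain2)
      then show ?thesis using True by (simp add: g_def)
    next
      case False
      then show ?thesis by (simp add: g_def axis_def)
    qed
    from DERIV_mult[OF this test_fun_line_deriv[OF \<psi>]] show ?thesis by (simp add: h_def mult.commute add.commute)
  qed
  have ftc: "(\<integral>t. indicator {0..1} t * h (x + t *\<^sub>R ?e) \<partial>lborel) = f ((x + ?e) $ i0) * \<psi> (x + ?e) - f (x $ i0) * \<psi> x" for x
  proof -
    have c: "continuous_on UNIV (\<lambda>t. h (x + t *\<^sub>R ?e))"
      by (rule continuous_on_compose2[OF ch]) (auto intro!: continuous_intros)
    have "(\<integral>t. h (x + t *\<^sub>R ?e) * indicator {0..1} t \<partial>lborel) = f ((x + 1 *\<^sub>R ?e) $ i0) * \<psi> (x + 1 *\<^sub>R ?e) - f ((x + 0 *\<^sub>R ?e) $ i0) * \<psi> (x + 0 *\<^sub>R ?e)"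
      using c by (intro integral_FTC_Icc_real d) (auto simp: continuous_on_eq_continuous_at)
    then show ?thesis by (simp add: mult.commute)
  qed
  have pair: "integrable (lborel \<Otimes>\<^sub>M lborel) (\<lambda>(x, t). indicator {0..1} t * h (x + t *\<^sub>R ?e))"
  proof -
    have "integrable (lborel \<Otimes>\<^sub>M lborel) (\<lambda>(x, t). indicator {0..1} t * (\<lambda>(x, t). h (x + t *\<^sub>R ?e)) (x, t))"
    proof (rule integrable_unit_interval_pair[where C="\<integral>x. \<bar>h x\<bar> \<partial>lborel"])
      fix t :: real
      have "(\<integral>\<^sup>+x. ennreal \<bar>h (x + t *\<^sub>R ?e)\<bar> \<partial>lborel) = (\<integral>\<^sup>+x. ennreal \<bar>h x\<bar> \<partial>lborel)"
        by (rule nn_integral_lborel_shift) measurable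
      also have "\<dots> = ennreal (\<integral>x. \<bar>h x\<bar> \<partial>lborel)" using ih by (intro nn_integral_eq_integral) auto
      finally show "(\<integral>\<^sup>+x. ennreal \<bar>case (x, t) of (x, t) \<Rightarrow> h (x + t *\<^sub>R ?e)\<bar> \<partial>lborel) \<le> ennreal (\<integral>x. \<bar>h x\<bar> \<partial>lborel)" by simp
    qed measurable
    then show ?thesis by simp
  qed
  have "0 = (\<integral>x. f ((x + ?e) $ i0) * \<psi> (x + ?e) - f (x $ i0) * \<psi> x \<partial>lborel)"
    using integral_lborel_shift[of "\<lambda>x. f (x $ i0) * \<psi> x" ?e] fu integrable_lborel_shift[OF fu, of ?e]
    by (subst Bochner_Integration.integral_diff) auto
  also have "\<dots> = (\<integral>x. (\<integral>t. indicator {0..1} t * h (x + t *\<^sub>R ?e) \<partial>lborel) \<partial>lborel)" by (simp only: ftc)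
  also have "\<dots> = (\<integral>t. (\<integral>x. indicator {0..1} t * h (x + t *\<^sub>R ?e) \<partial>lborel) \<partial>lborel)"
    by (rule lborel_pair.Fubini_integral[OF pair, symmetric])
  also have "\<dots> = (\<integral>t. indicator {0..1::real} t * (\<integral>x. h x \<partial>lborel) \<partial>lborel)"
    by (simp add: integral_lborel_shift[of h])
  also have "\<dots> = (\<integral>x. h x \<partial>lborel)" by simp
  also have "\<dots> = (\<integral>x. g x * \<psi> x \<partial>lborel) + (\<integral>x. f (x $ i0) * pdiff i \<psi> x \<partial>lborel)"
    unfolding h_def using i1 i2 by simp
  finally show ?thesis by (simp add: g_def)
qed

text \<open>The full family of derivatives is written down explicitly: a multi-index containing any
  coordinate other than \<open>i0\<close> gives 0.\<close>

definition coord_derivs :: "'n::finite \<Rightarrow> (real \<Rightarrow> real) \<Rightarrow> 'n list \<Rightarrow> real ^ 'n \<Rightarrow> real" where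
  "coord_derivs i0 f is x = (if set is \<subseteq> {i0} then (deriv ^^ length is) f (x $ i0) else 0)"

text \<open>The outermost derivative of the test function is moved onto \<open>f\<close>, which
  becomes \<open>deriv f\<close>; hence \<open>f\<close> is generalised in the induction on the
  multi-index.\<close>

lemma weak_derivs_coord:
  fixes i0 :: "'n::finite"
  assumes f: "smooth1 f"
  shows "weak_derivs m (\<lambda>x. f (x $ i0)) (coord_derivs i0 f)"
  unfolding weak_derivs_def
proof (intro conjI allI impI)
  show "coord_derivs i0 f [] = (\<lambda>x. f (x $ i0))" by (simp add: coord_derivs_def fun_eq_iff)
  fix "is" :: "'n list"
  show "loc_integrable (coord_derivs i0 f is)"
    using coord_loc_integrable[OF smooth1_continuous[OF f]] coord_loc_integrable[of "\<lambda>_. 0"]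
    unfolding coord_derivs_def by (cases "set is \<subseteq> {i0}") auto
  fix \<phi> :: "real ^ 'n \<Rightarrow> real" assume \<phi>: "test_fun \<phi>"
  show "(\<integral>x. f (x $ i0) * ipdiff is \<phi> x \<partial>lborel) = (-1) ^ length is * (\<integral>x. coord_derivs i0 f is x * \<phi> x \<partial>lborel)"
    using f
  proof (induction "is" arbitrary: f)
    case Nil
    then show ?case by (simp add: coord_derivs_def)
  next
    case (Cons i "is")
    have "(\<integral>x. f (x $ i0) * ipdiff (i # is) \<phi> x \<partial>lborel) = - (\<integral>x. (if i = i0 then deriv f (x $ i0) else 0) * ipdiff is \<phi> x \<partial>lborel)"
      using coord_integration_by_parts[OF Cons.prems test_fun_ipdiff[OF \<phi>]] by simp
    also have "\<dots> = (-1) ^ length (i # is) * (\<integral>x. coord_derivs i0 f (i # is) x * \<phi> x \<partial>lborel)"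
    proof (cases "i = i0")
      case True
      have "coord_derivs i0 (deriv f) is x = coord_derivs i0 f (i # is) x" for x
        using True by (simp add: coord_derivs_def funpow_swap1)
      then show ?thesis using True Cons.IH[OF smooth1_derivI[OF Cons.prems]] by simp
    next
      case False
      then show ?thesis by (simp add: coord_derivs_def)
    qed
    finally show ?case .
  qed
qed

lemma grad_norm_coord:
  fixes i0 :: "'n::finite"
  shows "grad_norm (coord_derivs i0 f) k x = \<bar>(deriv ^^ k) f (x $ i0)\<bar>"
proof -
  \<comment> \<open>Among the lists of length \<open>k\<close> only the constant one
    survives.\<close>
  have "(\<Sum>is\<in>{is. length is = k}. (coord_derivs i0 f is x)\<^sup>2) = (\<Sum>is\<in>{replicate k i0}. (coord_derivs i0 f is x)\<^sup>2)"
  proof (rule sum.mono_neutral_right)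
    show "finite {is :: 'n list. length is = k}" by (rule finite_lists_length)
    show "\<forall>is\<in>{is. length is = k} - {replicate k i0}. (coord_derivs i0 f is x)\<^sup>2 = 0"
    proof
      fix "is" assume "is \<in> {is. length is = k} - {replicate k i0}"
      then have "length is = k" "is \<noteq> replicate k i0" by auto
      then have "\<not> set is \<subseteq> {i0}" using replicate_eqI[of "is" k i0] by auto
      then show "(coord_derivs i0 f is x)\<^sup>2 = 0" by (simp add: coord_derivs_def)
    qed
  qed simp
  also have "\<dots> = ((deriv ^^ k) f (x $ i0))\<^sup>2" by (cases "k = 0") (auto simp: coord_derivs_def)
  finally show ?thesis by (simp add: grad_norm_def)
qed

section \<open>A monomial excludes the exponent \<infinity> on the target side\<close>

context
  fixes \<Phi> :: "real \<Rightarrow> real"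
  assumes adm: "admissible_Phi \<Phi>"
begin

text \<open>For the m-th power of a coordinate the gradient of order \<open>m\<close> is constant,
  hence in L^p even for p = \<infinity>, and the lower ones have finite moments; yet the function is
  essentially unbounded. So the inclusion itself fails, before any question of compactness.\<close>

lemma not_compact_emb_infinity:
  assumes m: "1 \<le> m" and p: "1 \<le> p"
  shows "\<not> compact_emb \<Phi> TYPE('n::finite) m p \<infinity>"
proof
  note [measurable_cong] = sets_mu[OF adm]
  assume c: "compact_emb \<Phi> TYPE('n) m p \<infinity>"
  obtain i0 :: 'n where True by simp
  define F where "F k t = (if k \<le> m then fact m / fact (m - k) * t ^ (m - k) else 0)" for k and t :: real
  let ?f = "\<lambda>t :: real. t ^ m"
  have F0: "F 0 = ?f" by (simp add: F_def fun_eq_iff)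
  have dF: "(F k has_real_derivative F (Suc k) t) (at t)" for k t
  proof -
    consider "k < m" | "k = m" | "k > m" by linarith
    then show ?thesis
    proof cases
      case 1
      then have s: "m - k = Suc (m - Suc k)" by simp
      have "((\<lambda>t. fact m / fact (m - k) * t ^ (m - k)) has_real_derivative fact m / fact (m - k) * (real (m - k) * t ^ (m - k - 1))) (at t)"
        by (auto intro!: derivative_eq_intros)
      moreover have "fact m / fact (m - k) * (real (m - k) * t ^ (m - k - 1)) = F (Suc k) t"
        using 1 unfolding F_def s by (simp add: fact_Suc field_simps del: of_nat_Suc)
      moreover have "F k = (\<lambda>t. fact m / fact (m - k) * t ^ (m - k))" using 1 by (simp add: F_def fun_eq_iff)
      ultimately show ?thesis by simp
    next
      case 2
      then have "F k = (\<lambda>t. fact m)" "F (Suc k) t = 0" by (auto simp: F_def fun_eq_iff)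
      then show ?thesis by simp
    next
      case 3
      then have "F k = (\<lambda>t. 0)" "F (Suc k) t = 0" by (auto simp: F_def fun_eq_iff)
      then show ?thesis by simp
    qed
  qed
  have sm: "smooth1 ?f" and dk: "(deriv ^^ k) ?f = F k" for k
    using smooth1I[of F, OF F0 dF] smooth1_eq[of F, OF F0 dF] by auto
  let ?u = "\<lambda>x :: real ^ 'n. ?f (x $ i0)"
  have b[measurable]: "grad_norm (coord_derivs i0 ?f) k \<in> borel_measurable borel" for k
  proof -
    have "F k \<in> borel_measurable borel" unfolding F_def by measurable
    then have "(\<lambda>x :: real ^ 'n. \<bar>F k (x $ i0)\<bar>) \<in> borel_measurable borel" by measurable
    then show ?thesis unfolding grad_norm_coord dk by simp
  qed
  have "in_VmLp \<Phi> m p ?u (coord_derivs i0 ?f)"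
    unfolding in_VmLp_def
  proof (intro conjI allI impI)
    show "weak_derivs m ?u (coord_derivs i0 ?f)" by (rule weak_derivs_coord[OF sm])
    show "memLp (mu_Phi_n \<Phi>) 1 (grad_norm (coord_derivs i0 ?f) k)" if k: "k < m" for k
      unfolding one_ereal_def
    proof (rule memLp_finiteI[OF adm b])
      have "(\<integral>\<^sup>+x. ennreal (\<bar>grad_norm (coord_derivs i0 ?f) k x\<bar> powr 1) \<partial>mu_Phi_n \<Phi>) = (\<integral>\<^sup>+x. ennreal (fact m / fact (m - k) * \<bar>x $ i0\<bar> ^ (m - k)) \<partial>mu_Phi_n \<Phi>)"
        unfolding grad_norm_coord dk using k by (simp add: F_def abs_mult power_abs)
      also have "\<dots> = (\<integral>\<^sup>+t. ennreal (c_Phi \<Phi> * exp (- \<Phi> \<bar>t\<bar>)) * ennreal (fact m / fact (m - k) * \<bar>t\<bar> ^ (m - k)) \<partial>lborel)"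
        by (rule nn_integral_mu_coord[OF adm]) measurable
      also have "\<dots> = (\<integral>\<^sup>+t. ennreal (c_Phi \<Phi> * (fact m / fact (m - k))) * ennreal (\<bar>t\<bar> ^ (m - k) * exp (- \<Phi> \<bar>t\<bar>)) \<partial>lborel)"
        using c_Phi_pos[OF adm] by (intro nn_integral_cong) (simp add: mult_ac flip: ennreal_mult)
      also have "\<dots> = ennreal (c_Phi \<Phi> * (fact m / fact (m - k))) * (\<integral>\<^sup>+t. ennreal (\<bar>t\<bar> ^ (m - k) * exp (- \<Phi> \<bar>t\<bar>)) \<partial>lborel)"
      proof (rule nn_integral_cmult)
        have "(\<lambda>t. exp (- \<Phi> \<bar>t\<bar>)) \<in> borel_measurable borel" 
          by (rule measurable_compose[OF borel_measurable_uminus[OF Phi_borel[OF adm]] borel_measurable_exp])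
        then have "(\<lambda>t. \<bar>t\<bar> ^ (m - k) * exp (- \<Phi> \<bar>t\<bar>)) \<in> borel_measurable borel" by (intro borel_measurable_times borel_measurable_power) auto
        then show "(\<lambda>t. ennreal (\<bar>t\<bar> ^ (m - k) * exp (- \<Phi> \<bar>t\<bar>))) \<in> borel_measurable lborel" by simp
      qed
      also have "\<dots> < \<infinity>" using moment_finite[OF adm, of "m - k"] by (simp add: ennreal_mult_less_top)
      finally show "(\<integral>\<^sup>+x. ennreal (\<bar>grad_norm (coord_derivs i0 ?f) k x\<bar> powr 1) \<partial>mu_Phi_n \<Phi>) < \<infinity>" .
    qed
    have gm: "grad_norm (coord_derivs i0 ?f) m = (\<lambda>x :: real ^ 'n. fact m)"
      unfolding grad_norm_coord dk fun_eq_iff by (simp add: F_def)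
    show "memLp (mu_Phi_n \<Phi>) p (grad_norm (coord_derivs i0 ?f) m)"
    proof (cases p)
      case (real r)
      show ?thesis unfolding real
        by (rule memLp_finiteI[OF adm b]) (simp add: gm space_mu[OF adm] emeasure_mu[OF adm])
    next
      case PInf
      have "esssup (mu_Phi_n \<Phi> :: (real ^ 'n) measure) (\<lambda>x. ereal (fact m)) = ereal (fact m)"
        by (rule esssup_const) (simp add: space_mu[OF adm] emeasure_mu[OF adm])
      then show ?thesis unfolding PInf gm memLp_def by simp
    next
      case MInf
      then show ?thesis using p by simp
    qed
  qed
  then have "memLp (mu_Phi_n \<Phi>) \<infinity> ?u" using c unfolding compact_emb_def by blast
  then have fin: "esssup (mu_Phi_n \<Phi>) (\<lambda>x. ereal \<bar>?u x\<bar>) < \<infinity>" by (simp add: memLp_def)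
  have ub: "?u \<in> borel_measurable borel" by measurable
  obtain C where C: "esssup (mu_Phi_n \<Phi>) (\<lambda>x. ereal \<bar>?u x\<bar>) = ereal C"
    using fin esssup_abs_nonneg[OF adm ub] by (cases "esssup (mu_Phi_n \<Phi>) (\<lambda>x. ereal \<bar>?u x\<bar>)") auto
  have "AE x in mu_Phi_n \<Phi>. ereal \<bar>?u x\<bar> \<le> ereal C" unfolding C[symmetric] by (rule esssup_AE)
  then have "AE x in lborel. ereal \<bar>?u x\<bar> \<le> ereal C" unfolding AE_mu[OF adm] .
  \<comment> \<open>On this unit cube the coordinate is at least \<open>\<bar>C\<bar> + 1\<close>,
    and so is its m-th power; the cube would have to be a null set, but its volume is 1.\<close>
  then have ae: "AE x in lborel. x \<notin> cell (\<chi> i::'n. \<bar>C\<bar> + 1) 1"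
  proof eventually_elim
    case (elim x)
    show ?case
    proof
      assume "x \<in> cell (\<chi> i::'n. \<bar>C\<bar> + 1) 1"
      then have x: "\<bar>C\<bar> + 1 \<le> x $ i0" by (simp add: cell_def)
      then have "x $ i0 ^ 1 \<le> x $ i0 ^ m" using m by (intro power_increasing) auto
      then show False using elim x by (auto simp: abs_le_iff)
    qed
  qed
  have "emeasure lborel (cell (\<chi> i::'n. \<bar>C\<bar> + 1) 1) = 0"
    using ae cell_borel[of "\<chi> i::'n. \<bar>C\<bar> + 1" 1] by (subst (asm) AE_iff_measurable[OF _ refl]) auto
  then show False by (simp add: emeasure_cell)
qed

end

section \<open>Bumps escaping to infinity\<close>

lemma bump_deriv_support:
  assumes "\<not> (-1 \<le> t \<and> t \<le> 1)" shows "(deriv ^^ l) (bump 1 (-1) 1) t = 0"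
  using assms
proof (induction l arbitrary: t)
  case 0
  then have "bump 1 (-1) 1 t = 0" by (intro bump_outside) auto
  then show ?case by simp
next
  case (Suc l)
  have "((\<lambda>x. 0) has_real_derivative 0) (at t)" by simp
  then have "((deriv ^^ l) (bump 1 (-1) 1) has_real_derivative 0) (at t)"
    by (rule has_field_derivative_transform_within_open[where S="- {-1..1}"]) (use Suc in auto)
  then show ?case by (simp add: DERIV_imp_deriv)
qed

lemma bump_derivs_bounded:
  obtains B where "0 \<le> B" "\<And>l t. l \<le> m \<Longrightarrow> \<bar>(deriv ^^ l) (bump 1 (-1) 1) t\<bar> \<le> B"
proof -
  have "\<exists>B. \<forall>t. \<bar>(deriv ^^ l) (bump 1 (-1) 1) t\<bar> \<le> B \<and> 0 \<le> B" for l
  proof -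
    have "compact ((deriv ^^ l) (bump 1 (-1) 1) ` {-1..1})"
      by (intro compact_continuous_image continuous_on_subset[OF smooth1_continuous[OF bump_smooth]]) auto
    then obtain B where B: "\<And>y. y \<in> (deriv ^^ l) (bump 1 (-1) 1) ` {-1..1} \<Longrightarrow> norm y \<le> B"
      using compact_imp_bounded bounded_iff by metis
    have B0: "0 \<le> B" using B[of "(deriv ^^ l) (bump 1 (-1) 1) 0"] by (force intro: order_trans[OF norm_ge_zero])
    show ?thesis
    proof (intro exI allI conjI)
      fix t
      show "\<bar>(deriv ^^ l) (bump 1 (-1) 1) t\<bar> \<le> B"
        using B[of "(deriv ^^ l) (bump 1 (-1) 1) t"] bump_deriv_support[of t l] B0
        by (cases "-1 \<le> t \<and> t \<le> 1") auto
    qed (rule B0)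
  qed
  then obtain F where F: "\<And>l t. \<bar>(deriv ^^ l) (bump 1 (-1) 1) t\<bar> \<le> F l" "\<And>l. 0 \<le> F l" by metis
  show thesis
  proof (rule that[of "\<Sum>l\<le>m. F l"])
    show "0 \<le> (\<Sum>l\<le>m. F l)" using F by (intro sum_nonneg) auto
    fix l t assume "l \<le> m"
    then have "F l \<le> (\<Sum>l\<le>m. F l)" using F by (intro member_le_sum) auto
    then show "\<bar>(deriv ^^ l) (bump 1 (-1) 1) t\<bar> \<le> (\<Sum>l\<le>m. F l)" using F(1)[of l t] by linarith
  qed
qed

lemma bump_lower:
  assumes "\<bar>t\<bar> \<le> 1/2" shows "exp (- 4) \<le> bump 1 (-1) 1 t"
proof -
  have b: "exp (- 2) \<le> bump0 y" if "y \<ge> 1/2" for y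
    using that by (auto simp: bump0_def field_simps)
  have "exp (- 2) * exp (- 2) \<le> bump0 (t + 1) * bump0 (1 - t)"
    using assms by (intro mult_mono b) (auto simp: bump0_bounds abs_le_iff)
  moreover have "exp (- 2) * exp (- 2) = exp (- 4 :: real)" unfolding exp_add[symmetric] by simp
  ultimately show ?thesis by (simp add: bump_def)
qed

context
  fixes \<Phi> :: "real \<Rightarrow> real"
  assumes adm: "admissible_Phi \<Phi>"
begin

text \<open>The height is the p-th root of exp(\<Phi>(s-1)), the reciprocal of the largest value of
  exp(-\<Phi>) on the support [s-1, s+1]; this keeps the L^p norms bounded as \<open>s\<close>
  grows.\<close>

definition spike :: "real \<Rightarrow> real \<Rightarrow> real \<Rightarrow> real" where
  "spike p s t = exp (\<Phi> (s - 1) / p) * bump 1 (-1) 1 (t - s)"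

lemma spike_derivs:
  shows spike_smooth: "smooth1 (spike p s)"
    and spike_deriv: "(deriv ^^ l) (spike p s) t = exp (\<Phi> (s - 1) / p) * (deriv ^^ l) (bump 1 (-1) 1) (t - s)"
proof -
  define F where "F l t = exp (\<Phi> (s - 1) / p) * (deriv ^^ l) (bump 1 (-1) 1) (t - s)" for l t
  have F0: "F 0 = spike p s" by (simp add: F_def spike_def fun_eq_iff)
  have dF: "(F l has_real_derivative F (Suc l) t) (at t)" for l t
  proof -
    have "((\<lambda>t. (deriv ^^ l) (bump 1 (-1) 1) (t - s)) has_real_derivative (deriv ^^ Suc l) (bump 1 (-1) 1) (t - s) * 1) (at t)"
      by (rule DERIV_chain2[OF smooth1_deriv[OF bump_smooth]]) (auto intro!: derivative_eq_intros)
    from DERIV_cmult[OF this] show ?thesis unfolding F_def by simp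
  qed
  show "smooth1 (spike p s)" by (rule smooth1I[of F, OF F0 dF])
  show "(deriv ^^ l) (spike p s) t = exp (\<Phi> (s - 1) / p) * (deriv ^^ l) (bump 1 (-1) 1) (t - s)"
    unfolding smooth1_eq[of F, OF F0 dF] by (simp add: F_def)
qed

text \<open>For s \<ge> 2 the interval lies on the positive half-line, where the weight is largest
  at the left end; its length 2 gives the factor 2.\<close>

lemma nn_integral_mu_coord_le:
  fixes f :: "real \<Rightarrow> real" and i0 :: "'n::finite"
  assumes [measurable]: "f \<in> borel_measurable borel" and M: "0 \<le> M" "\<And>t. \<bar>f t\<bar> \<le> M" and supp: "\<And>t. \<not> (s - 1 \<le> t \<and> t \<le> s + 1) \<Longrightarrow> f t = 0"
    and r: "0 < r" and s: "2 \<le> s"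
  shows "(\<integral>\<^sup>+x. ennreal (\<bar>f (x $ i0)\<bar> powr r) \<partial>(mu_Phi_n \<Phi> :: (real ^ 'n) measure)) \<le> ennreal (2 * c_Phi \<Phi> * (M powr r * exp (- \<Phi> (s - 1))))"
proof -
  have c: "0 < c_Phi \<Phi>" by (rule c_Phi_pos[OF adm])
  have "(\<integral>\<^sup>+x. ennreal (\<bar>f (x $ i0)\<bar> powr r) \<partial>(mu_Phi_n \<Phi> :: (real ^ 'n) measure)) = (\<integral>\<^sup>+t. ennreal (c_Phi \<Phi> * exp (- \<Phi> \<bar>t\<bar>)) * ennreal (\<bar>f t\<bar> powr r) \<partial>lborel)"
    by (rule nn_integral_mu_coord[OF adm]) measurable
  also have "\<dots> \<le> (\<integral>\<^sup>+t. ennreal (c_Phi \<Phi> * (M powr r * exp (- \<Phi> (s - 1)))) * indicator {s - 1..s + 1} t \<partial>lborel)"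
  proof (intro nn_integral_mono)
    fix t
    show "ennreal (c_Phi \<Phi> * exp (- \<Phi> \<bar>t\<bar>)) * ennreal (\<bar>f t\<bar> powr r) \<le> ennreal (c_Phi \<Phi> * (M powr r * exp (- \<Phi> (s - 1)))) * indicator {s - 1..s + 1} t"
    proof (cases "s - 1 \<le> t \<and> t \<le> s + 1")
      case True
      then have "exp (- \<Phi> \<bar>t\<bar>) \<le> exp (- \<Phi> (s - 1))" using s Phi_mono[OF adm, of "s - 1" "\<bar>t\<bar>"] by simp
      moreover have "\<bar>f t\<bar> powr r \<le> M powr r" using M r by (intro powr_mono2) auto
      ultimately have "exp (- \<Phi> \<bar>t\<bar>) * \<bar>f t\<bar> powr r \<le> exp (- \<Phi> (s - 1)) * M powr r" by (intro mult_mono) auto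
      then have "c_Phi \<Phi> * exp (- \<Phi> \<bar>t\<bar>) * \<bar>f t\<bar> powr r \<le> c_Phi \<Phi> * (M powr r * exp (- \<Phi> (s - 1)))"
        using c by (simp add: mult.assoc mult.commute)
      then show ?thesis using True c by (simp add: ennreal_leI flip: ennreal_mult)
    next
      case False
      then show ?thesis using supp[of t] by simp
    qed
  qed
  also have "\<dots> = ennreal (2 * c_Phi \<Phi> * (M powr r * exp (- \<Phi> (s - 1))))"
    using c by (subst nn_integral_cmult_indicator) (auto simp: mult_ac simp flip: ennreal_mult ennreal_numeral)
  finally show ?thesis .
qed

text \<open>The height to the power \<open>r\<close> against the weight leaves the exponent
  \<Phi>(s-1) (r/p - 1), which is at most 0 for r \<le> p. Both r = 1 for the lower derivatives and
  r = p for the top one are covered.\<close>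

lemma spike_upper:
  fixes i0 :: "'n::finite" and p r B :: real
  assumes p: "1 \<le> p" and r: "1 \<le> r" "r \<le> p" and s: "2 \<le> s" and B: "0 \<le> B" "\<And>t. \<bar>(deriv ^^ l) (bump 1 (-1) 1) t\<bar> \<le> B"
  shows "(\<integral>\<^sup>+x. ennreal (\<bar>grad_norm (coord_derivs i0 (spike p s)) l x\<bar> powr r) \<partial>(mu_Phi_n \<Phi> :: (real ^ 'n) measure)) \<le> ennreal (2 * c_Phi \<Phi> * B powr r)"
    and "grad_norm (coord_derivs i0 (spike p s)) l \<in> borel_measurable borel"
proof -
  let ?A = "exp (\<Phi> (s - 1) / p)"
  let ?f = "(deriv ^^ l) (spike p s)"
  have c: "0 < c_Phi \<Phi>" by (rule c_Phi_pos[OF adm])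
  have f[measurable]: "?f \<in> borel_measurable borel"
    by (rule borel_measurable_continuous_onI[OF smooth1_continuous[OF spike_smooth]])
  have "(\<integral>\<^sup>+x. ennreal (\<bar>?f (x $ i0)\<bar> powr r) \<partial>(mu_Phi_n \<Phi> :: (real ^ 'n) measure)) \<le> ennreal (2 * c_Phi \<Phi> * ((?A * B) powr r * exp (- \<Phi> (s - 1))))"
  proof (rule nn_integral_mu_coord_le[OF f])
    show "\<bar>?f t\<bar> \<le> ?A * B" for t unfolding spike_deriv by (simp add: abs_mult B mult_left_mono)
    show "?f t = 0" if "\<not> (s - 1 \<le> t \<and> t \<le> s + 1)" for t
    proof -
      have ts: "\<not> (- 1 \<le> t - s \<and> t - s \<le> 1)" using that by auto
      show ?thesis unfolding spike_deriv by (simp add: bump_deriv_support[OF ts])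
    qed
  qed (use B r s in auto)
  also have "\<dots> \<le> ennreal (2 * c_Phi \<Phi> * B powr r)"
  proof (intro ennreal_leI mult_left_mono)
    have "(?A * B) powr r * exp (- \<Phi> (s - 1)) = B powr r * (exp (\<Phi> (s - 1) / p * r) * exp (- \<Phi> (s - 1)))"
      using B by (simp add: powr_mult exp_powr_real mult_ac)
    also have "exp (\<Phi> (s - 1) / p * r) * exp (- \<Phi> (s - 1)) \<le> 1"
    proof -
      have "\<Phi> (s - 1) * (r / p) \<le> \<Phi> (s - 1) * 1" using r p s Phi_nonneg[OF adm, of "s - 1"] by (intro mult_left_mono) auto
      then show ?thesis unfolding exp_add[symmetric] by simp
    qed
    then have "B powr r * (exp (\<Phi> (s - 1) / p * r) * exp (- \<Phi> (s - 1))) \<le> B powr r" by (intro mult_left_le) auto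
    finally show "(?A * B) powr r * exp (- \<Phi> (s - 1)) \<le> B powr r" .
  qed (use c in auto)
  finally show "(\<integral>\<^sup>+x. ennreal (\<bar>grad_norm (coord_derivs i0 (spike p s)) l x\<bar> powr r) \<partial>(mu_Phi_n \<Phi> :: (real ^ 'n) measure)) \<le> ennreal (2 * c_Phi \<Phi> * B powr r)"
    by (simp add: grad_norm_coord)
  have "(\<lambda>x :: real ^ 'n. \<bar>?f (x $ i0)\<bar>) \<in> borel_measurable borel" by measurable
  then show "grad_norm (coord_derivs i0 (spike p s)) l \<in> borel_measurable borel" unfolding grad_norm_coord .
qed

lemma spike_V_bound:
  fixes i0 :: "'n::finite" and p :: real
  assumes p: "1 \<le> p"
  obtains C where "\<And>s. 2 \<le> s \<Longrightarrow> in_VmLp \<Phi> m (ereal p) (\<lambda>x :: real ^ 'n. spike p s (x $ i0)) (coord_derivs i0 (spike p s))"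
    "\<And>s. 2 \<le> s \<Longrightarrow> VmLp_norm \<Phi> m (ereal p) (coord_derivs i0 (spike p s)) \<le> C"
proof -
  obtain B where B: "0 \<le> B" "\<And>l t. l \<le> m \<Longrightarrow> \<bar>(deriv ^^ l) (bump 1 (-1) 1) t\<bar> \<le> B" using bump_derivs_bounded by blast
  define c2 where "c2 = 2 * c_Phi \<Phi>"
  have c2: "0 < c2" using c_Phi_pos[OF adm] by (simp add: c2_def)
  have up: "(\<integral>\<^sup>+x. ennreal (\<bar>grad_norm (coord_derivs i0 (spike p s)) l x\<bar> powr r) \<partial>(mu_Phi_n \<Phi> :: (real ^ 'n) measure)) \<le> ennreal ((c2 powr (1 / r) * B) powr r)"
    if "2 \<le> s" "l \<le> m" "1 \<le> r" "r \<le> p" for s l r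
  proof -
    have "(c2 powr (1 / r) * B) powr r = c2 * B powr r" using that c2 B by (simp add: powr_mult powr_powr)
    then show ?thesis using spike_upper(1)[OF p that(3,4,1) B(1) B(2)[OF that(2)], of i0] by (simp add: c2_def)
  qed
  have bm: "grad_norm (coord_derivs i0 (spike p s)) l \<in> borel_measurable borel" if "2 \<le> s" "l \<le> m" for s l
    by (rule spike_upper(2)[OF p order_refl p that(1) B(1) B(2)[OF that(2)]])
  have mem: "memLp (mu_Phi_n \<Phi>) (ereal r) (grad_norm (coord_derivs i0 (spike p s)) l)" if "2 \<le> s" "l \<le> m" "1 \<le> r" "r \<le> p" for s l r
    using up[OF that] by (intro memLp_finiteI[OF adm bm[OF that(1,2)]]) (auto simp: le_less_trans)
  have le: "Lnorm (mu_Phi_n \<Phi>) (ereal r) (grad_norm (coord_derivs i0 (spike p s)) l) \<le> c2 powr (1 / r) * B" if "2 \<le> s" "l \<le> m" "1 \<le> r" "r \<le> p" for s l r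
    using that B by (intro Lnorm_le[OF adm bm[OF that(1,2)] _ _ up[OF that]]) auto
  show thesis
  proof (rule that)
    fix s :: real assume s: "2 \<le> s"
    show "in_VmLp \<Phi> m (ereal p) (\<lambda>x :: real ^ 'n. spike p s (x $ i0)) (coord_derivs i0 (spike p s))"
      unfolding in_VmLp_def one_ereal_def using p s by (auto intro!: weak_derivs_coord spike_smooth mem)
    have "(\<Sum>k<m. Lnorm (mu_Phi_n \<Phi>) (ereal 1) (grad_norm (coord_derivs i0 (spike p s)) k)) \<le> (\<Sum>k<m. c2 powr (1 / 1) * B)"
      using s p by (intro sum_mono le) auto
    then show "VmLp_norm \<Phi> m (ereal p) (coord_derivs i0 (spike p s)) \<le> (\<Sum>k<m. c2 powr (1 / 1) * B) + c2 powr (1 / p) * B"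
      unfolding VmLp_norm_def one_ereal_def using le[OF s order_refl p order_refl] by (intro add_mono) auto
  qed
qed

text \<open>On the middle interval of length 1 the bump is at least \<open>exp (- 4)\<close> and
  exp(-\<Phi>) at least its value at s + 1. The exponent that remains is the quantity the growth
  lemmas bound from below.\<close>

lemma spike_lower:
  fixes i0 :: "'n::finite" and p q :: real
  assumes q: "1 \<le> q" and s: "2 \<le> s"
  shows "ennreal (c_Phi \<Phi> * (exp (- 4) powr q * exp (q / p * \<Phi> (s - 1) - \<Phi> (s + 1)))) \<le> (\<integral>\<^sup>+x. ennreal (\<bar>spike p s (x $ i0)\<bar> powr q) \<partial>(mu_Phi_n \<Phi> :: (real ^ 'n) measure))"
proof -
  have c: "0 < c_Phi \<Phi>" by (rule c_Phi_pos[OF adm])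
  have [measurable]: "spike p s \<in> borel_measurable borel"
    using borel_measurable_continuous_onI[OF smooth1_continuous[OF spike_smooth, of 0]] by simp
  let ?L = "c_Phi \<Phi> * (exp (- 4) powr q * exp (q / p * \<Phi> (s - 1) - \<Phi> (s + 1)))"
  have "ennreal ?L = (\<integral>\<^sup>+t. ennreal ?L * indicator {s - 1/2..s + 1/2} t \<partial>lborel)"
    by (subst nn_integral_cmult_indicator) auto
  also have "\<dots> \<le> (\<integral>\<^sup>+t. ennreal (c_Phi \<Phi> * exp (- \<Phi> \<bar>t\<bar>)) * ennreal (\<bar>spike p s t\<bar> powr q) \<partial>lborel)"
  proof (intro nn_integral_mono)
    fix t
    show "ennreal ?L * indicator {s - 1/2..s + 1/2} t \<le> ennreal (c_Phi \<Phi> * exp (- \<Phi> \<bar>t\<bar>)) * ennreal (\<bar>spike p s t\<bar> powr q)"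
    proof (cases "t \<in> {s - 1/2..s + 1/2}")
      case True
      then have ts: "\<bar>t - s\<bar> \<le> 1 / 2" unfolding atLeastAtMost_iff by linarith
      have "exp (\<Phi> (s - 1) / p) * exp (- 4) \<le> spike p s t"
        unfolding spike_def by (intro mult_left_mono bump_lower ts) auto
      then have "(exp (\<Phi> (s - 1) / p) * exp (- 4)) powr q \<le> \<bar>spike p s t\<bar> powr q"
        using q by (intro powr_mono2) auto
      moreover have "(exp (\<Phi> (s - 1) / p) * exp (- 4)) powr q = exp (- 4) powr q * exp (q / p * \<Phi> (s - 1))"
        by (simp add: powr_mult exp_powr_real mult_ac)
      moreover have "exp (- \<Phi> (s + 1)) \<le> exp (- \<Phi> \<bar>t\<bar>)"
        using True s Phi_mono[OF adm, of "\<bar>t\<bar>" "s + 1"] by auto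
      ultimately have "exp (- \<Phi> (s + 1)) * (exp (- 4) powr q * exp (q / p * \<Phi> (s - 1))) \<le> exp (- \<Phi> \<bar>t\<bar>) * \<bar>spike p s t\<bar> powr q"
        by (intro mult_mono) auto
      moreover have "exp (q / p * \<Phi> (s - 1) - \<Phi> (s + 1)) = exp (- \<Phi> (s + 1)) * exp (q / p * \<Phi> (s - 1))"
        unfolding exp_add[symmetric] by simp
      ultimately have "exp (- 4) powr q * exp (q / p * \<Phi> (s - 1) - \<Phi> (s + 1)) \<le> exp (- \<Phi> \<bar>t\<bar>) * \<bar>spike p s t\<bar> powr q"
        by (simp only: mult_ac)
      then have "?L \<le> (c_Phi \<Phi> * exp (- \<Phi> \<bar>t\<bar>)) * \<bar>spike p s t\<bar> powr q"
        unfolding mult.assoc using c by (intro mult_left_mono) auto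
      then show ?thesis using True c by (simp add: ennreal_leI flip: ennreal_mult)
    qed simp
  qed
  also have "\<dots> = (\<integral>\<^sup>+x. ennreal (\<bar>spike p s (x $ i0)\<bar> powr q) \<partial>(mu_Phi_n \<Phi> :: (real ^ 'n) measure))"
    by (rule nn_integral_mu_coord[OF adm, symmetric]) measurable
  finally show ?thesis .
qed

text \<open>The spikes are bounded in the Sobolev norm, have disjoint supports, and the growth condition keeps
  their norms in \<open>L\<^sup>q\<close> away from zero.\<close>

lemma not_compact_emb_spikes:
  fixes p q \<eta> s0 :: real
  assumes p: "1 \<le> p" and q: "1 \<le> q" and growth: "\<And>s. s0 \<le> s \<Longrightarrow> - \<eta> \<le> q / p * \<Phi> (s - 1) - \<Phi> (s + 1)"
  shows "\<not> compact_emb \<Phi> TYPE('n::finite) m (ereal p) (ereal q)"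
proof
  note [measurable_cong] = sets_mu[OF adm]
  assume ce: "compact_emb \<Phi> TYPE('n) m (ereal p) (ereal q)"
  obtain i0 :: 'n where True by simp
  \<comment> \<open>The spacing 2 is the width of a bump, so supports meet at most in end points,
    where the bumps vanish; the offset puts every centre in the range of the upper and lower
    estimates.\<close>
  define s where "s j = max 2 s0 + 2 * real j" for j :: nat
  have s2: "2 \<le> s j" "s0 \<le> s j" for j by (auto simp: s_def)
  define u where "u j x = spike p (s j) (x $ i0)" for j and x :: "real ^ 'n"
  define D where "D j = coord_derivs i0 (spike p (s j))" for j
  obtain C where C: "\<And>s. 2 \<le> s \<Longrightarrow> in_VmLp \<Phi> m (ereal p) (\<lambda>x :: real ^ 'n. spike p s (x $ i0)) (coord_derivs i0 (spike p s))"
    "\<And>s. 2 \<le> s \<Longrightarrow> VmLp_norm \<Phi> m (ereal p) (coord_derivs i0 (spike p s)) \<le> C"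
    using spike_V_bound[OF p, of m i0] by blast
  have uV: "in_VmLp \<Phi> m (ereal p) (u j) (D j)" "VmLp_norm \<Phi> m (ereal p) (D j) \<le> C" for j
    using C[OF s2(1)[of j]] by (simp_all add: u_def[abs_def] D_def)
  obtain r g where r: "strict_mono (r :: nat \<Rightarrow> nat)" and g: "memLp (mu_Phi_n \<Phi>) (ereal q) g"
    and lim: "(\<lambda>j. Lnorm (mu_Phi_n \<Phi>) (ereal q) (\<lambda>x. u (r j) x - g x)) \<longlonglongrightarrow> 0"
    using ce uV unfolding compact_emb_def by blast
  have umem: "memLp (mu_Phi_n \<Phi>) (ereal q) (u j)" for j
    using ce uV unfolding compact_emb_def by blast
  note [measurable] = memLp_borel[OF adm g] memLp_borel[OF adm umem]
  have fin: "(\<integral>\<^sup>+x. ennreal (\<bar>f x\<bar> powr q) \<partial>mu_Phi_n \<Phi>) < \<infinity>" if "memLp (mu_Phi_n \<Phi>) (ereal q) f" for f :: "real ^ 'n \<Rightarrow> real"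
    using nn_integral_powr_Lnorm[OF adm that] q by simp
  have dmem: "memLp (mu_Phi_n \<Phi>) (ereal q) (\<lambda>x. u j x - g x)" for j
  proof (rule memLp_finiteI[OF adm])
    have "(\<integral>\<^sup>+x. ennreal (\<bar>u j x - g x\<bar> powr q) * indicator UNIV x \<partial>mu_Phi_n \<Phi>) \<le> ennreal (2 powr q) * ((\<integral>\<^sup>+x. ennreal (\<bar>u j x\<bar> powr q) * indicator UNIV x \<partial>mu_Phi_n \<Phi>) + (\<integral>\<^sup>+x. ennreal (\<bar>g x\<bar> powr q) * indicator UNIV x \<partial>mu_Phi_n \<Phi>))"
      using q by (intro nn_integral_powr_add_le) (auto simp: sets_mu[OF adm])
    also have "\<dots> < \<infinity>" using fin[OF umem[of j]] fin[OF g] by (simp add: ennreal_mult_less_top)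
    finally show "(\<integral>\<^sup>+x. ennreal (\<bar>u j x - g x\<bar> powr q) \<partial>mu_Phi_n \<Phi>) < \<infinity>" by simp
  qed measurable
  define L where "L j = Lnorm (mu_Phi_n \<Phi>) (ereal q) (\<lambda>x. u (r j) x - g x)" for j
  define \<delta> where "\<delta> = c_Phi \<Phi> * (exp (- 4) powr q * exp (- \<eta>))"
  have \<delta>: "0 < \<delta>" using c_Phi_pos[OF adm] by (simp add: \<delta>_def)
  have low: "ennreal \<delta> \<le> (\<integral>\<^sup>+x. ennreal (\<bar>u j x\<bar> powr q) \<partial>mu_Phi_n \<Phi>)" for j
  proof -
    have "\<delta> \<le> c_Phi \<Phi> * (exp (- 4) powr q * exp (q / p * \<Phi> (s j - 1) - \<Phi> (s j + 1)))"
      unfolding \<delta>_def using growth[OF s2(2)[of j]] c_Phi_pos[OF adm] by (intro mult_left_mono) auto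
    then show ?thesis using spike_lower[OF q s2(1)[of j], of p i0] unfolding u_def by (meson ennreal_leI order_trans)
  qed
  have disj: "u i x = 0 \<or> u j x = 0" if "i < j" for i j x
  proof -
    have "s i + 2 \<le> s j" using that by (simp add: s_def)
    then have "\<not> (-1 < x $ i0 - s i \<and> x $ i0 - s i < 1) \<or> \<not> (-1 < x $ i0 - s j \<and> x $ i0 - s j < 1)" by linarith
    then show ?thesis unfolding u_def spike_def by (auto intro!: bump_outside)
  qed
  \<comment> \<open>Where one spike is nonzero the next one vanishes, so the moment of their
    difference is at least that of the first; yet both approach \<open>g\<close> along the
    subsequence.\<close>
  have le: "\<delta> \<le> 2 powr q * (L j powr q + L (Suc j) powr q)" for j
  proof -
    have "ennreal \<delta> \<le> (\<integral>\<^sup>+x. ennreal (\<bar>u (r j) x\<bar> powr q) \<partial>mu_Phi_n \<Phi>)" by (rule low)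
    also have "\<dots> \<le> (\<integral>\<^sup>+x. ennreal (\<bar>u (r j) x - u (r (Suc j)) x\<bar> powr q) * indicator UNIV x \<partial>mu_Phi_n \<Phi>)"
    proof (intro nn_integral_mono)
      fix x
      have "u (r j) x = 0 \<or> u (r (Suc j)) x = 0" using r by (intro disj) (simp add: strict_mono_def)
      then show "ennreal (\<bar>u (r j) x\<bar> powr q) \<le> ennreal (\<bar>u (r j) x - u (r (Suc j)) x\<bar> powr q) * indicator UNIV x"
        by auto
    qed
    also have "\<dots> \<le> ennreal (2 powr q) * ((\<integral>\<^sup>+x. ennreal (\<bar>u (r j) x - g x\<bar> powr q) * indicator UNIV x \<partial>mu_Phi_n \<Phi>) + (\<integral>\<^sup>+x. ennreal (\<bar>u (r (Suc j)) x - g x\<bar> powr q) * indicator UNIV x \<partial>mu_Phi_n \<Phi>))"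
      using q by (intro nn_integral_powr_add_le) (auto simp: sets_mu[OF adm])
    also have "\<dots> = ennreal (2 powr q) * (ennreal (L j powr q) + ennreal (L (Suc j) powr q))"
      using q unfolding L_def by (simp add: nn_integral_powr_Lnorm[OF adm dmem])
    also have "\<dots> = ennreal (2 powr q * (L j powr q + L (Suc j) powr q))"
      by (simp flip: ennreal_plus ennreal_mult)
    finally show ?thesis by (simp add: ennreal_le_iff)
  qed
  have "(\<lambda>j. 2 powr q * (L j powr q + L (Suc j) powr q)) \<longlonglongrightarrow> 2 powr q * (0 powr q + 0 powr q)"
  proof -
    have L0: "L \<longlonglongrightarrow> 0" using lim by (simp add: L_def[abs_def])
    have Ln: "0 \<le> L j" for j unfolding L_def by (rule Lnorm_nonneg[OF adm]) measurable
    show ?thesis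
      using L0 LIMSEQ_Suc[OF L0] Ln q by (intro tendsto_mult tendsto_add tendsto_const tendsto_powr') auto
  qed
  then have "\<delta> \<le> 2 powr q * (0 powr q + 0 powr q)" by (rule LIMSEQ_le_const) (use le in blast)
  then show False using \<delta> by simp
qed

text \<open>The root of \<Phi> is concave and vanishes at 0, so its value at s - 1 is at least
  (s-1)/(s+1) times its value at s + 1. Squaring gives a lower bound for the ratio of \<Phi> at the
  two points that tends to 1 and thus eventually exceeds p/q.\<close>

lemma growth_strict:
  fixes p q :: real
  assumes p: "1 \<le> p" and q: "p < q"
  obtains s0 where "\<And>s. s0 \<le> s \<Longrightarrow> 0 \<le> q / p * \<Phi> (s - 1) - \<Phi> (s + 1)"
proof -
  have conc: "concave_on {0..} (\<lambda>x. sqrt (\<Phi> x))" using adm by (simp add: admissible_Phi_def)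
  have sq: "((s - 1) / (s + 1))\<^sup>2 * \<Phi> (s + 1) \<le> \<Phi> (s - 1)" if s: "1 \<le> s" for s
  proof -
    let ?t = "(s - 1) / (s + 1)"
    have t: "0 \<le> ?t" "?t \<le> 1" using s by auto
    have "sqrt (\<Phi> ((1 - ?t) *\<^sub>R 0 + ?t *\<^sub>R (s + 1))) \<ge> (1 - ?t) * sqrt (\<Phi> 0) + ?t * sqrt (\<Phi> (s + 1))"
      using s t by (intro concave_onD[OF conc]) auto
    then have "?t * sqrt (\<Phi> (s + 1)) \<le> sqrt (\<Phi> (s - 1))" using s Phi_0[OF adm] by simp
    then have "(?t * sqrt (\<Phi> (s + 1)))\<^sup>2 \<le> (sqrt (\<Phi> (s - 1)))\<^sup>2"
      using s Phi_nonneg[OF adm, of "s + 1"] by (intro power_mono) auto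
    moreover have "(?t * sqrt (\<Phi> (s + 1)))\<^sup>2 = ?t\<^sup>2 * \<Phi> (s + 1)"
      using s Phi_nonneg[OF adm, of "s + 1"] unfolding power_mult_distrib by simp
    moreover have "(sqrt (\<Phi> (s - 1)))\<^sup>2 = \<Phi> (s - 1)" using s Phi_nonneg[OF adm, of "s - 1"] by simp
    ultimately show ?thesis by (simp only:)
  qed
  have "((\<lambda>s::real. (1 - 2 * inverse (s + 1))\<^sup>2) \<longlongrightarrow> (1 - 2 * 0)\<^sup>2) at_top"
    by (intro tendsto_intros tendsto_inverse_0_at_top filterlim_at_top_add_at_top filterlim_ident filterlim_tendsto_add_at_top[OF tendsto_const filterlim_ident, of 1, simplified add.commute])
  then have "eventually (\<lambda>s::real. p / q < (1 - 2 * inverse (s + 1))\<^sup>2) at_top"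
    using p q by (intro order_tendstoD) auto
  then obtain s1 :: real where s1: "\<And>s. s1 \<le> s \<Longrightarrow> p / q < (1 - 2 * inverse (s + 1))\<^sup>2" by (auto simp: eventually_at_top_linorder)
  show thesis
  proof (rule that[of "max 1 s1"])
    fix s assume s: "max 1 s1 \<le> s"
    have "1 - 2 * inverse (s + 1) = (s - 1) / (s + 1)" using s by (simp add: field_simps)
    then have "p / q \<le> ((s - 1) / (s + 1))\<^sup>2" using s1[of s] s by simp
    then have "p / q * \<Phi> (s + 1) \<le> ((s - 1) / (s + 1))\<^sup>2 * \<Phi> (s + 1)" using s Phi_nonneg[OF adm, of "s + 1"] by (intro mult_right_mono) auto
    also have "\<dots> \<le> \<Phi> (s - 1)" using s by (intro sq) simp
    finally have "q / p * (p / q * \<Phi> (s + 1)) \<le> q / p * \<Phi> (s - 1)" using p q by (intro mult_left_mono) auto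
    then show "0 \<le> q / p * \<Phi> (s - 1) - \<Phi> (s + 1)" using p q by simp
  qed
qed

text \<open>A convex function with linear growth has bounded increments over intervals of length 2:
  the increment is controlled by the chord to a distant point \<open>T\<close>, and the slope of
  that chord by the linear bound at \<open>T\<close>.\<close>

lemma growth_linear:
  fixes p q L :: real
  assumes p: "1 \<le> p" and q: "p \<le> q" and L: "0 < L" "((\<lambda>s. s / \<Phi> s) \<longlongrightarrow> L) at_top"
  obtains s0 \<eta> where "\<And>s. s0 \<le> s \<Longrightarrow> - \<eta> \<le> q / p * \<Phi> (s - 1) - \<Phi> (s + 1)"
proof -
  define C where "C = 2 / L"
  have C: "0 < C" using L by (simp add: C_def)
  have "eventually (\<lambda>s. L / 2 < s / \<Phi> s) at_top" using L by (intro order_tendstoD) auto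
  then have "eventually (\<lambda>s. \<Phi> s \<le> C * s) at_top"
    using eventually_gt_at_top[of 0]
  proof eventually_elim
    case (elim s)
    then show ?case using L Phi_pos[OF adm, of s] by (simp add: C_def field_simps)
  qed
  then obtain s1 where s1: "\<And>s. s1 \<le> s \<Longrightarrow> \<Phi> s \<le> C * s" by (auto simp: eventually_at_top_linorder)
  show thesis
  proof (rule that[of 1 "4 * C"])
    fix s :: real assume s: "1 \<le> s"
    \<comment> \<open>At least twice s - 1, so that \<open>l * T\<close> stays below 4, and large
      enough for the linear bound on \<Phi>. The weight \<open>l\<close> is chosen so that s + 1 is
      the convex combination of s - 1 and \<open>T\<close>.\<close>
    define T where "T = max (2 * s + 2) s1"
    have T: "2 * s + 2 \<le> T" "s1 \<le> T" by (auto simp: T_def)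
    define l where "l = 2 / (T - (s - 1))"
    have l: "0 \<le> l" "l \<le> 1" using T s by (auto simp: l_def)
    have "(1 - l) *\<^sub>R (s - 1) + l *\<^sub>R T = (s - 1) + l * (T - (s - 1))" by (simp add: algebra_simps)
    also have "\<dots> = s + 1"
    proof -
      have "T - (s - 1) \<noteq> 0" using T s by linarith
      moreover have "2 / d * d = 2" if "d \<noteq> 0" for d :: real using that by simp
      ultimately have "l * (T - (s - 1)) = 2" unfolding l_def by blast
      then show ?thesis by simp
    qed
    finally have "\<Phi> (s + 1) \<le> (1 - l) * \<Phi> (s - 1) + l * \<Phi> T"
      using convex_onD[OF Phi_convex[OF adm], of l "s - 1" T] l s T by simp
    moreover have "(1 - l) * \<Phi> (s - 1) \<le> 1 * \<Phi> (s - 1)" using l s Phi_nonneg[OF adm, of "s - 1"] by (intro mult_right_mono) auto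
    moreover have "l * \<Phi> T \<le> 4 * C"
    proof -
      have "l * \<Phi> T \<le> l * (C * T)" using l s1[OF T(2)] by (intro mult_left_mono)
      also have "\<dots> = (l * T) * C" by simp
      also have "l * T \<le> 4" using T s by (simp add: l_def field_simps)
      then have "(l * T) * C \<le> 4 * C" using C by (intro mult_right_mono) auto
      finally show ?thesis .
    qed
    moreover have "1 * \<Phi> (s - 1) \<le> q / p * \<Phi> (s - 1)" using p q s Phi_nonneg[OF adm, of "s - 1"] by (intro mult_right_mono) auto
    ultimately show "- (4 * C) \<le> q / p * \<Phi> (s - 1) - \<Phi> (s + 1)" by linarith
  qed
qed

section \<open>The two characterisations\<close>

lemma memLp_mono:
  fixes f :: "real ^ 'n::finite \<Rightarrow> real" and p r :: real
  assumes r: "1 \<le> r" "r \<le> p" and f: "memLp (mu_Phi_n \<Phi>) (ereal p) f"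
  shows "memLp (mu_Phi_n \<Phi>) (ereal r) f"
proof (rule memLp_finiteI[OF adm memLp_borel[OF adm f]])
  have "(\<integral>\<^sup>+x. ennreal (\<bar>f x\<bar> powr r) \<partial>mu_Phi_n \<Phi>) \<le> ennreal (1 + Lnorm (mu_Phi_n \<Phi>) (ereal p) f powr real_of_ereal (ereal p) + Lnorm (mu_Phi_n \<Phi>) (ereal p) f powr r)"
    using r by (intro Lnorm_bound[OF adm f order_refl]) auto
  then show "(\<integral>\<^sup>+x. ennreal (\<bar>f x\<bar> powr r) \<partial>mu_Phi_n \<Phi>) < \<infinity>" by (simp add: le_less_trans)
qed

lemma compact_emb_superlinear_iff:
  fixes p q :: ereal
  assumes m: "1 \<le> m" and p: "1 \<le> p" and q: "1 \<le> q" and sup: "((\<lambda>s. s / \<Phi> s) \<longlongrightarrow> 0) at_top"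
  shows "compact_emb \<Phi> TYPE('n::finite) m p q \<longleftrightarrow> q \<le> p \<and> q < \<infinity>"
proof
  assume ce: "compact_emb \<Phi> TYPE('n) m p q"
  have "q \<noteq> \<infinity>" using ce not_compact_emb_infinity[OF adm m p] by auto
  then obtain q' where q': "q = ereal q'" "1 \<le> q'" using q by (cases q) auto
  show "q \<le> p \<and> q < \<infinity>"
  proof (rule ccontr)
    assume "\<not> (q \<le> p \<and> q < \<infinity>)"
    then have "p < q" using q' by auto
    then obtain p' where p': "p = ereal p'" "1 \<le> p'" "p' < q'" using q' p by (cases p) auto
    obtain s0 where "\<And>s. s0 \<le> s \<Longrightarrow> 0 \<le> q' / p' * \<Phi> (s - 1) - \<Phi> (s + 1)" using growth_strict[OF p'(2,3)] by blast
    then have "\<not> compact_emb \<Phi> TYPE('n) m (ereal p') (ereal q')" by (intro not_compact_emb_spikes[where \<eta>=0]) (use p' q' in auto)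
    then show False using ce p' q' by simp
  qed
next
  assume qp: "q \<le> p \<and> q < \<infinity>"
  then obtain q' where "q = ereal q'" "1 \<le> q'" using q by (cases q) auto
  then show "compact_emb \<Phi> TYPE('n) m p q" using compact_emb_superlinear[OF adm m _ _ sup, of q' p] qp by simp
qed

lemma compact_emb_linear_iff:
  fixes p q :: ereal
  assumes m: "1 \<le> m" and p: "1 \<le> p" and q: "1 \<le> q" and L: "0 < L" "((\<lambda>s. s / \<Phi> s) \<longlongrightarrow> L) at_top"
  shows "compact_emb \<Phi> TYPE('n::finite) m p q \<longleftrightarrow> q < p"
proof
  assume ce: "compact_emb \<Phi> TYPE('n) m p q"
  have "q \<noteq> \<infinity>" using ce not_compact_emb_infinity[OF adm m p] by auto
  then obtain q' where q': "q = ereal q'" "1 \<le> q'" using q by (cases q) auto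
  show "q < p"
  proof (rule ccontr)
    assume "\<not> q < p"
    then obtain p' where p': "p = ereal p'" "1 \<le> p'" "p' \<le> q'" using q' p by (cases p) auto
    obtain s0 \<eta> where "\<And>s. s0 \<le> s \<Longrightarrow> - \<eta> \<le> q' / p' * \<Phi> (s - 1) - \<Phi> (s + 1)" using growth_linear[OF p'(2,3) L] by blast
    then have "\<not> compact_emb \<Phi> TYPE('n) m (ereal p') (ereal q')" by (intro not_compact_emb_spikes) (use p' q' in auto)
    then show False using ce p' q' by simp
  qed
next
  assume qp: "q < p"
  then obtain q' where q': "q = ereal q'" "1 \<le> q'" using q by (cases q) auto
  \<comment> \<open>For finite \<open>p\<close> the exponent \<open>p\<close> itself will do; for p
    = \<infinity> any larger real number serves, here q' + 1.\<close>
  obtain r where r: "q' < r" "ereal r \<le> p" using qp q'(1) by (cases p) (auto intro: that[of "q' + 1"])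
  show "compact_emb \<Phi> TYPE('n) m p q" unfolding q'(1) by (rule compact_emb_subcritical[OF adm m q'(2) r])
qed

end

text \<open>The word smallest is rendered by inclusion: L^p is itself an admissible target and is
  contained in every admissible L^r. The inclusion rests on r \<le> p, by the characterisation
  applied to \<open>r\<close>, and on the finiteness of the measure.\<close>

theorem theorem7p9:
  fixes \<Phi> :: "real \<Rightarrow> real" and m :: nat and p q :: ereal
  assumes Phi: "admissible_Phi \<Phi>"
    and m: "m \<ge> 1"
    and p: "1 \<le> p" and q: "1 \<le> q"
  shows "(((\<lambda>s. s / \<Phi> s) \<longlongrightarrow> 0) at_top \<longrightarrow>
            (compact_emb \<Phi> TYPE('n::finite) m p q \<longleftrightarrow> q \<le> p \<and> q < \<infinity>) \<and>
            (p < \<infinity> \<longrightarrow> compact_emb \<Phi> TYPE('n) m p p \<and>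
               (\<forall>r\<ge>1. compact_emb \<Phi> TYPE('n) m p r \<longrightarrow>
                  {f :: real ^ 'n \<Rightarrow> real. memLp (mu_Phi_n \<Phi>) p f}
                    \<subseteq> {f. memLp (mu_Phi_n \<Phi>) r f})))
       \<and> ((\<exists>L>0. ((\<lambda>s. s / \<Phi> s) \<longlongrightarrow> L) at_top) \<longrightarrow>
            (compact_emb \<Phi> TYPE('n) m p q \<longleftrightarrow> q < p))"
proof (intro conjI impI allI)
  assume sup: "((\<lambda>s. s / \<Phi> s) \<longlongrightarrow> 0) at_top"
  show "compact_emb \<Phi> TYPE('n) m p q \<longleftrightarrow> q \<le> p \<and> q < \<infinity>"
    by (rule compact_emb_superlinear_iff[OF Phi m p q sup])
  assume fin: "p < \<infinity>"
  show "compact_emb \<Phi> TYPE('n) m p p"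
    using compact_emb_superlinear_iff[OF Phi m p p sup] fin by simp
  fix r :: ereal assume r: "1 \<le> r" and "compact_emb \<Phi> TYPE('n) m p r"
  then have "r \<le> p" "r < \<infinity>" using compact_emb_superlinear_iff[OF Phi m p r sup] by auto
  then obtain r' p' where rp: "r = ereal r'" "p = ereal p'" "1 \<le> r'" "r' \<le> p'"
    using r p fin by (cases r; cases p) auto
  show "{f :: real ^ 'n \<Rightarrow> real. memLp (mu_Phi_n \<Phi>) p f} \<subseteq> {f. memLp (mu_Phi_n \<Phi>) r f}"
    unfolding rp(1,2) using memLp_mono[OF Phi rp(3,4)] by auto
next
  assume "\<exists>L>0. ((\<lambda>s. s / \<Phi> s) \<longlongrightarrow> L) at_top"
  then show "compact_emb \<Phi> TYPE('n) m p q \<longleftrightarrow> q < p"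
    using compact_emb_linear_iff[OF Phi m p q] by blast
qed

end
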